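(* Let $\mathcal{F}$ be a simply generated family with weight sequence $(\phi_m)_{m\ge0}$, $\Phi(x)=\sum_m\phi_mx^m$ with radius of convergence $R$; suppose there is $\tau\in(0,R]$ with $\tau\Phi'(\tau)=\Phi(\tau)$ and that the corresponding offspring distribution $\xi$ (given by $\mathbb{P}(\xi=m)=\phi_m\tau^m/\Phi(\tau)$) satisfies $\mathbb{V}(\xi)<\infty$. Let $J_n$ be the number of distinct plane trees represented by the fringe subtrees of a random tree $T_n$ of size $n$ from $\mathcal{F}$. Set $\kappa=2\tau^{-1}\Phi(\tau)^{1/2}(2\pi\Phi''(\tau))^{-1/2}$. Let $M=\{k\ge0:\phi_k>0\}$, $\Psi(x)=\sum_{k\in M}x^k$, and let $\upsilon$ be the solution of $\upsilon\Psi'(\upsilon)=\Psi(\upsilon)$. Set $C_1=\log(\Psi'(\upsilon))$ and $C_2=-\mu$, where $\mu=\sum_{m\in M}\mathbb{P}(\xi=m)\log\mathbb{P}(\xi=m)$. Then (i) $\kappa\sqrt{C_2}\frac{n}{\sqrt{\log n}}(1+o(1))\le\mathbb{E}(J_n)\le\kappa\sqrt{C_1}\frac{n}{\sqrt{\log n}}(1+o(1))$; (ii) with probability tending to $1$, $\kappa\sqrt{C_2}\frac{n}{\sqrt{\log n}}(1+o(1))\le J_n\le\kappa\sqrt{C_1}\frac{n}{\sqrt{\log n}}(1+o(1))$.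
   Context: A simply generated family: a plane tree $t$ has weight $\prod_v\phi_{\deg(v)}$, and the underlying plane tree of a random tree of size $n$ (vertices) from the family is chosen with probability proportional to its weight; each tree of the family has an associated plane representation (e.g. $d$-ary trees forget positions of children, labelled trees order children by labels and forget labels). Two fringe subtrees (vertex plus all descendants) count as the same if their plane representations coincide. *)

theory Defs
  imports "HOL-Probability.Probability"
begin

datatype plane_tree = Node "plane_tree list"

fun num_vertices :: "plane_tree \<Rightarrow> nat" where
  "num_vertices (Node ts) = Suc (sum_list (map num_vertices ts))"

fun weight :: "(nat \<Rightarrow> real) \<Rightarrow> plane_tree \<Rightarrow> real" where
  "weight \<phi> (Node ts) = \<phi> (length ts) * prod_list (map (weight \<phi>) ts)"

fun fringe_subtrees :: "plane_tree \<Rightarrow> plane_tree set" where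
  "fringe_subtrees (Node ts) = insert (Node ts) (\<Union>t\<in>set ts. fringe_subtrees t)"

definition total_weight :: "(nat \<Rightarrow> real) \<Rightarrow> nat \<Rightarrow> real" where
  "total_weight \<phi> n = (\<Sum>t | num_vertices t = n. weight \<phi> t)"

text \<open>The sum in the previous definition is over a finite set, so it is not zero by convention.\<close>

lemma finite_plane_trees_of_size: "finite {t. num_vertices t = n}"
proof (induction n rule: less_induct)
  case (less n)
  let ?A = "\<Union>k<n. {t. num_vertices t = k}"
  have "{t. num_vertices t = n} \<subseteq> Node ` {ts. set ts \<subseteq> ?A \<and> length ts \<le> n}"
  proof
    fix t assume "t \<in> {t. num_vertices t = n}"
    then have n: "num_vertices t = n" by simp
    obtain ts where t: "t = Node ts" by (cases t)
    have pos: "1 \<le> num_vertices s" for s by (cases s) simp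
    have "num_vertices s < n" if "s \<in> set ts" for s
      using member_le_sum_list[of "num_vertices s" "map num_vertices ts"] that n t by auto
    moreover have "length ts \<le> sum_list (map num_vertices ts)"
      using sum_list_mono[of ts "\<lambda>_. 1" num_vertices] pos
      by (simp add: sum_list_triv)
    ultimately show "t \<in> Node ` {ts. set ts \<subseteq> ?A \<and> length ts \<le> n}"
      using n t by auto
  qed
  moreover have "finite ?A" using less.IH by auto
  ultimately show ?case
    by (rule finite_subset[OF _ finite_imageI[OF finite_lists_length_le]])
qed

text \<open>
  The trees of the family are objects of an arbitrary type \<open>'a\<close> (plane trees, \<open>d\<close>-ary trees,
  labelled trees, ...). \<open>plane_rep\<close> is the plane representation, \<open>fringe t\<close> is the set of fringe
  subtrees of \<open>t\<close>, and \<open>T n\<close> is the law of the random tree of size \<open>n\<close>, constrained only for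
  those \<open>n\<close> for which the family contains a tree with \<open>n\<close> vertices.
\<close>

definition simply_generated_family ::
  "(nat \<Rightarrow> real) \<Rightarrow> ('a \<Rightarrow> plane_tree) \<Rightarrow> ('a \<Rightarrow> 'a set) \<Rightarrow> (nat \<Rightarrow> 'a pmf) \<Rightarrow> bool" where
  "simply_generated_family \<phi> plane_rep fringe T \<longleftrightarrow>
     (\<forall>m. 0 \<le> \<phi> m) \<and>
     (\<forall>n. total_weight \<phi> n > 0 \<longrightarrow>
        (\<forall>s. pmf (map_pmf plane_rep (T n)) s =
               (if num_vertices s = n then weight \<phi> s / total_weight \<phi> n else 0)) \<and>
        (\<forall>t\<in>set_pmf (T n). plane_rep ` fringe t = fringe_subtrees (plane_rep t)))"

definition num_distinct_fringe :: "('a \<Rightarrow> plane_tree) \<Rightarrow> ('a \<Rightarrow> 'a set) \<Rightarrow> 'a \<Rightarrow> nat" where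
  "num_distinct_fringe plane_rep fringe t = card (plane_rep ` fringe t)"

text \<open>The limit \<open>n \<rightarrow> \<infinity>\<close> along the sizes for which the random tree exists.\<close>

definition admissible_sizes :: "(nat \<Rightarrow> real) \<Rightarrow> nat filter" where
  "admissible_sizes \<phi> = inf sequentially (principal {n. total_weight \<phi> n > 0})"

end

theory Submission
  imports Defs "HOL-Real_Asymp.Real_Asymp"
begin

text \<open>
  The random tree is a Galton--Watson tree with the critical offspring law \<open>\<xi>\<close>, conditioned on
  its size: tilting by \<open>\<tau>\<close> multiplies the weights of all trees of one size by a common factor.
  In terms of preorder degree sequences (codes) it is a word of \<open>n\<close> independent letters, conditioned
  on being a code, and its fringe subtrees are exactly the codes that occur in this word.

  The number of different fringe subtrees that are larger than about \<open>ln n\<close>, and the number of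
  positions where no small fringe subtree starts, change by at most a power of \<open>ln n\<close> when
  one letter changes. McDiarmid's inequality bounds their deviations from the mean for the
  unconditioned word by \<open>exp (- n / polylog n)\<close>. The conditioning event has probability at least
  \<open>exp (- sqrt n * (ln n)\<^sup>2)\<close>, because grafting trees makes the size distribution
  supermultiplicative. Hence only unconditioned means are needed, and no local limit theorem.

  These means reduce to the probability that the Galton--Watson tree has more than \<open>k\<close>
  vertices. It is asymptotic to \<open>\<kappa> / sqrt k\<close>, by the square-root singularity of the generating
  function and a Tauberian argument that compares with the binomial series. For the upper bound
  take \<open>k\<close> slightly below \<open>ln n / C1\<close>: there are only \<open>o (n / sqrt (ln n))\<close> plane trees up to
  this size. For the lower bound take \<open>k\<close> slightly above \<open>ln n / C2\<close>: apart from an exponentially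
  small proportion, trees of at least this size have probability at most \<open>n powr (- 1 - \<epsilon>)\<close>, so
  that they hardly ever occur twice.
\<close>

section \<open>Codes of plane trees\<close>

text \<open>Probabilities for the conditioned tree are at most those for the free word divided by
  \<open>q n\<close>, the probability that the Galton-Watson tree has size \<open>n\<close>. To use
  this, both statistics must make sense on every word and be Lipschitz with a polylogarithmic
  constant. This is why the lower bound ignores fringe subtrees larger than
  \<open>(ln n)\<^sup>2\<close>: about \<open>n / ln n\<close> vertices carry them, which is of
  lower order than \<open>n / sqrt (ln n)\<close>.

  A finite variance gives no analytic continuation of the generating function, hence no direct
  access to single values \<open>q n\<close>. The tails are accessible because they decrease, and a
  crude lower bound on \<open>q n\<close> is then enough. It can hold only where
  \<open>q n > 0\<close>, as \<open>q\<close> may vanish on whole residue classes.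

  The constants come from \<open>\<kappa> / sqrt k\<close> at \<open>k = ln n / C\<close>, which
  times \<open>n\<close> is \<open>\<kappa> * sqrt C * n / sqrt (ln n)\<close>. Here
  \<open>exp C1\<close> bounds the growth rate of the number of trees with out-degrees in
  \<open>M\<close>, and \<open>C2\<close>, if finite, is the entropy of \<open>\<xi>\<close>, the
  typical value of \<open>- ln (weight) / size\<close>.\<close>

fun code :: "plane_tree \<Rightarrow> nat list" where
  "code (Node ts) = length ts # concat (map code ts)"

lemma length_code [simp]: "length (code t) = num_vertices t"
proof (induction t)
  case (Node ts)
  then have "map (length \<circ> code) ts = map num_vertices ts" by simp
  then have "sum_list (map (length \<circ> code) ts) = sum_list (map num_vertices ts)" by (rule arg_cong)
  then show ?case by (simp add: length_concat)
qed

lemma num_vertices_pos: "0 < num_vertices t"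
  by (cases t) simp

lemma code_not_Nil [simp]: "code t \<noteq> []"
  by (cases t) simp

lemma weight_code: "weight f t = prod_list (map f (code t))"
proof (induction t)
  case (Node ts)
  then have "map (weight f) ts = map (\<lambda>t. prod_list (map f (code t))) ts" by simp
  then have "prod_list (map (weight f) ts) = prod_list (map (\<lambda>t. prod_list (map f (code t))) ts)"
    by (rule arg_cong)
  also have "\<dots> = prod_list (map f (concat (map code ts)))"
    by (induction ts) auto
  finally show ?case by simp
qed

text \<open>A code is self-delimiting: its first letter announces the number of child codes, which
  are then peeled off one by one. So at most one tree can start at a given position of a
  word.\<close>

lemma code_append_inject: "code s @ u = code t @ v \<Longrightarrow> s = t \<and> u = v"
proof (induction s arbitrary: t u v)
  case (Node ss)
  obtain ts where t: "t = Node ts" by (cases t)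
  have "ss = ts \<and> u = v"
    if "length ss = length ts" "concat (map code ss) @ u = concat (map code ts) @ v"
       "\<And>s t u v. s \<in> set ss \<Longrightarrow> code s @ u = code t @ v \<Longrightarrow> s = t \<and> u = v"
    for u v
    using that
  proof (induction ss ts rule: list_induct2)
    case (Cons x xs y ys)
    have "code x @ (concat (map code xs) @ u) = code y @ (concat (map code ys) @ v)"
      using Cons.prems(1) by simp
    from Cons.prems(2)[OF _ this] have "x = y" "concat (map code xs) @ u = concat (map code ys) @ v"
      by simp_all
    moreover from Cons.IH[OF this(2)] have "xs = ys \<and> u = v"
      using Cons.prems(2) by (meson list.set_intros(2))
    ultimately show ?case by simp
  qed simp
  moreover have "length ss = length ts" "concat (map code ss) @ u = concat (map code ts) @ v"
    using Node.prems t by simp_all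
  ultimately show ?case using Node.IH t by blast
qed

lemma code_inject: "code s = code t \<longleftrightarrow> s = t"
  using code_append_inject[of s "[]" t "[]"] by auto

text \<open>A cut inside the code falls before some vertex. What follows is the fringe subtree of
  this vertex, then those of the later siblings of it and of its ancestors, in preorder.
  Non-emptiness of \<open>u\<close> guarantees a first tree, and it is this first tree that the
  applications compare.\<close>

lemma code_suffix:
  assumes "x @ u = code t" "u \<noteq> []"
  shows "\<exists>ss. ss \<noteq> [] \<and> set ss \<subseteq> fringe_subtrees t \<and> u = concat (map code ss)"
  using assms
proof (induction t arbitrary: x u)
  case (Node ts)
  show ?case
  proof (cases x)
    case Nil
    then show ?thesis using Node.prems by (intro exI[of _ "[Node ts]"]) auto
  next
    case (Cons a x')
    then have "x' @ u = concat (map code ts)" using Node.prems by simp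
    moreover have "\<forall>t\<in>set ts. \<forall>x u. x @ u = code t \<longrightarrow> u \<noteq> [] \<longrightarrow>
        (\<exists>ss. ss \<noteq> [] \<and> set ss \<subseteq> fringe_subtrees t \<and> u = concat (map code ss))"
      using Node.IH by blast
    ultimately have "\<exists>ss. ss \<noteq> [] \<and> set ss \<subseteq> (\<Union>t\<in>set ts. fringe_subtrees t) \<and> u = concat (map code ss)"
      using Node.prems(2)
    proof (induction ts arbitrary: x')
      case (Cons y ys)
      \<comment> \<open>The cut lies either in the code of the first child \<open>y\<close>, with
        remainder \<open>z\<close> (empty if the cut is at its end), or in the codes of the later
        children.\<close>
      from Cons.prems(1) consider z where "x' @ z = code y" "u = z @ concat (map code ys)"
        | z where "z @ u = concat (map code ys)" "x' = code y @ z"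
        by (auto simp: append_eq_append_conv2)
      then show ?case
      proof cases
        case 1
        have self: "t \<in> fringe_subtrees t" for t by (cases t) simp
        show ?thesis
        proof (cases "z = []")
          case True
          then have "ys \<noteq> []" using 1(2) Cons.prems(3) by auto
          moreover have "u = concat (map code ys)" using 1(2) True by simp
          moreover have "set ys \<subseteq> (\<Union>t\<in>set (y # ys). fringe_subtrees t)" using self by auto
          ultimately show ?thesis by blast
        next
          case False
          then obtain ss where "ss \<noteq> []" "set ss \<subseteq> fringe_subtrees y" "z = concat (map code ss)"
            using Cons.prems(2) 1(1) by (metis list.set_intros(1))
          moreover have "set ys \<subseteq> (\<Union>t\<in>set ys. fringe_subtrees t)" using self by auto
          ultimately have "ss @ ys \<noteq> []" "set (ss @ ys) \<subseteq> (\<Union>t\<in>set (y # ys). fringe_subtrees t)"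
            "u = concat (map code (ss @ ys))" using 1(2) by auto
          then show ?thesis by blast
        qed
      next
        case 2
        have "\<forall>t\<in>set ys. \<forall>x u. x @ u = code t \<longrightarrow> u \<noteq> [] \<longrightarrow>
            (\<exists>ss. ss \<noteq> [] \<and> set ss \<subseteq> fringe_subtrees t \<and> u = concat (map code ss))"
          using Cons.prems(2) by (meson list.set_intros(2))
        from Cons.IH[OF 2(1) this Cons.prems(3)]
        obtain ss where "ss \<noteq> []" "set ss \<subseteq> (\<Union>t\<in>set ys. fringe_subtrees t)" "u = concat (map code ss)"
          by blast
        then show ?thesis by (intro exI[of _ ss]) auto
      qed
    qed simp
    then obtain ss where "ss \<noteq> []" "set ss \<subseteq> (\<Union>t\<in>set ts. fringe_subtrees t)"
      "u = concat (map code ss)" by blast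
    moreover then have "set ss \<subseteq> fringe_subtrees (Node ts)" by auto
    ultimately show ?thesis by blast
  qed
qed

lemma fringe_code:
  assumes "s \<in> fringe_subtrees t" shows "\<exists>x y. code t = x @ code s @ y"
  using assms
proof (induction t)
  case (Node ts)
  show ?case
  proof (cases "s = Node ts")
    case True
    then show ?thesis by (intro exI[of _ "[]"]) simp
  next
    case False
    then obtain t where t: "t \<in> set ts" "s \<in> fringe_subtrees t" using Node.prems by auto
    then obtain x y where "code t = x @ code s @ y" using Node.IH by blast
    moreover obtain us vs where "ts = us @ t # vs" using t(1) by (meson split_list)
    ultimately show ?thesis
      by (intro exI[of _ "length ts # concat (map code us) @ x"] exI[of _ "y @ concat (map code vs)"]) simp
  qed
qed

section \<open>Occurrences of trees in words\<close>

definition occ :: "plane_tree \<Rightarrow> nat \<Rightarrow> nat list \<Rightarrow> bool" where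
  "occ s i w \<longleftrightarrow> take (num_vertices s) (drop i w) = code s"

lemma occ_length: "occ s i w \<Longrightarrow> i + num_vertices s \<le> length w"
proof -
  assume "occ s i w"
  then have "length (take (num_vertices s) (drop i w)) = num_vertices s" unfolding occ_def by simp
  then show ?thesis using num_vertices_pos[of s] by (simp add: min_def split: if_splits)
qed

lemma occ_drop: "occ s i w \<longleftrightarrow> (\<exists>u. drop i w = code s @ u)"
  unfolding occ_def by (metis append_take_drop_id append_eq_conv_conj length_code)

lemma occ_unique: "occ s i w \<Longrightarrow> occ t i w \<Longrightarrow> s = t"
  unfolding occ_drop using code_append_inject by metis

text \<open>For the inclusion from right to left, the suffix at position \<open>i\<close> is a
  concatenation of codes of fringe subtrees; its first tree must be \<open>s\<close>, because codes
  are prefix-free.\<close>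

lemma fringe_subtrees_occ: "fringe_subtrees t = {s. \<exists>i. occ s i (code t)}"
proof (intro equalityI subsetI CollectI)
  fix s assume "s \<in> fringe_subtrees t"
  then obtain x y where "code t = x @ code s @ y" using fringe_code by blast
  then show "\<exists>i. occ s i (code t)" by (intro exI[of _ "length x"]) (simp add: occ_drop)
next
  fix s assume "s \<in> {s. \<exists>i. occ s i (code t)}"
  then obtain i u where iu: "drop i (code t) = code s @ u" by (auto simp: occ_drop)
  have "take i (code t) @ drop i (code t) = code t" "drop i (code t) \<noteq> []" by (simp, metis iu append_is_Nil_conv code_not_Nil)
  from code_suffix[OF this] obtain ss where
    "ss \<noteq> []" "set ss \<subseteq> fringe_subtrees t" "code s @ u = concat (map code ss)"
    using iu by auto
  moreover from this(1) obtain s' ss' where ss: "ss = s' # ss'" by (cases ss) auto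
  ultimately have "code s @ u = code s' @ concat (map code ss')" by simp
  from code_append_inject[OF this] show "s \<in> fringe_subtrees t"
    using ss \<open>set ss \<subseteq> fringe_subtrees t\<close> by simp
qed

text \<open>An overlap would make a proper nonempty suffix of \<open>code s\<close> start with a
  complete code. By prefix-freeness that is \<open>code s\<close> itself, which is too long. Hence
  two occurrences of the same tree involve disjoint sets of letters and are independent events in a
  random word.\<close>

lemma occ_no_overlap:
  assumes "occ s i w" "occ s j w" "i < j"
  shows "i + num_vertices s \<le> j"
proof (rule ccontr)
  assume not: "\<not> ?thesis"
  obtain u v where u: "drop i w = code s @ u" and v: "drop j w = code s @ v"
    using assms by (auto simp: occ_drop)
  let ?d = "j - i"
  have "drop j w = drop ?d (drop i w)" using assms by simp
  also have "\<dots> = drop ?d (code s) @ u" using u not by simp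
  finally have *: "drop ?d (code s) @ u = code s @ v" using v by simp
  have "take ?d (code s) @ drop ?d (code s) = code s" "drop ?d (code s) \<noteq> []" using not assms by auto
  from code_suffix[OF this] obtain ss where ss: "ss \<noteq> []" "drop ?d (code s) = concat (map code ss)"
    by blast
  then obtain s' ss' where "ss = s' # ss'" by (cases ss) auto
  then have "drop ?d (code s) = code s @ concat (map code ss')"
    using * ss code_append_inject[of s' "concat (map code ss') @ u" s v] by auto
  then have "length (drop ?d (code s)) \<ge> num_vertices s" by simp
  then show False using assms num_vertices_pos[of s] by simp
qed

lemma finite_fringe_subtrees: "finite (fringe_subtrees t)"
  by (induction t) auto

lemma finite_trees_size_le: "finite {t. num_vertices t \<le> n}"
proof -
  have "{t. num_vertices t \<le> n} = (\<Union>k\<le>n. {t. num_vertices t = k})" by auto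
  then show ?thesis using finite_plane_trees_of_size by simp
qed

lemma occ_update:
  assumes "j < i \<or> i + num_vertices s \<le> j"
  shows "occ s i (w[j := x]) \<longleftrightarrow> occ s i w"
proof -
  have "take (num_vertices s) (drop i (w[j := x])) = take (num_vertices s) (drop i w)"
    using assms by (auto simp: drop_update_swap drop_update_cancel not_less)
  then show ?thesis unfolding occ_def by simp
qed

section \<open>Two statistics of words that change little when one letter changes\<close>

definition distinct_occ :: "plane_tree set \<Rightarrow> nat list \<Rightarrow> nat" where
  "distinct_occ A w = card {s\<in>A. \<exists>i. occ s i w}"

text \<open>In \<open>code t\<close> each position starts exactly one fringe subtree, so there this
  is the number of vertices whose fringe subtree has more than \<open>K\<close> vertices. In an
  arbitrary word it also counts the positions at which no complete code starts.\<close>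

definition no_small_occ :: "nat \<Rightarrow> nat list \<Rightarrow> nat" where
  "no_small_occ K w = card {i. i < length w \<and> \<not> (\<exists>s. num_vertices s \<le> K \<and> occ s i w)}"

text \<open>A tree that is lost has an occurrence covering position \<open>j\<close>, hence starting
  among the \<open>L\<close> positions that end at \<open>j\<close>, and each start belongs to at
  most one tree.\<close>

lemma distinct_occ_update_le:
  assumes A: "A \<subseteq> {s. num_vertices s \<le> L}"
  shows "distinct_occ A w \<le> distinct_occ A (w[j := x]) + L"
proof -
  let ?D = "\<lambda>w. {s\<in>A. \<exists>i. occ s i w}"
  let ?B = "{s\<in>A. \<exists>i. occ s i w \<and> i \<le> j \<and> j < i + L}"
  have fin: "finite A" using A finite_trees_size_le finite_subset by blast
  have "?D w \<subseteq> ?D (w[j := x]) \<union> ?B"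
  proof
    fix s assume s: "s \<in> ?D w"
    then obtain i where i: "occ s i w" by auto
    show "s \<in> ?D (w[j := x]) \<union> ?B"
    proof (cases "j < i \<or> i + num_vertices s \<le> j")
      case True
      then show ?thesis using occ_update i s by blast
    next
      case False
      have "num_vertices s \<le> L" using s A by blast
      then have "occ s i w \<and> i \<le> j \<and> j < i + L" using i False by simp
      then show ?thesis using s by blast
    qed
  qed
  then have "card (?D w) \<le> card (?D (w[j := x])) + card ?B"
    using fin by (intro order_trans[OF card_mono card_Un_le]) auto
  moreover have "card ?B \<le> L"
  proof -
    define f where "f s = (SOME i. occ s i w \<and> i \<le> j \<and> j < i + L)" for s
    have f: "occ s (f s) w \<and> f s \<le> j \<and> j < f s + L" if "s \<in> ?B" for s
      using that unfolding f_def by (intro someI_ex[of "\<lambda>i. occ s i w \<and> i \<le> j \<and> j < i + L"]) auto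
    have "inj_on f ?B"
    proof (rule inj_onI)
      fix s t assume st: "s \<in> ?B" "t \<in> ?B" "f s = f t"
      then show "s = t" using f[OF st(1)] f[OF st(2)] occ_unique by metis
    qed
    moreover have "f ` ?B \<subseteq> {j + 1 - L..j}"
    proof
      fix i assume "i \<in> f ` ?B"
      then obtain s where "s \<in> ?B" "i = f s" by blast
      then have "j < i + L" "i \<le> j" using f by blast+
      then show "i \<in> {j + 1 - L..j}" by (auto simp: le_diff_conv)
    qed
    ultimately have "card ?B \<le> card {j + 1 - L..j}" by (rule card_inj_on_le) simp
    then show ?thesis by simp
  qed
  ultimately show ?thesis unfolding distinct_occ_def by simp
qed

text \<open>Whether a tree of size at most \<open>K\<close> starts at \<open>i\<close> is decided by
  the letters \<open>i\<close>, ..., \<open>i + K - 1\<close>, so at most \<open>K\<close> positions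
  change their status.\<close>

lemma no_small_occ_update_le: "no_small_occ K w \<le> no_small_occ K (w[j := x]) + K"
proof -
  let ?N = "\<lambda>w. {i. i < length w \<and> \<not> (\<exists>s. num_vertices s \<le> K \<and> occ s i w)}"
  have "?N w \<subseteq> ?N (w[j := x]) \<union> {j + 1 - K..j}"
  proof
    fix i assume i: "i \<in> ?N w"
    show "i \<in> ?N (w[j := x]) \<union> {j + 1 - K..j}"
    proof (cases "j < i \<or> i + K \<le> j")
      case True
      then have "occ s i (w[j := x]) = occ s i w" if "num_vertices s \<le> K" for s
        using that by (intro occ_update) auto
      then show ?thesis using i by auto
    qed auto
  qed
  then have "card (?N w) \<le> card (?N (w[j := x])) + card {j + 1 - K..j}"
    by (intro order_trans[OF card_mono card_Un_le]) auto
  then show ?thesis unfolding no_small_occ_def by simp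
qed

text \<open>An update is undone by another update, so a one-sided bound valid for all words is
  two-sided.\<close>

lemma abs_diff_update_le:
  fixes F :: "'a list \<Rightarrow> nat"
  assumes "\<And>w j x. F w \<le> F (w[j := x]) + c"
  shows "\<bar>real (F w) - real (F (w[j := x]))\<bar> \<le> real c"
proof -
  have "w = (w[j := x])[j := w ! j]" by simp
  then have "F (w[j := x]) \<le> F w + c" by (metis assms)
  with assms[of w j x] show ?thesis by linarith
qed

lemma distinct_occ_le_card_fringe: "distinct_occ A (code t) \<le> card (fringe_subtrees t)"
  unfolding distinct_occ_def using finite_fringe_subtrees[of t]
  by (intro card_mono) (auto simp: fringe_subtrees_occ)

text \<open>The small fringe subtrees are bounded by the number of all eligible trees. The large
  ones inject into the positions where they start, and no small tree can start there. The predicate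
  \<open>P\<close> will be positivity of the weight.\<close>

lemma card_fringe_le:
  assumes "\<And>s. s \<in> fringe_subtrees t \<Longrightarrow> P s"
  shows "card (fringe_subtrees t) \<le> card {s. num_vertices s \<le> K \<and> P s} + no_small_occ K (code t)"
proof -
  let ?F = "fringe_subtrees t"
  let ?B = "{s \<in> ?F. K < num_vertices s}"
  let ?N = "{i. i < length (code t) \<and> \<not> (\<exists>s. num_vertices s \<le> K \<and> occ s i (code t))}"
  have "?F \<subseteq> {s. num_vertices s \<le> K \<and> P s} \<union> ?B" using assms by auto
  moreover have "finite {s. num_vertices s \<le> K \<and> P s}" 
    using finite_trees_size_le[of K] by (rule finite_subset[rotated]) auto
  ultimately have "card ?F \<le> card {s. num_vertices s \<le> K \<and> P s} + card ?B"
    using finite_fringe_subtrees[of t] by (intro order_trans[OF card_mono card_Un_le]) auto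
  moreover have "card ?B \<le> card ?N"
  proof -
    define f where "f s = (SOME i. occ s i (code t))" for s
    have f: "occ s (f s) (code t)" if "s \<in> ?B" for s
      using that unfolding f_def fringe_subtrees_occ by (intro someI_ex[of "\<lambda>i. occ s i (code t)"]) auto
    have "inj_on f ?B"
    proof (rule inj_onI)
      fix s s' assume st: "s \<in> ?B" "s' \<in> ?B" "f s = f s'"
      then show "s = s'" using f[OF st(1)] f[OF st(2)] occ_unique by metis
    qed
    moreover have "f ` ?B \<subseteq> ?N"
    proof safe
      fix s assume s: "s \<in> ?F" "K < num_vertices s"
      then have o: "occ s (f s) (code t)" using f by auto
      then show "f s < length (code t)" using occ_length[OF o] num_vertices_pos[of s] by simp
      fix s' assume "num_vertices s' \<le> K" "occ s' (f s) (code t)"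
      then have "s = s'" using occ_unique[OF o] by blast
      then show False using \<open>num_vertices s' \<le> K\<close> s by simp
    qed
    ultimately show ?thesis by (rule card_inj_on_le) auto
  qed
  ultimately show ?thesis unfolding no_small_occ_def by simp
qed

section \<open>McDiarmid's inequality\<close>

lemma integrable_bounded_pmf:
  fixes f :: "'a \<Rightarrow> real"
  assumes "\<And>x. x \<in> set_pmf p \<Longrightarrow> \<bar>f x\<bar> \<le> B"
  shows "integrable (measure_pmf p) f"
  using assms by (intro measure_pmf.integrable_const_bound[where B = B]) (auto simp: AE_measure_pmf_iff)

lemma expectation_bind_pmf:
  fixes f :: "'b \<Rightarrow> real"
  assumes "\<And>y. y \<in> set_pmf (bind_pmf p g) \<Longrightarrow> \<bar>f y\<bar> \<le> B"
  shows "measure_pmf.expectation (bind_pmf p g) f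
    = measure_pmf.expectation p (\<lambda>x. measure_pmf.expectation (g x) f)"
proof -
  \<comment> \<open>The bound on \<open>f\<close> is known on the support, but the exchange of
    integrals asks for it everywhere; so \<open>f\<close> is set to 0 off the support.\<close>
  define h where "h y = (if y \<in> set_pmf (bind_pmf p g) then f y else 0)" for y
  have B: "0 \<le> B"
  proof -
    obtain y where "y \<in> set_pmf (bind_pmf p g)" using set_pmf_not_empty by fast
    from assms[OF this] show ?thesis by linarith
  qed
  have "measure_pmf.expectation (bind_pmf p g) f = measure_pmf.expectation (bind_pmf p g) h"
    unfolding h_def by (intro integral_cong_AE) (auto simp: AE_measure_pmf_iff)
  also have "\<dots> = measure_pmf.expectation p (\<lambda>x. measure_pmf.expectation (g x) h)"
    unfolding measure_pmf_bind
    by (rule integral_bind[where K = "count_space UNIV" and B = B and B' = 1])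
       (use assms B measurable_measure_pmf[of g] in \<open>auto simp: h_def measure_pmf.finite_measure_axioms
          measure_pmf.emeasure_space_1\<close>)
  also have "\<dots> = measure_pmf.expectation p (\<lambda>x. measure_pmf.expectation (g x) f)"
    unfolding h_def
    by (intro integral_cong_AE) (auto simp: AE_measure_pmf_iff intro!: integral_cong_AE)
  finally show ?thesis .
qed

lemma length_replicate_pmf: "w \<in> set_pmf (replicate_pmf n p) \<Longrightarrow> length w = n"
  by (simp add: set_replicate_pmf)

lemma replicate_pmf_Suc': "replicate_pmf (Suc n) p = bind_pmf p (\<lambda>x. map_pmf ((#) x) (replicate_pmf n p))"
  by (simp add: map_pmf_def)

text \<open>Induction on the length, conditioning on the first letter. The conditional mean
  \<open>g\<close> varies by at most \<open>c\<close>, so Hoeffding's lemma contributes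
  \<open>l\<^sup>2 * c\<^sup>2 / 8\<close> to the exponent; with the first letter frozen, the other
  letters are handled by the induction hypothesis.\<close>

lemma mcdiarmid_mgf:
  fixes f :: "'a list \<Rightarrow> real"
  assumes "0 < l" "0 \<le> c"
    and "\<And>w i x. length w = n \<Longrightarrow> i < n \<Longrightarrow> \<bar>f w - f (w[i := x])\<bar> \<le> c"
    and "\<And>w. length w = n \<Longrightarrow> \<bar>f w\<bar> \<le> B"
  shows "(\<integral>\<^sup>+w. exp (l * (f w - measure_pmf.expectation (replicate_pmf n p) f)) \<partial>replicate_pmf n p)
    \<le> ennreal (exp (l\<^sup>2 * (real n * c\<^sup>2) / 8))"
  using assms(3,4)
proof (induction n arbitrary: f)
  case 0
  show ?case by simp
next
  case (Suc n)
  let ?P = "replicate_pmf n p"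
  define g where "g x = measure_pmf.expectation ?P (\<lambda>w. f (x # w))" for x
  let ?E = "measure_pmf.expectation (replicate_pmf (Suc n) p) f"
  have bnd: "\<bar>f (x # w)\<bar> \<le> B" if "w \<in> set_pmf ?P" for x w
    using Suc.prems(2)[of "x # w"] length_replicate_pmf[OF that] by simp
  have int: "integrable ?P (\<lambda>w. f (x # w))" for x
    by (rule integrable_bounded_pmf[where B = B]) (use bnd in auto)
  have E: "?E = measure_pmf.expectation p g"
    unfolding replicate_pmf_Suc' g_def
    by (subst expectation_bind_pmf[where B = B]) (use bnd in auto)
  have gdiff: "\<bar>g x - g y\<bar> \<le> c" for x y
  proof -
    have "\<bar>f (x # w) - f (y # w)\<bar> \<le> c" if "w \<in> set_pmf ?P" for w
      using Suc.prems(1)[of "x # w" 0 y] length_replicate_pmf[OF that] by simp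
    then have "\<bar>measure_pmf.expectation ?P (\<lambda>w. f (x # w) - f (y # w))\<bar> \<le> measure_pmf.expectation ?P (\<lambda>w. c)"
      using int by (intro order_trans[OF integral_abs_bound] integral_mono_AE) (auto simp: AE_measure_pmf_iff)
    then show ?thesis unfolding g_def using int by simp
  qed
  have below: "bdd_below (range g)"
    proof (rule bdd_belowI)
    fix y assume "y \<in> range g"
    then obtain x where "y = g x" by blast
    then show "g undefined - c \<le> y" using gdiff[of undefined x] by linarith
  qed
  \<comment> \<open>Hoeffding's lemma wants an interval of length \<open>c\<close> that contains all
    values of \<open>g\<close>; the infimum is its left end.\<close>
  define a where "a = Inf (range g)"
  have ga: "g x \<in> {a..a + c}" for x
  proof -
    have "a \<le> g x" unfolding a_def using below by (intro cInf_lower) auto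
    moreover have "g x - c \<le> a" unfolding a_def
    proof (rule cInf_greatest)
      fix z assume "z \<in> range g"
      then obtain y where "z = g y" by blast
      then show "g x - c \<le> z" using gdiff[of x y] by linarith
    qed simp
    ultimately show ?thesis by simp
  qed
  interpret g: interval_bounded_random_variable "measure_pmf p" g a "a + c"
    by unfold_locales (use ga in \<open>auto simp: AE_measure_pmf_iff\<close>)
  have IH: "(\<integral>\<^sup>+w. exp (l * (f (x # w) - g x)) \<partial>?P) \<le> ennreal (exp (l\<^sup>2 * (real n * c\<^sup>2) / 8))" for x
    unfolding g_def
  proof (rule Suc.IH)
    fix w :: "'a list" and i y assume "length w = n" "i < n"
    then show "\<bar>f (x # w) - f (x # w[i := y])\<bar> \<le> c"
      using Suc.prems(1)[of "x # w" "Suc i" y] by simp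
  next
    fix w :: "'a list" assume "length w = n"
    then show "\<bar>f (x # w)\<bar> \<le> B" using Suc.prems(2)[of "x # w"] by simp
  qed
  have "(\<integral>\<^sup>+w. exp (l * (f w - ?E)) \<partial>replicate_pmf (Suc n) p)
    = (\<integral>\<^sup>+x. \<integral>\<^sup>+w. exp (l * (f (x # w) - ?E)) \<partial>?P \<partial>p)"
    unfolding replicate_pmf_Suc' by simp
  also have "\<dots> = (\<integral>\<^sup>+x. \<integral>\<^sup>+w. ennreal (exp (l * (g x - ?E))) * ennreal (exp (l * (f (x # w) - g x))) \<partial>?P \<partial>p)"
    by (intro nn_integral_cong) (simp add: ennreal_mult'[symmetric] exp_add[symmetric] algebra_simps)
  also have "\<dots> = (\<integral>\<^sup>+x. ennreal (exp (l * (g x - ?E))) * (\<integral>\<^sup>+w. ennreal (exp (l * (f (x # w) - g x))) \<partial>?P) \<partial>p)"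
    by (simp add: nn_integral_cmult)
  also have "\<dots> \<le> (\<integral>\<^sup>+x. ennreal (exp (l * (g x - ?E))) * ennreal (exp (l\<^sup>2 * (real n * c\<^sup>2) / 8)) \<partial>p)"
    by (intro nn_integral_mono mult_left_mono IH) simp
  also have "\<dots> = (\<integral>\<^sup>+x. ennreal (exp (l * (g x - ?E))) \<partial>p) * ennreal (exp (l\<^sup>2 * (real n * c\<^sup>2) / 8))"
    by (simp add: nn_integral_multc)
  also have "\<dots> \<le> ennreal (exp (l\<^sup>2 * (a + c - a)\<^sup>2 / 8)) * ennreal (exp (l\<^sup>2 * (real n * c\<^sup>2) / 8))"
    using g.Hoeffdings_lemma_nn_integral[OF \<open>0 < l\<close>] unfolding E by (intro mult_right_mono) auto
  also have "\<dots> = ennreal (exp (l\<^sup>2 * (real (Suc n) * c\<^sup>2) / 8))"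
    by (simp add: ennreal_mult'[symmetric] exp_add[symmetric] field_simps)
  finally show ?case .
qed

theorem mcdiarmid_ge:
  fixes f :: "'a list \<Rightarrow> real"
  assumes "0 \<le> r" "0 \<le> c"
    and diff: "\<And>w i x. length w = n \<Longrightarrow> i < n \<Longrightarrow> \<bar>f w - f (w[i := x])\<bar> \<le> c"
    and bnd: "\<And>w. length w = n \<Longrightarrow> \<bar>f w\<bar> \<le> B"
  shows "measure_pmf.prob (replicate_pmf n p)
      {w. f w \<ge> measure_pmf.expectation (replicate_pmf n p) f + r} \<le> exp (- 2 * r\<^sup>2 / (real n * c\<^sup>2))"
proof (cases "r = 0 \<or> n = 0 \<or> c = 0")
  \<comment> \<open>In these cases the exponent is 0, by \<open>x / 0 = 0\<close> if the denominator
    vanishes, and the claimed bound is 1.\<close>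
  case True
  then show ?thesis by auto
next
  case False
  let ?P = "replicate_pmf n p" and ?E = "measure_pmf.expectation (replicate_pmf n p) f"
  \<comment> \<open>This \<open>l\<close> minimises the exponent
    \<open>- l * r + l\<^sup>2 * (n * c\<^sup>2) / 8\<close>.\<close>
  define l where "l = 4 * r / (real n * c\<^sup>2)"
  have l: "0 < l" using False assms by (simp add: l_def)
  have "emeasure ?P {w \<in> UNIV. f w - ?E \<ge> r}
    \<le> ennreal (exp (- l * r)) * (\<integral>\<^sup>+w. ennreal (exp (l * (f w - ?E))) * indicator UNIV w \<partial>?P)"
    by (rule Chernoff_ineq_nn_integral_ge) (use l in auto)
  also have "\<dots> \<le> ennreal (exp (- l * r)) * ennreal (exp (l\<^sup>2 * (real n * c\<^sup>2) / 8))"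
    using mcdiarmid_mgf[OF l \<open>0 \<le> c\<close> diff bnd, of n p] by (intro mult_left_mono) simp_all
  also have "\<dots> = ennreal (exp (- l * r + l\<^sup>2 * (real n * c\<^sup>2) / 8))"
    by (simp add: ennreal_mult'[symmetric] exp_add[symmetric])
  also have "- l * r + l\<^sup>2 * (real n * c\<^sup>2) / 8 = - 2 * r\<^sup>2 / (real n * c\<^sup>2)"
    using False unfolding l_def by (simp add: field_simps power2_eq_square)
  finally have "emeasure ?P {w. f w \<ge> ?E + r} \<le> ennreal (exp (- 2 * r\<^sup>2 / (real n * c\<^sup>2)))"
    by (simp add: algebra_simps)
  then show ?thesis by (simp add: measure_pmf.emeasure_eq_measure)
qed

corollary mcdiarmid_le:
  fixes f :: "'a list \<Rightarrow> real"
  assumes "0 \<le> r" "0 \<le> c"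
    and diff: "\<And>w i x. length w = n \<Longrightarrow> i < n \<Longrightarrow> \<bar>f w - f (w[i := x])\<bar> \<le> c"
    and bnd: "\<And>w. length w = n \<Longrightarrow> \<bar>f w\<bar> \<le> B"
  shows "measure_pmf.prob (replicate_pmf n p)
      {w. f w \<le> measure_pmf.expectation (replicate_pmf n p) f - r} \<le> exp (- 2 * r\<^sup>2 / (real n * c\<^sup>2))"
proof -
  have "measure_pmf.prob (replicate_pmf n p)
      {w. - f w \<ge> measure_pmf.expectation (replicate_pmf n p) (\<lambda>w. - f w) + r} \<le> exp (- 2 * r\<^sup>2 / (real n * c\<^sup>2))"
    by (rule mcdiarmid_ge[where B = B]) (use assms in \<open>auto simp: abs_minus_commute\<close>)
  moreover have "{w. - f w \<ge> measure_pmf.expectation (replicate_pmf n p) (\<lambda>w. - f w) + r}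
    = {w. f w \<le> measure_pmf.expectation (replicate_pmf n p) f - r}"
    by (auto simp: algebra_simps)
  ultimately show ?thesis by simp
qed

section \<open>A Tauberian theorem\<close>

lemma summable_bounded_power:
  fixes d :: "nat \<Rightarrow> real"
  assumes "\<And>n. \<bar>d n\<bar> \<le> B" "0 \<le> z" "z < 1"
  shows "summable (\<lambda>n. d n * z ^ n)"
proof (rule summable_comparison_test')
  show "summable (\<lambda>n. B * z ^ n)" using assms by (intro summable_mult summable_geometric) auto
  show "norm (d n * z ^ n) \<le> B * z ^ n" for n
    using assms by (simp add: abs_mult mult_right_mono)
qed

text \<open>Karamata's method. For a monomial \<open>g x = x ^ k\<close> the sum is the power series
  of \<open>d\<close> at \<open>exp (- (k + 1) / N)\<close>, which \<open>d_gf\<close> covers.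
  Weierstrass approximation extends this to continuous \<open>g\<close>: as the factor
  \<open>z ^ n\<close> is kept outside \<open>g\<close>, the error is at most \<open>\<eta>\<close>
  times the power series of \<open>h\<close> at \<open>exp (- 1 / N)\<close>, which is
  \<open>O (sqrt N)\<close>.\<close>

lemma tauberian_continuous:
  fixes d h :: "nat \<Rightarrow> real" and g :: "real \<Rightarrow> real"
  assumes dh: "\<And>n. \<bar>d n\<bar> \<le> h n" and hB: "\<And>n. h n \<le> B"
    and h_gf: "\<And>N. 0 < N \<Longrightarrow> (\<Sum>n. h n * exp (- 1 / real N) ^ n) \<le> C * sqrt (real N)"
    and d_gf: "\<And>k. (\<lambda>N. (\<Sum>n. d n * exp (- real (Suc k) / real N) ^ n) / sqrt (real N)) \<longlonglongrightarrow> 0"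
    and g: "continuous_on {0..1} g"
  shows "(\<lambda>N. (\<Sum>n. d n * (exp (- 1 / real N) ^ n * g (exp (- 1 / real N) ^ n))) / sqrt (real N)) \<longlonglongrightarrow> 0"
proof (rule LIMSEQ_I)
  fix e :: real assume "0 < e"
  define z where "z N = exp (- 1 / real N)" for N
  define C' where "C' = \<bar>C\<bar> + 1"
  have C': "C' > 0" "C \<le> C'" by (auto simp: C'_def)
  define \<eta> where "\<eta> = e / (2 * C')"
  have \<eta>: "\<eta> > 0" using \<open>0 < e\<close> C' by (simp add: \<eta>_def)
  obtain q where q: "real_polynomial_function q" "\<And>x. x \<in> {0..1} \<Longrightarrow> \<bar>g x - q x\<bar> < \<eta>"
    using Stone_Weierstrass_real_polynomial_function[OF compact_Icc g \<eta>] by metis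
  obtain c m where c: "q = (\<lambda>x. \<Sum>i\<le>m. c i * x ^ i)"
    using q(1) by (auto simp: real_polynomial_function_iff_sum)
  have z: "0 \<le> z N" "N > 0 \<Longrightarrow> z N < 1" for N by (auto simp: z_def)
  have zn: "0 \<le> z N ^ n" "N > 0 \<Longrightarrow> z N ^ n \<le> 1" for N n
    using z[of N] by (auto simp: power_le_one)
  have dB: "\<bar>d n\<bar> \<le> B" for n using dh[of n] hB[of n] by linarith
  have sumd: "summable (\<lambda>n. d n * (z N ^ n * f (z N ^ n)))" if "N > 0" "\<And>x. x \<in> {0..1} \<Longrightarrow> \<bar>f x\<bar> \<le> K" for N f K
  proof -
    have "summable (\<lambda>n. (d n * f (z N ^ n)) * z N ^ n)"
      by (rule summable_bounded_power[where B = "B * K"])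
         (use zn z that dB in \<open>auto simp: abs_mult intro!: mult_mono order_trans[OF abs_ge_zero dB]\<close>)
    then show ?thesis by (simp add: algebra_simps)
  qed
  have poly: "(\<lambda>N. (\<Sum>n. d n * (z N ^ n * q (z N ^ n))) / sqrt (real N)) \<longlonglongrightarrow> 0"
  proof -
    have lim: "(\<lambda>N. \<Sum>i\<le>m. c i * ((\<Sum>n. d n * exp (- real (Suc i) / real N) ^ n) / sqrt (real N))) \<longlonglongrightarrow> (\<Sum>i\<le>m. c i * 0)"
      by (intro tendsto_sum tendsto_mult tendsto_const d_gf)
    have **: "(\<Sum>i\<le>m. c i * ((\<Sum>n. d n * exp (- real (Suc i) / real N) ^ n) / sqrt (real N)))
        = (\<Sum>n. d n * (z N ^ n * q (z N ^ n))) / sqrt (real N)" if N: "N > 0" for N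
    proof -
      have pw: "exp (- real (Suc i) / real N) ^ n = z N ^ n * (z N ^ n) ^ i" for i n
      proof -
        have "exp (- real (Suc i) / real N) = z N ^ Suc i"
          unfolding z_def exp_of_nat_mult[symmetric] by (simp add: diff_divide_distrib add_divide_distrib)
        then show ?thesis by (simp add: power_mult_distrib power_mult[symmetric] mult.commute)
      qed
      have s: "summable (\<lambda>n. d n * (z N ^ n * (z N ^ n) ^ i))" for i
        by (rule sumd[where K = 1, OF N]) (auto simp: power_le_one)
      have "(\<Sum>n. d n * (z N ^ n * q (z N ^ n))) = (\<Sum>n. \<Sum>i\<le>m. c i * (d n * (z N ^ n * (z N ^ n) ^ i)))"
        unfolding c by (simp add: sum_distrib_left algebra_simps)
      also have "\<dots> = (\<Sum>i\<le>m. \<Sum>n. c i * (d n * (z N ^ n * (z N ^ n) ^ i)))"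
        by (intro suminf_sum summable_mult s)
      also have "\<dots> = (\<Sum>i\<le>m. c i * (\<Sum>n. d n * (z N ^ n * (z N ^ n) ^ i)))"
        by (simp add: suminf_mult[OF s])
      finally show ?thesis unfolding pw by (simp add: sum_divide_distrib)
    qed
    have "\<forall>\<^sub>F N in sequentially. (\<Sum>i\<le>m. c i * ((\<Sum>n. d n * exp (- real (Suc i) / real N) ^ n) / sqrt (real N)))
        = (\<Sum>n. d n * (z N ^ n * q (z N ^ n))) / sqrt (real N)"
      by (rule eventually_mono[OF eventually_gt_at_top[of 0]]) (rule **)
    from Lim_transform_eventually[OF lim this] show ?thesis by simp
  qed
  then obtain N0 where N0: "\<And>N. N \<ge> N0 \<Longrightarrow> \<bar>(\<Sum>n. d n * (z N ^ n * q (z N ^ n))) / sqrt (real N)\<bar> < e / 2"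
    using LIMSEQ_D[OF poly, of "e / 2"] \<open>0 < e\<close> by auto
  have gK: "\<exists>K. \<forall>x\<in>{0..1}. \<bar>g x\<bar> \<le> K"
    using compact_imp_bounded[OF compact_continuous_image[OF g compact_Icc]]
    unfolding bounded_iff by auto
  then obtain K where K: "\<And>x. x \<in> {0..1} \<Longrightarrow> \<bar>g x\<bar> \<le> K" by blast
  have qK: "\<bar>q x\<bar> \<le> K + \<eta>" if "x \<in> {0..1}" for x using K[OF that] q(2)[OF that] by linarith
  have diff: "\<bar>(\<Sum>n. d n * (z N ^ n * g (z N ^ n))) - (\<Sum>n. d n * (z N ^ n * q (z N ^ n)))\<bar> \<le> e / 2 * sqrt (real N)"
    if N: "N > 0" for N
  proof -
    have hs: "summable (\<lambda>n. h n * z N ^ n)"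
    proof (rule summable_bounded_power)
      show "\<bar>h n\<bar> \<le> B" for n using dh[of n] hB[of n] by linarith
    qed (use z N in auto)
    have gs: "summable (\<lambda>n. d n * (z N ^ n * g (z N ^ n)))" and qs: "summable (\<lambda>n. d n * (z N ^ n * q (z N ^ n)))"
      by (rule sumd[OF N K] sumd[OF N qK], assumption)+
    have tm: "\<bar>d n * (z N ^ n * g (z N ^ n)) - d n * (z N ^ n * q (z N ^ n))\<bar> \<le> \<eta> * (h n * z N ^ n)" for n
    proof -
      have "\<bar>g (z N ^ n) - q (z N ^ n)\<bar> \<le> \<eta>" using q(2)[of "z N ^ n"] zn N by (simp add: less_imp_le)
      then have "(\<bar>d n\<bar> * z N ^ n) * \<bar>g (z N ^ n) - q (z N ^ n)\<bar> \<le> (h n * z N ^ n) * \<eta>"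
        using dh[of n] zn(1)[of N n] by (intro mult_mono) (auto intro: order_trans[OF abs_ge_zero])
      moreover have "d n * (z N ^ n * g (z N ^ n)) - d n * (z N ^ n * q (z N ^ n))
          = d n * z N ^ n * (g (z N ^ n) - q (z N ^ n))" by (simp add: algebra_simps)
      ultimately show ?thesis using zn(1)[of N n] by (simp add: abs_mult mult.commute)
    qed
    have "\<bar>(\<Sum>n. d n * (z N ^ n * g (z N ^ n))) - (\<Sum>n. d n * (z N ^ n * q (z N ^ n)))\<bar>
        = norm (\<Sum>n. d n * (z N ^ n * g (z N ^ n)) - d n * (z N ^ n * q (z N ^ n)))"
      by (simp add: suminf_diff[OF gs qs])
    also have "\<dots> \<le> (\<Sum>n. \<eta> * (h n * z N ^ n))"
      by (rule norm_suminf_le) (use tm summable_mult[OF hs] in auto)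
    also have "\<dots> = \<eta> * (\<Sum>n. h n * z N ^ n)" by (rule suminf_mult[OF hs])
    also have "\<dots> \<le> \<eta> * (C' * sqrt (real N))"
      using h_gf[OF N] C' \<eta> unfolding z_def
      by (intro mult_left_mono order_trans[OF h_gf[OF N]] mult_right_mono) auto
    also have "\<dots> = e / 2 * sqrt (real N)" using C' by (simp add: \<eta>_def)
    finally show ?thesis .
  qed
  have "\<bar>(\<Sum>n. d n * (z N ^ n * g (z N ^ n))) / sqrt (real N)\<bar> < e" if "N \<ge> max N0 1" for N
  proof -
    have N: "N > 0" "N \<ge> N0" using that by auto
    have "\<bar>(\<Sum>n. d n * (z N ^ n * g (z N ^ n))) / sqrt (real N) - (\<Sum>n. d n * (z N ^ n * q (z N ^ n))) / sqrt (real N)\<bar> \<le> e / 2"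
      using diff[OF N(1)] N(1) by (simp add: diff_divide_distrib[symmetric] abs_divide pos_divide_le_eq)
    then show ?thesis using N0[OF N(2)] by linarith
  qed
  then show "\<exists>no. \<forall>N\<ge>no. norm ((\<Sum>n. d n * (exp (- 1 / real N) ^ n * g (exp (- 1 / real N) ^ n))) / sqrt (real N) - 0) < e"
    unfolding z_def by (intro exI[of _ "max N0 1"]) simp
qed

text \<open>A tent function \<open>g\<close> of \<open>x = exp (- n / N)\<close> vanishes outside
  the window, while the weights \<open>z ^ n * g (z ^ n)\<close> add up to at least
  \<open>m * N\<close>. If \<open>d\<close> is at least \<open>t > 0\<close> on the window, then
  \<open>t * m * N\<close> is at most the weighted sum of \<open>d\<close>, which is
  \<open>o (sqrt N)\<close>. The quantifier over \<open>t\<close> stands inside because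
  \<open>t\<close> will depend on \<open>N\<close>.\<close>

lemma tauberian_window:
  fixes d h :: "nat \<Rightarrow> real" and \<alpha> \<beta> e :: real
  assumes dh: "\<And>n. \<bar>d n\<bar> \<le> h n" and hB: "\<And>n. h n \<le> B"
    and h_gf: "\<And>N. 0 < N \<Longrightarrow> (\<Sum>n. h n * exp (- 1 / real N) ^ n) \<le> C * sqrt (real N)"
    and d_gf: "\<And>k. (\<lambda>N. (\<Sum>n. d n * exp (- real (Suc k) / real N) ^ n) / sqrt (real N)) \<longlonglongrightarrow> 0"
    and ab: "0 < \<alpha>" "\<alpha> < \<beta>" and e: "0 < e"
  shows "\<forall>\<^sub>F N in sequentially. \<forall>t. (\<forall>n. \<alpha> * real N \<le> real n \<and> real n \<le> \<beta> * real N \<longrightarrow> t \<le> d n)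
    \<longrightarrow> t * sqrt (real N) \<le> e"
proof -
  define g :: "real \<Rightarrow> real" where "g x = max 0 (min (x - exp (- \<beta>)) (exp (- \<alpha>) - x))" for x
  define z where "z N = exp (- 1 / real N)" for N
  \<comment> \<open>On the middle third of the window \<open>g\<close> is at least
    \<open>g0 > 0\<close>. The factor \<open>\<delta> / 2\<close> in \<open>m\<close> allows for
    rounding when the integers of this third are counted: at most 2 of
    \<open>\<delta> * N > 4\<close> are lost.\<close>
  define \<delta> where "\<delta> = (\<beta> - \<alpha>) / 3"
  have \<delta>: "\<delta> > 0" using ab by (simp add: \<delta>_def)
  define \<alpha>' \<beta>' where "\<alpha>' = \<alpha> + \<delta>" and "\<beta>' = \<beta> - \<delta>"
  have ab': "\<alpha> < \<alpha>'" "\<beta>' < \<beta>" "\<beta>' - \<alpha>' = \<delta>" using \<delta> by (auto simp: \<alpha>'_def \<beta>'_def \<delta>_def field_simps)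
  define g0 where "g0 = min (exp (- \<beta>') - exp (- \<beta>)) (exp (- \<alpha>) - exp (- \<alpha>'))"
  have g0: "g0 > 0" using ab' by (simp add: g0_def)
  define m where "m = \<delta> / 2 * (exp (- \<beta>) * g0)"
  have m: "m > 0" using \<delta> g0 by (simp add: m_def)
  have cont: "continuous_on {0..1} g" unfolding g_def by (intro continuous_intros)
  have lim: "(\<lambda>N. (\<Sum>n. d n * (z N ^ n * g (z N ^ n))) / sqrt (real N)) \<longlonglongrightarrow> 0"
    unfolding z_def by (rule tauberian_continuous[OF dh hB h_gf d_gf cont])
  have ev1: "\<forall>\<^sub>F N in sequentially. (\<Sum>n. d n * (z N ^ n * g (z N ^ n))) / sqrt (real N) < e * m"
    using order_tendstoD(2)[OF lim, of "e * m"] e m by simp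
  have ev2: "\<forall>\<^sub>F N in sequentially. 4 / \<delta> < real N"
    using filterlim_real_sequentially by (simp add: filterlim_at_top_dense)
  show ?thesis
    using ev1 ev2 eventually_gt_at_top[of 0]
  proof eventually_elim
    case (elim N)
    have N: "N > 0" using elim by simp
    have zp: "z N ^ n = exp (- (real n / real N))" for n
      unfolding z_def exp_of_nat_mult[symmetric] by simp
    have z: "0 \<le> z N" "z N < 1" using N by (auto simp: z_def)
    have zn: "0 < z N ^ n" "z N ^ n \<le> 1" for n by (auto simp: zp)
    have g_nonneg: "0 \<le> g x" for x by (simp add: g_def)
    have g_le: "g x \<le> 1" if "0 \<le> x" "x \<le> 1" for x
    proof -
      have "g x \<le> max 0 (x - exp (- \<beta>))" by (auto simp: g_def)
      also have "\<dots> \<le> 1" using that exp_gt_zero[of "- \<beta>"] by (intro max.boundedI) linarith+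
      finally show ?thesis .
    qed
    have dB: "\<bar>d n\<bar> \<le> B" for n using dh[of n] hB[of n] by linarith
    have ds: "summable (\<lambda>n. d n * (z N ^ n * g (z N ^ n)))"
    proof -
      have "summable (\<lambda>n. (d n * g (z N ^ n)) * z N ^ n)"
      proof (rule summable_bounded_power[OF _ z])
        show "\<bar>d n * g (z N ^ n)\<bar> \<le> B * 1" for n
          unfolding abs_mult using dB[of n] g_nonneg g_le[of "z N ^ n"] zn(1)[of n] zn(2)[of n]
          by (intro mult_mono) auto
      qed
      then show ?thesis by (simp add: algebra_simps)
    qed
    have gs: "summable (\<lambda>n. z N ^ n * g (z N ^ n))"
    proof -
      have "summable (\<lambda>n. g (z N ^ n) * z N ^ n)"
      proof (rule summable_bounded_power[OF _ z])
        show "\<bar>g (z N ^ n)\<bar> \<le> 1" for n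
          using g_nonneg g_le[of "z N ^ n"] zn(1)[of n] zn(2)[of n] by simp
      qed
      then show ?thesis by (simp add: algebra_simps)
    qed
    have W: "m * real N \<le> (\<Sum>n. z N ^ n * g (z N ^ n))"
    proof -
      define I where "I = {nat \<lceil>\<alpha>' * real N\<rceil>..nat \<lfloor>\<beta>' * real N\<rfloor>}"
      have pos: "0 \<le> \<alpha>' * real N" using ab ab' by simp
      have len: "\<beta>' * real N = \<alpha>' * real N + \<delta> * real N" using ab'(3) by (simp add: algebra_simps)
      have big: "\<delta> * real N > 4" using elim(2) \<delta> by (simp add: field_simps)
      have cI: "real (card I) \<ge> \<delta> / 2 * real N"
      proof -
        have "real_of_int \<lceil>\<alpha>' * real N\<rceil> \<le> \<alpha>' * real N + 1" "\<beta>' * real N - 1 \<le> real_of_int \<lfloor>\<beta>' * real N\<rfloor>"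
          by linarith+
        moreover have "real (card I) \<ge> real (nat \<lfloor>\<beta>' * real N\<rfloor>) - real (nat \<lceil>\<alpha>' * real N\<rceil>)"
          unfolding I_def by simp
        moreover have "real (nat \<lceil>\<alpha>' * real N\<rceil>) = real_of_int \<lceil>\<alpha>' * real N\<rceil>" using pos by simp
        moreover have "real (nat \<lfloor>\<beta>' * real N\<rfloor>) \<ge> real_of_int \<lfloor>\<beta>' * real N\<rfloor>" by linarith
        ultimately show ?thesis using len big by linarith
      qed
      have tm: "exp (- \<beta>) * g0 \<le> z N ^ n * g (z N ^ n)" if "n \<in> I" for n
      proof -
        have "nat \<lceil>\<alpha>' * real N\<rceil> \<le> n" "n \<le> nat \<lfloor>\<beta>' * real N\<rfloor>" using that by (auto simp: I_def)
        then have "\<alpha>' * real N \<le> real n" "real n \<le> \<beta>' * real N"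
          using pos len \<delta> big by linarith+
        then have "\<alpha>' \<le> real n / real N" "real n / real N \<le> \<beta>'" using N by (simp_all add: field_simps)
        then have "z N ^ n \<le> exp (- \<alpha>')" "exp (- \<beta>') \<le> z N ^ n" unfolding zp by simp_all
        then have "g0 \<le> g (z N ^ n)" "exp (- \<beta>) \<le> z N ^ n"
          using order_trans[of "exp (- \<beta>)" "exp (- \<beta>')" "z N ^ n"] ab' by (auto simp: g0_def g_def)
        then show ?thesis using g0 zn(1)[of n] by (intro mult_mono) auto
      qed
      have "m * real N \<le> real (card I) * (exp (- \<beta>) * g0)"
        using mult_right_mono[OF cI, of "exp (- \<beta>) * g0"] g0 by (simp add: m_def algebra_simps)
      also have "\<dots> \<le> (\<Sum>n\<in>I. z N ^ n * g (z N ^ n))" by (rule sum_bounded_below[OF tm])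
      also have "\<dots> \<le> (\<Sum>n. z N ^ n * g (z N ^ n))"
        using zn g_nonneg by (intro sum_le_suminf gs) (auto simp: I_def less_imp_le)
      finally show ?thesis .
    qed
    show ?case
    proof (intro allI impI)
      fix t assume t: "\<forall>n. \<alpha> * real N \<le> real n \<and> real n \<le> \<beta> * real N \<longrightarrow> t \<le> d n"
      show "t * sqrt (real N) \<le> e"
      proof (cases "t \<le> 0")
        case True
        then have "t * sqrt (real N) \<le> 0" by (simp add: mult_nonpos_nonneg)
        then show ?thesis using e by linarith
      next
        case False
        have "t * (z N ^ n * g (z N ^ n)) \<le> d n * (z N ^ n * g (z N ^ n))" for n
        proof (cases "g (z N ^ n) = 0")
          case False
          then have "exp (- \<beta>) < z N ^ n" "z N ^ n < exp (- \<alpha>)" by (auto simp: g_def split: if_splits)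
          then have "\<alpha> < real n / real N" "real n / real N < \<beta>" unfolding zp by simp_all
          then have "t \<le> d n" using t N by (simp add: field_simps)
          then show ?thesis using zn(1)[of n] g_nonneg by (intro mult_right_mono) auto
        qed simp
        then have "(\<Sum>n. t * (z N ^ n * g (z N ^ n))) \<le> (\<Sum>n. d n * (z N ^ n * g (z N ^ n)))"
          by (intro suminf_le summable_mult gs ds)
        then have "t * (m * real N) \<le> (\<Sum>n. d n * (z N ^ n * g (z N ^ n)))"
          using W False by (simp add: suminf_mult[OF gs]) (meson mult_left_mono order_trans less_imp_le not_le)
        also have "\<dots> \<le> e * m * sqrt (real N)"
          using elim(1) N by (simp add: field_simps)
        finally have "m * (t * (sqrt (real N) * sqrt (real N))) \<le> m * (e * sqrt (real N))"
          by (simp add: algebra_simps)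
        then have "t * sqrt (real N) * sqrt (real N) \<le> e * sqrt (real N)" using m by (simp add: mult.assoc)
        then show ?thesis using N by simp
      qed
    qed
  qed
qed

text \<open>Carries \<open>b k ~ L / sqrt k\<close> over to indices \<open>k ~ c * x\<close>. Here
  \<open>x\<close> will be \<open>N\<close> in the Tauberian argument, and \<open>ln n\<close> or
  its square when subtrees are counted.\<close>

lemma tendsto_scaled_index:
  fixes b x :: "nat \<Rightarrow> real" and s :: "nat \<Rightarrow> nat"
  assumes b: "(\<lambda>n. b n * sqrt (real n)) \<longlonglongrightarrow> L" and c: "0 < c"
    and x: "filterlim x at_top sequentially" and s: "(\<lambda>n. real (s n) / x n) \<longlonglongrightarrow> c"
  shows "(\<lambda>n. b (s n) * sqrt (x n)) \<longlonglongrightarrow> L / sqrt c"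
proof -
  have pos: "\<forall>\<^sub>F n in sequentially. 0 < x n" using x by (simp add: filterlim_at_top_dense)
  have "filterlim (\<lambda>n. real (s n)) at_top sequentially"
  proof (rule filterlim_cong[THEN iffD1, OF refl refl])
    show "filterlim (\<lambda>n. real (s n) / x n * x n) at_top sequentially"
      by (rule filterlim_tendsto_pos_mult_at_top[OF s c x])
    show "\<forall>\<^sub>F n in sequentially. real (s n) / x n * x n = real (s n)"
      using pos by eventually_elim simp
  qed
  then have s_top: "filterlim s at_top sequentially" by (simp add: filterlim_sequentially_iff_filterlim_real)
  have "(\<lambda>n. b (s n) * sqrt (real (s n)) / sqrt (real (s n) / x n)) \<longlonglongrightarrow> L / sqrt c"
    using c by (intro tendsto_divide tendsto_real_sqrt s filterlim_compose[OF b s_top]) auto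
  moreover have "\<forall>\<^sub>F n in sequentially. b (s n) * sqrt (real (s n)) / sqrt (real (s n) / x n) = b (s n) * sqrt (x n)"
    using eventually_compose_filterlim[OF eventually_gt_at_top[of 0] s_top] pos
    by eventually_elim (simp add: real_sqrt_divide)
  ultimately show ?thesis by (rule Lim_transform_eventually)
qed

lemma tendsto_round_divide:
  fixes x :: "nat \<Rightarrow> real"
  assumes c: "0 < c" and x: "filterlim x at_top sequentially"
  shows "(\<lambda>n. real (nat \<lfloor>c * x n\<rfloor>) / x n) \<longlonglongrightarrow> c" "(\<lambda>n. real (nat \<lceil>c * x n\<rceil>) / x n) \<longlonglongrightarrow> c"
proof -
  have lim: "(\<lambda>n. real (s n) / x n) \<longlonglongrightarrow> c"
    if s: "\<And>n. 0 < x n \<Longrightarrow> c * x n - 1 \<le> real (s n) \<and> real (s n) \<le> c * x n + 1" for s :: "nat \<Rightarrow> nat"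
  proof (rule tendsto_sandwich)
    have pos: "\<forall>\<^sub>F n in sequentially. 0 < x n" using x by (simp add: filterlim_at_top_dense)
    show "\<forall>\<^sub>F n in sequentially. c - inverse (x n) \<le> real (s n) / x n"
      using pos by eventually_elim (use s in \<open>simp add: pos_le_divide_eq left_diff_distrib\<close>)
    show "\<forall>\<^sub>F n in sequentially. real (s n) / x n \<le> c + inverse (x n)"
      using pos by eventually_elim (use s in \<open>simp add: pos_divide_le_eq distrib_right\<close>)
    note inv = tendsto_inverse_0_at_top[OF x]
    show "(\<lambda>n. c - inverse (x n)) \<longlonglongrightarrow> c" using tendsto_diff[OF tendsto_const inv, of c] by simp
    show "(\<lambda>n. c + inverse (x n)) \<longlonglongrightarrow> c" using tendsto_add[OF tendsto_const inv, of c] by simp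
  qed
  have "c * x n - 1 \<le> real (nat \<lfloor>c * x n\<rfloor>) \<and> real (nat \<lfloor>c * x n\<rfloor>) \<le> c * x n + 1"
    "c * x n - 1 \<le> real (nat \<lceil>c * x n\<rceil>) \<and> real (nat \<lceil>c * x n\<rceil>) \<le> c * x n + 1" if "0 < x n" for n
  proof -
    have "0 \<le> c * x n" using c that by simp
    then show "c * x n - 1 \<le> real (nat \<lfloor>c * x n\<rfloor>) \<and> real (nat \<lfloor>c * x n\<rfloor>) \<le> c * x n + 1"
      "c * x n - 1 \<le> real (nat \<lceil>c * x n\<rceil>) \<and> real (nat \<lceil>c * x n\<rceil>) \<le> c * x n + 1" by linarith+
  qed
  from lim[OF this(1)] lim[OF this(2)]
  show "(\<lambda>n. real (nat \<lfloor>c * x n\<rfloor>) / x n) \<longlonglongrightarrow> c" "(\<lambda>n. real (nat \<lceil>c * x n\<rceil>) / x n) \<longlonglongrightarrow> c"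
    by blast+
qed

text \<open>Let \<open>c < 1\<close>. By monotonicity \<open>a N - b (c N) \<le> a n - b n\<close>
  for all \<open>n\<close> between \<open>c N\<close> and \<open>N\<close>. The window lemma makes
  the left side at most \<open>e / sqrt N\<close>, and \<open>b (c N)\<close> is about
  \<open>L / sqrt (c N)\<close>; then \<open>c\<close> tends to 1. Windows above \<open>N\<close>
  give the lower bound in the same way.\<close>

theorem tauberian_sqrt:
  fixes a b :: "nat \<Rightarrow> real"
  assumes a: "decseq a" "\<And>n. 0 \<le> a n" and b: "decseq b" "\<And>n. 0 \<le> b n"
    and b_gf: "\<And>N. 0 < N \<Longrightarrow> (\<Sum>n. (a n + b n) * exp (- 1 / real N) ^ n) \<le> C * sqrt (real N)"
    and d_gf: "\<And>k. (\<lambda>N. (\<Sum>n. (a n - b n) * exp (- real (Suc k) / real N) ^ n) / sqrt (real N)) \<longlonglongrightarrow> 0"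
    and lim: "(\<lambda>n. b n * sqrt (real n)) \<longlonglongrightarrow> L"
  shows "(\<lambda>n. a n * sqrt (real n)) \<longlonglongrightarrow> L"
proof -
  have bd: "\<bar>a n - b n\<bar> \<le> a n + b n" "\<bar>b n - a n\<bar> \<le> a n + b n" "a n + b n \<le> a 0 + b 0" for n
    using a(2)[of n] b(2)[of n] decseqD[OF a(1), of 0 n] decseqD[OF b(1), of 0 n] by auto
  have d_gf': "(\<lambda>N. (\<Sum>n. (b n - a n) * exp (- real (Suc k) / real N) ^ n) / sqrt (real N)) \<longlonglongrightarrow> 0" for k
  proof -
    have "summable (\<lambda>n. (a n - b n) * exp (- real (Suc k) / real N) ^ n)" if "N > 0" for N
    proof (rule summable_bounded_power)
      show "\<bar>a n - b n\<bar> \<le> a 0 + b 0" for n using bd[of n] by linarith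
    qed (use that in \<open>auto intro: divide_neg_pos\<close>)
    from suminf_minus[OF this]
    have "(\<Sum>n. (b n - a n) * exp (- real (Suc k) / real N) ^ n) / sqrt (real N)
      = - ((\<Sum>n. (a n - b n) * exp (- real (Suc k) / real N) ^ n) / sqrt (real N))" for N
      by (cases "N = 0") (simp_all add: algebra_simps)
    then show ?thesis using tendsto_minus[OF d_gf[of k]] by simp
  qed
  note win = tauberian_window[OF bd(1) bd(3) b_gf d_gf] tauberian_window[OF bd(2) bd(3) b_gf d_gf']
  have upper: "\<forall>\<^sub>F N in sequentially. a N * sqrt (real N) \<le> L / sqrt c + e" if "0 < c" "c < 1" "0 < e" for c e
  proof -
    have l: "(\<lambda>N. b (nat \<lceil>c * real N\<rceil>) * sqrt (real N)) \<longlonglongrightarrow> L / sqrt c"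
      by (intro tendsto_scaled_index[OF lim] tendsto_round_divide filterlim_real_sequentially) (use that in auto)
    have "\<forall>\<^sub>F N in sequentially. b (nat \<lceil>c * real N\<rceil>) * sqrt (real N) < L / sqrt c + e / 2"
      using order_tendstoD(2)[OF l, of "L / sqrt c + e / 2"] that by simp
    moreover have "\<forall>\<^sub>F N in sequentially. \<forall>t. (\<forall>n. c * real N \<le> real n \<and> real n \<le> 1 * real N \<longrightarrow> t \<le> a n - b n)
        \<longrightarrow> t * sqrt (real N) \<le> e / 2"
      by (rule win(1)) (use that in auto)
    ultimately show ?thesis
    proof eventually_elim
      case (elim N)
      have "\<forall>n. c * real N \<le> real n \<and> real n \<le> 1 * real N \<longrightarrow> a N - b (nat \<lceil>c * real N\<rceil>) \<le> a n - b n"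
      proof (intro allI impI)
        fix n assume n: "c * real N \<le> real n \<and> real n \<le> 1 * real N"
        then have "n \<le> N" "nat \<lceil>c * real N\<rceil> \<le> n" by (auto simp: ceiling_le_iff nat_le_iff)
        then have "a N \<le> a n" "b n \<le> b (nat \<lceil>c * real N\<rceil>)"
          using decseqD[OF a(1)] decseqD[OF b(1)] by blast+
        then show "a N - b (nat \<lceil>c * real N\<rceil>) \<le> a n - b n" by linarith
      qed
      then have "(a N - b (nat \<lceil>c * real N\<rceil>)) * sqrt (real N) \<le> e / 2" using elim(2) by blast
      then show ?case using elim(1) by (simp add: algebra_simps)
    qed
  qed
  have lower: "\<forall>\<^sub>F N in sequentially. a N * sqrt (real N) \<ge> L / sqrt c - e" if "1 < c" "0 < e" for c e
  proof -
    have l: "(\<lambda>N. b (nat \<lfloor>c * real N\<rfloor>) * sqrt (real N)) \<longlonglongrightarrow> L / sqrt c"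
      by (intro tendsto_scaled_index[OF lim] tendsto_round_divide filterlim_real_sequentially) (use that in auto)
    have "\<forall>\<^sub>F N in sequentially. b (nat \<lfloor>c * real N\<rfloor>) * sqrt (real N) > L / sqrt c - e / 2"
      using order_tendstoD(1)[OF l, of "L / sqrt c - e / 2"] that by simp
    moreover have "\<forall>\<^sub>F N in sequentially. \<forall>t. (\<forall>n. 1 * real N \<le> real n \<and> real n \<le> c * real N \<longrightarrow> t \<le> b n - a n)
        \<longrightarrow> t * sqrt (real N) \<le> e / 2"
      by (rule win(2)) (use that in auto)
    ultimately show ?thesis
    proof eventually_elim
      case (elim N)
      have "\<forall>n. 1 * real N \<le> real n \<and> real n \<le> c * real N \<longrightarrow> b (nat \<lfloor>c * real N\<rfloor>) - a N \<le> b n - a n"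
      proof (intro allI impI)
        fix n assume n: "1 * real N \<le> real n \<and> real n \<le> c * real N"
        then have "N \<le> n" "n \<le> nat \<lfloor>c * real N\<rfloor>" by (auto simp: le_nat_floor)
        then have "a n \<le> a N" "b (nat \<lfloor>c * real N\<rfloor>) \<le> b n"
          using decseqD[OF a(1)] decseqD[OF b(1)] by blast+
        then show "b (nat \<lfloor>c * real N\<rfloor>) - a N \<le> b n - a n" by linarith
      qed
      then have "(b (nat \<lfloor>c * real N\<rfloor>) - a N) * sqrt (real N) \<le> e / 2" using elim(2) by blast
      then show ?case using elim(1) by (simp add: algebra_simps)
    qed
  qed
  have near: "((\<lambda>c. L / sqrt c) \<longlongrightarrow> L / sqrt 1) (at 1)" by (intro tendsto_intros) auto
  show ?thesis
  proof (rule order_tendstoI)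
    fix x assume x: "x < L"
    have "\<forall>\<^sub>F c in at_right 1. x + (L - x) / 2 < L / sqrt c"
      using order_tendstoD(1)[OF near, of "x + (L - x) / 2"] x by (simp add: eventually_at_split field_simps)
    then have "\<forall>\<^sub>F c in at_right 1. x + (L - x) / 2 < L / sqrt c \<and> (1::real) < c"
      using eventually_at_right_less by (rule eventually_conj)
    then obtain c where c: "x + (L - x) / 2 < L / sqrt c" "1 < c"
      using eventually_happens'[OF trivial_limit_at_right_real] by blast
    have "(L - x) / 2 > 0" using x by simp
    from lower[OF c(2) this] show "\<forall>\<^sub>F n in sequentially. x < a n * sqrt (real n)"
      by (rule eventually_mono) (use c in linarith)
  next
    fix x assume x: "L < x"
    have "\<forall>\<^sub>F c in at_left 1. L / sqrt c < x - (x - L) / 2"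
      using order_tendstoD(2)[OF near, of "x - (x - L) / 2"] x by (simp add: eventually_at_split field_simps)
    then have "\<forall>\<^sub>F c in at_left 1. L / sqrt c < x - (x - L) / 2 \<and> c \<in> {0<..<1::real}"
      using eventually_at_left_real[of 0 "1::real"] by (intro eventually_conj) auto
    then obtain c where c: "L / sqrt c < x - (x - L) / 2" "0 < c" "c < 1"
      using eventually_happens'[OF trivial_limit_at_left_real] by (metis (no_types, lifting) greaterThanLessThan_iff)
    have "(x - L) / 2 > 0" using x by simp
    from upper[OF c(2,3) this] show "\<forall>\<^sub>F n in sequentially. a n * sqrt (real n) < x"
      by (rule eventually_mono) (use c in linarith)
  qed
qed

section \<open>Random words and Galton-Watson trees\<close>

lemma prob_replicate_pmf_cylinder:
  "measure_pmf.prob (replicate_pmf n p) {w. \<forall>i<n. w ! i \<in> S i} = (\<Prod>i<n. measure_pmf.prob p (S i))"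
proof (induction n arbitrary: S)
  case 0
  show ?case by simp
next
  case (Suc n)
  let ?X = "{w. \<forall>i<Suc n. w ! i \<in> S i}" and ?Y = "{w. \<forall>i<n. w ! i \<in> S (Suc i)}"
  have vim: "(#) x -` ?X = (if x \<in> S 0 then ?Y else {})" for x
    by (auto simp: All_less_Suc2)
  have "emeasure (replicate_pmf (Suc n) p) ?X = (\<integral>\<^sup>+x. emeasure (replicate_pmf n p) ((#) x -` ?X) \<partial>p)"
    unfolding replicate_pmf_Suc' by simp
  also have "\<dots> = (\<integral>\<^sup>+x. indicator (S 0) x * emeasure (replicate_pmf n p) ?Y \<partial>p)"
    unfolding vim by (intro nn_integral_cong) (auto simp: indicator_def)
  also have "\<dots> = emeasure p (S 0) * emeasure (replicate_pmf n p) ?Y"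
    by (simp add: nn_integral_multc)
  finally have "measure_pmf.prob (replicate_pmf (Suc n) p) ?X
      = measure_pmf.prob p (S 0) * measure_pmf.prob (replicate_pmf n p) ?Y"
    by (simp add: measure_pmf.emeasure_eq_measure ennreal_mult'[symmetric] del: replicate_pmf.simps)
  also have "\<dots> = (\<Prod>i<Suc n. measure_pmf.prob p (S i))"
    unfolding Suc.IH prod.lessThan_Suc_shift by simp
  finally show ?case .
qed

text \<open>The letters allowed at position \<open>l\<close> if \<open>v\<close> is to stand at
  position \<open>i\<close>. This turns occurrences into cylinder events, whose probability is a
  product over positions.\<close>

definition window :: "nat \<Rightarrow> 'a list \<Rightarrow> nat \<Rightarrow> 'a set" where
  "window i v l = (if i \<le> l \<and> l < i + length v then {v ! (l - i)} else UNIV)"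

lemma take_drop_eq_iff_window:
  assumes "i + length v \<le> length w"
  shows "take (length v) (drop i w) = v \<longleftrightarrow> (\<forall>l<length w. w ! l \<in> window i v l)"
proof -
  have "take (length v) (drop i w) = v \<longleftrightarrow> (\<forall>l<length v. w ! (i + l) = v ! l)"
    using assms by (auto simp: list_eq_iff_nth_eq)
  also have "\<dots> \<longleftrightarrow> (\<forall>l<length w. w ! l \<in> window i v l)"
  proof safe
    fix l assume "\<forall>l<length v. w ! (i + l) = v ! l" "l < length w"
    then show "w ! l \<in> window i v l"
      unfolding window_def using le_add_diff_inverse[of i l] by (auto simp del: le_add_diff_inverse)
        (metis add_less_cancel_left le_add_diff_inverse)
  next
    fix l assume "\<forall>l<length w. w ! l \<in> window i v l" "l < length v"
    then have "w ! (i + l) \<in> window i v (i + l)" using assms by simp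
    then show "w ! (i + l) = v ! l" using \<open>l < length v\<close> by (simp add: window_def)
  qed
  finally show ?thesis .
qed

lemma prod_window:
  assumes "i + length v \<le> n"
  shows "(\<Prod>l<n. measure_pmf.prob p (window i v l)) = prod_list (map (pmf p) v)"
proof -
  have "(\<Prod>l<n. measure_pmf.prob p (window i v l)) = (\<Prod>l\<in>{i..<i + length v}. measure_pmf.prob p (window i v l))"
    using assms by (intro prod.mono_neutral_right) (auto simp: window_def)
  also have "\<dots> = (\<Prod>l\<in>{i..<i + length v}. pmf p (v ! (l - i)))"
    by (intro prod.cong) (auto simp: window_def measure_pmf_single)
  also have "\<dots> = (\<Prod>l\<in>{0..<length v}. pmf p (v ! l))"
    by (rule prod.reindex_bij_witness[of _ "\<lambda>l. l + i" "\<lambda>l. l - i"]) auto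
  also have "\<dots> = prod_list (map (pmf p) v)" by (induction v rule: rev_induct) (simp_all add: nth_append)
  finally show ?thesis .
qed

lemma measure_replicate_pmf_cong:
  assumes "\<And>w. length w = n \<Longrightarrow> P w \<longleftrightarrow> Q w"
  shows "measure_pmf.prob (replicate_pmf n p) {w. P w} = measure_pmf.prob (replicate_pmf n p) {w. Q w}"
  using assms by (intro measure_pmf.finite_measure_eq_AE) (auto simp: AE_measure_pmf_iff set_replicate_pmf)

lemma prob_substring:
  assumes "i + length v \<le> n"
  shows "measure_pmf.prob (replicate_pmf n p) {w. take (length v) (drop i w) = v} = prod_list (map (pmf p) v)"
proof -
  have "measure_pmf.prob (replicate_pmf n p) {w. take (length v) (drop i w) = v}
      = measure_pmf.prob (replicate_pmf n p) {w. \<forall>l<n. w ! l \<in> window i v l}"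
    using assms take_drop_eq_iff_window by (intro measure_replicate_pmf_cong) blast
  then show ?thesis unfolding prob_replicate_pmf_cylinder using prod_window[OF assms] by simp
qed

lemma prob_substring_twice:
  assumes "i + length v \<le> j" "j + length v \<le> n"
  shows "measure_pmf.prob (replicate_pmf n p)
      {w. take (length v) (drop i w) = v \<and> take (length v) (drop j w) = v} = (prod_list (map (pmf p) v))\<^sup>2"
proof -
  have "measure_pmf.prob (replicate_pmf n p) {w. take (length v) (drop i w) = v \<and> take (length v) (drop j w) = v}
      = measure_pmf.prob (replicate_pmf n p) {w. \<forall>l<n. w ! l \<in> window i v l \<inter> window j v l}"
    using assms take_drop_eq_iff_window[of i v] take_drop_eq_iff_window[of j v]
    by (intro measure_replicate_pmf_cong) auto
  \<comment> \<open>The windows are disjoint, so at each position one of the two sets is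
    \<open>UNIV\<close>, and the intersection has the product probability.\<close>
  also have "\<dots> = (\<Prod>l<n. measure_pmf.prob p (window i v l) * measure_pmf.prob p (window j v l))"
    unfolding prob_replicate_pmf_cylinder
    using assms by (intro prod.cong) (auto simp: window_def)
  also have "\<dots> = (prod_list (map (pmf p) v))\<^sup>2"
    using assms by (simp add: prod.distrib prod_window power2_eq_square)
  finally show ?thesis .
qed

lemma prob_occ:
  "i + num_vertices s \<le> n \<Longrightarrow> measure_pmf.prob (replicate_pmf n p) {w. occ s i w} = weight (pmf p) s"
  using prob_substring[of i "code s" n p] by (simp add: occ_def weight_code)

text \<open>Overlapping occurrences do not exist, nor do occurrences that run beyond the end. All
  others use disjoint letters and have exactly the squared probability.\<close>

lemma prob_occ_twice_le:
  assumes "i < j"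
  shows "measure_pmf.prob (replicate_pmf n p) {w. occ s i w \<and> occ s j w} \<le> (weight (pmf p) s)\<^sup>2"
proof (cases "i + num_vertices s \<le> j \<and> j + num_vertices s \<le> n")
  case True
  then show ?thesis using prob_substring_twice[of i "code s" j n p] by (simp add: occ_def weight_code)
next
  case False
  have "measure_pmf.prob (replicate_pmf n p) {w. occ s i w \<and> occ s j w} = measure_pmf.prob (replicate_pmf n p) {w. False}"
    using False occ_no_overlap[of s i _ j] occ_length[of s j] assms by (intro measure_replicate_pmf_cong) blast
  then show ?thesis by simp
qed

lemma pmf_replicate_pmf: "length w = n \<Longrightarrow> pmf (replicate_pmf n p) w = prod_list (map (pmf p) w)"
proof -
  assume n: "length w = n"
  have "measure_pmf.prob (replicate_pmf n p) {w'. take (length w) (drop 0 w') = w}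
      = measure_pmf.prob (replicate_pmf n p) {w'. w' = w}"
    using n by (intro measure_replicate_pmf_cong) auto
  then show ?thesis using prob_substring[of 0 w n p] n by (simp add: measure_pmf_single)
qed

section \<open>Tree weights as probabilities in a random word\<close>

lemma weight_nonneg: "(\<And>m. 0 \<le> f m) \<Longrightarrow> 0 \<le> weight f t"
  unfolding weight_code by (intro prod_list_nonneg) auto

lemma weight_pmf_nonneg [simp]: "0 \<le> weight (pmf p) t"
  by (rule weight_nonneg) simp

text \<open>The events are disjoint, as at most one tree starts at position
  \<open>i\<close>.\<close>

lemma sum_weight_eq_prob:
  assumes "finite X" "\<And>s. s \<in> X \<Longrightarrow> i + num_vertices s \<le> n"
  shows "measure_pmf.prob (replicate_pmf n p) {w. \<exists>s\<in>X. occ s i w} = (\<Sum>s\<in>X. weight (pmf p) s)"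
proof -
  have "measure_pmf.prob (replicate_pmf n p) (\<Union>s\<in>X. {w. occ s i w}) = (\<Sum>s\<in>X. measure_pmf.prob (replicate_pmf n p) {w. occ s i w})"
    using assms(1) occ_unique by (intro measure_pmf.finite_measure_finite_Union) (auto simp: disjoint_family_on_def)
  also have "\<dots> = (\<Sum>s\<in>X. weight (pmf p) s)" using assms(2) by (intro sum.cong prob_occ) auto
  also have "(\<Union>s\<in>X. {w. occ s i w}) = {w. \<exists>s\<in>X. occ s i w}" by auto
  finally show ?thesis .
qed

text \<open>Kraft's inequality for the prefix-free code: all trees of \<open>X\<close> are looked
  for at position 0 of one word that is long enough for each of them.\<close>

lemma sum_weight_le_1:
  assumes "finite X"
  shows "(\<Sum>s\<in>X. weight (pmf p) s) \<le> 1"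
proof -
  have "s \<in> X \<Longrightarrow> 0 + num_vertices s \<le> sum num_vertices X" for s
    using assms by (simp add: member_le_sum)
  from sum_weight_eq_prob[OF assms this, of p] show ?thesis by (metis measure_pmf.prob_le_1)
qed

lemma sum_total_weight: "(\<Sum>k\<le>N. total_weight f k) = (\<Sum>s | num_vertices s \<le> N. weight f s)"
proof -
  have "(\<Sum>k\<le>N. total_weight f k) = (\<Sum>s\<in>(\<Union>k\<le>N. {s. num_vertices s = k}). weight f s)"
    unfolding total_weight_def
    by (rule sum.UNION_disjoint[symmetric]) (auto simp: finite_plane_trees_of_size)
  also have "(\<Union>k\<le>N. {s. num_vertices s = k}) = {s. num_vertices s \<le> N}" by auto
  finally show ?thesis .
qed

lemma total_weight_nonneg: "0 \<le> total_weight (pmf p) k"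
  unfolding total_weight_def by (intro sum_nonneg) simp

lemma total_weight_summable: "summable (total_weight (pmf p))"
  and total_weight_suminf_le: "(\<Sum>k. total_weight (pmf p) k) \<le> 1"
proof -
  have bd: "(\<Sum>k<n. total_weight (pmf p) k) \<le> 1" for n
  proof -
    have "(\<Sum>k<n. total_weight (pmf p) k) \<le> (\<Sum>k\<le>n. total_weight (pmf p) k)"
      by (intro sum_mono2) (auto simp: total_weight_nonneg)
    then show ?thesis unfolding sum_total_weight using sum_weight_le_1[OF finite_trees_size_le] by (rule order_trans)
  qed
  show "summable (total_weight (pmf p))"
    by (rule summableI_nonneg_bounded[OF total_weight_nonneg bd])
  then show "(\<Sum>k. total_weight (pmf p) k) \<le> 1" by (rule suminf_le_const) (rule bd)
qed

section \<open>The generating function of the size of a Galton-Watson tree\<close>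

definition tree_gf :: "nat pmf \<Rightarrow> real \<Rightarrow> real" where
  "tree_gf p z = (\<Sum>n. total_weight (pmf p) n * z ^ n)"

lemma tree_gf_summable:
  assumes "0 \<le> z" "z \<le> 1"
  shows "summable (\<lambda>n. total_weight (pmf p) n * z ^ n)"
proof (rule summable_comparison_test'[OF total_weight_summable[of p]])
  show "norm (total_weight (pmf p) n * z ^ n) \<le> total_weight (pmf p) n" for n
    using assms total_weight_nonneg[of p n] by (simp add: abs_mult mult_left_le power_le_one)
qed

lemma tree_gf_bounds:
  assumes "0 \<le> z" "z \<le> 1"
  shows "0 \<le> tree_gf p z" "tree_gf p z \<le> 1"
proof -
  show "0 \<le> tree_gf p z" unfolding tree_gf_def
    using assms by (intro suminf_nonneg tree_gf_summable) (auto simp: total_weight_nonneg)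
  have "tree_gf p z \<le> (\<Sum>k. total_weight (pmf p) k)" unfolding tree_gf_def
    using assms total_weight_nonneg[of p]
    by (intro suminf_le tree_gf_summable total_weight_summable) (auto simp: mult_left_le power_le_one)
  then show "tree_gf p z \<le> 1" using total_weight_suminf_le by (rule order_trans)
qed

text \<open>Gives the joint contribution of the \<open>k\<close> subtrees at a root. Integrals in
  \<open>ennreal\<close> over the counting measure allow every rearrangement of the infinite
  sums.\<close>

lemma nn_integral_lists_prod:
  fixes x :: "'a \<Rightarrow> ennreal"
  shows "(\<integral>\<^sup>+ts. prod_list (map x ts) * indicator {ts. length ts = k} ts \<partial>count_space UNIV)
    = (\<integral>\<^sup>+t. x t \<partial>count_space UNIV) ^ k"
proof (induction k)
  case 0
  have "(\<integral>\<^sup>+ts. prod_list (map x ts) * indicator {ts. length ts = 0} ts \<partial>count_space UNIV)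
    = (\<integral>\<^sup>+(ts::'a list). 1 * indicator {[]} ts \<partial>count_space UNIV)"
    by (intro nn_integral_cong) (auto simp: indicator_def)
  then show ?case by simp
next
  case (Suc k)
  let ?f = "\<lambda>k ts. prod_list (map x ts) * indicator {ts. length ts = k} ts"
  have "(\<integral>\<^sup>+ts. ?f (Suc k) ts \<partial>count_space UNIV) = (\<integral>\<^sup>+ts. ?f (Suc k) ts \<partial>count_space {ts. ts \<noteq> []})"
    by (subst (2) nn_integral_count_space_indicator) (auto intro!: nn_integral_cong simp: indicator_def)
  also have "\<dots> = (\<integral>\<^sup>+y. ?f (Suc k) ((\<lambda>(t, ts). t # ts) y) \<partial>count_space UNIV)"
    by (rule nn_integral_bij_count_space[symmetric])
       (auto simp: bij_betw_def inj_on_def image_iff neq_Nil_conv)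
  also have "\<dots> = (\<integral>\<^sup>+t. \<integral>\<^sup>+ts. ?f (Suc k) (t # ts) \<partial>count_space UNIV \<partial>count_space UNIV)"
    by (subst nn_integral_fst_count_space[symmetric]) simp
  also have "\<dots> = (\<integral>\<^sup>+t. \<integral>\<^sup>+ts. x t * ?f k ts \<partial>count_space UNIV \<partial>count_space UNIV)"
    by (intro nn_integral_cong) (auto simp: indicator_def mult.assoc)
  also have "\<dots> = (\<integral>\<^sup>+t. x t * (\<integral>\<^sup>+ts. ?f k ts \<partial>count_space UNIV) \<partial>count_space UNIV)"
    by (simp add: nn_integral_cmult)
  also have "\<dots> = (\<integral>\<^sup>+t. x t \<partial>count_space UNIV) ^ Suc k"
    unfolding Suc.IH by (simp add: nn_integral_multc)
  finally show ?case .
qed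

lemma nn_integral_by_nat_fibres:
  fixes f :: "'a \<Rightarrow> ennreal" and s :: "'a \<Rightarrow> nat"
  shows "(\<integral>\<^sup>+t. f t \<partial>count_space UNIV) = (\<Sum>n. \<integral>\<^sup>+t. f t * indicator {t. s t = n} t \<partial>count_space UNIV)"
proof -
  have "(\<Sum>n. f t * indicator {t. s t = n} t) = f t" for t
  proof -
    have "(\<Sum>n. f t * indicator {t. s t = n} t) = (\<Sum>n\<in>{s t}. f t * indicator {t. s t = n} t)"
      by (rule suminf_finite) auto
    then show ?thesis by simp
  qed
  then show ?thesis by (subst nn_integral_suminf[symmetric]) auto
qed

text \<open>Decomposition at the root: \<open>Node\<close> is a bijection from lists of trees to
  trees, the lists are grouped by their length \<open>k\<close>, and \<open>k\<close> subtrees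
  contribute \<open>tree_gf p z ^ k\<close>.\<close>

lemma tree_gf_functional_eq:
  assumes "0 \<le> z" "z \<le> 1"
  shows "tree_gf p z = z * measure_pmf.expectation p (\<lambda>k. tree_gf p z ^ k)"
proof -
  let ?x = "\<lambda>t. ennreal (weight (pmf p) t * z ^ num_vertices t)"
  let ?Y = "tree_gf p z"
  note Y = tree_gf_bounds[OF assms, of p]
  have fin: "(\<integral>\<^sup>+t. ?x t * indicator {t. num_vertices t = n} t \<partial>count_space UNIV)
      = ennreal (total_weight (pmf p) n * z ^ n)" for n
  proof -
    have "(\<integral>\<^sup>+t. ?x t * indicator {t. num_vertices t = n} t \<partial>count_space UNIV)
      = (\<integral>\<^sup>+t. ?x t \<partial>count_space {t. num_vertices t = n})"
      by (subst (2) nn_integral_count_space_indicator) (auto intro!: nn_integral_cong simp: indicator_def)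
    also have "\<dots> = (\<Sum>t | num_vertices t = n. ?x t)"
      by (rule nn_integral_count_space_finite) (rule finite_plane_trees_of_size)
    also have "\<dots> = ennreal (\<Sum>t | num_vertices t = n. weight (pmf p) t * z ^ num_vertices t)"
      using assms by (intro sum_ennreal) auto
    also have "(\<Sum>t | num_vertices t = n. weight (pmf p) t * z ^ num_vertices t) = total_weight (pmf p) n * z ^ n"
      unfolding total_weight_def sum_distrib_right by (intro sum.cong) auto
    finally show ?thesis .
  qed
  have G: "(\<integral>\<^sup>+t. ?x t \<partial>count_space UNIV) = ennreal ?Y"
  proof -
    have "(\<integral>\<^sup>+t. ?x t \<partial>count_space UNIV) = (\<Sum>n. ennreal (total_weight (pmf p) n * z ^ n))"
      unfolding fin[symmetric] by (rule nn_integral_by_nat_fibres)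
    also have "\<dots> = ennreal ?Y" unfolding tree_gf_def
      using assms by (intro suminf_ennreal2 tree_gf_summable) (auto simp: total_weight_nonneg)
    finally show ?thesis .
  qed
  have Nodex: "?x (Node ts) = ennreal (z * pmf p (length ts)) * prod_list (map ?x ts)" for ts
  proof -
    have "ennreal (prod_list (map (weight (pmf p)) ts) * z ^ sum_list (map num_vertices ts)) = prod_list (map ?x ts)"
    proof (induction ts)
      case (Cons t ts)
      have "ennreal (prod_list (map (weight (pmf p)) (t # ts)) * z ^ sum_list (map num_vertices (t # ts)))
        = ennreal ((weight (pmf p) t * z ^ num_vertices t) * (prod_list (map (weight (pmf p)) ts) * z ^ sum_list (map num_vertices ts)))"
        by (simp add: power_add mult_ac)
      also have "\<dots> = ?x t * prod_list (map ?x ts)"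
        unfolding Cons.IH[symmetric] using assms by (intro ennreal_mult') simp
      finally show ?case by simp
    qed simp
    moreover have "?x (Node ts) = ennreal ((z * pmf p (length ts)) * (prod_list (map (weight (pmf p)) ts) * z ^ sum_list (map num_vertices ts)))"
      by (simp add: mult_ac)
    moreover have "\<dots> = ennreal (z * pmf p (length ts)) *
        ennreal (prod_list (map (weight (pmf p)) ts) * z ^ sum_list (map num_vertices ts))"
      using assms by (intro ennreal_mult') simp
    ultimately show ?thesis by (simp only:)
  qed
  have "ennreal ?Y = (\<integral>\<^sup>+t. ?x t \<partial>count_space UNIV)" by (rule G[symmetric])
  also have "\<dots> = (\<integral>\<^sup>+ts. ?x (Node ts) \<partial>count_space UNIV)"
  proof (rule nn_integral_bij_count_space[symmetric])
    show "bij_betw Node UNIV UNIV" by (auto simp: bij_betw_def inj_on_def image_iff) (metis plane_tree.exhaust)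
  qed
  also have "\<dots> = (\<Sum>k. \<integral>\<^sup>+ts. ?x (Node ts) * indicator {ts. length ts = k} ts \<partial>count_space UNIV)"
    by (rule nn_integral_by_nat_fibres)
  also have "\<dots> = (\<Sum>k. ennreal (z * pmf p k) * (\<integral>\<^sup>+ts. prod_list (map ?x ts) * indicator {ts. length ts = k} ts \<partial>count_space UNIV))"
    unfolding Nodex
    by (subst nn_integral_cmult[symmetric]) (auto intro!: suminf_cong nn_integral_cong simp: indicator_def)
  also have "\<dots> = (\<Sum>k. ennreal (z * pmf p k) * ennreal ?Y ^ k)"
    unfolding nn_integral_lists_prod G by simp
  also have "\<dots> = (\<Sum>k. ennreal z * (ennreal (pmf p k) * ennreal (?Y ^ k)))"
    using Y assms by (simp add: ennreal_mult' ennreal_power mult.assoc)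
  also have "\<dots> = ennreal z * (\<Sum>k. ennreal (pmf p k) * ennreal (?Y ^ k))" by simp
  also have "(\<Sum>k. ennreal (pmf p k) * ennreal (?Y ^ k)) = (\<integral>\<^sup>+k. ennreal (?Y ^ k) \<partial>p)"
    by (simp add: nn_integral_measure_pmf nn_integral_count_space_nat)
  also have "\<dots> = ennreal (measure_pmf.expectation p (\<lambda>k. ?Y ^ k))"
    using Y by (intro nn_integral_eq_integral integrable_bounded_pmf[where B = 1]) (auto simp: power_le_one)
  finally have "ennreal ?Y = ennreal (z * measure_pmf.expectation p (\<lambda>k. ?Y ^ k))"
    using assms by (simp add: ennreal_mult')
  moreover have "0 \<le> z * measure_pmf.expectation p (\<lambda>k. ?Y ^ k)"
    using assms Y by (intro mult_nonneg_nonneg integral_nonneg_AE) auto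
  ultimately show ?thesis using Y by (simp add: ennreal_inj)
qed

section \<open>The tail of the size of a critical Galton-Watson tree\<close>

text \<open>\<open>((1 - w)\<^sup>k - 1 + k w) / w\<^sup>2\<close>, written as a polynomial so that \<open>w = 0\<close> is not exceptional.\<close>

primrec taylor2 :: "real \<Rightarrow> nat \<Rightarrow> real" where
  "taylor2 w 0 = 0"
| "taylor2 w (Suc k) = (1 - w) * taylor2 w k + real k"

lemma taylor2_eq: "(1 - w) ^ k - 1 + real k * w = w\<^sup>2 * taylor2 w k"
proof (induction k)
  case (Suc k)
  have "(1 - w) ^ Suc k - 1 + real (Suc k) * w = (1 - w) * ((1 - w) ^ k - 1 + real k * w) + w\<^sup>2 * real k"
    by (simp add: algebra_simps power2_eq_square)
  also have "\<dots> = w\<^sup>2 * taylor2 w (Suc k)" unfolding Suc.IH by (simp add: algebra_simps)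
  finally show ?case .
qed simp

lemma taylor2_nonneg: "0 \<le> w \<Longrightarrow> w \<le> 1 \<Longrightarrow> 0 \<le> taylor2 w k"
  by (induction k) auto

lemma taylor2_ge_1: "0 \<le> w \<Longrightarrow> w \<le> 1 \<Longrightarrow> 2 \<le> k \<Longrightarrow> 1 \<le> taylor2 w k"
proof -
  assume w: "0 \<le> w" "w \<le> 1" and "2 \<le> k"
  then obtain j where j: "k = Suc j" "1 \<le> j" by (cases k) auto
  have "0 \<le> (1 - w) * taylor2 w j" using w taylor2_nonneg[OF w, of j] by simp
  then show ?thesis using j by simp
qed

text \<open>The right side is the value at \<open>w = 0\<close>. It does not depend on
  \<open>w\<close> and becomes the integrable majorant for dominated convergence.\<close>

lemma taylor2_le: "0 \<le> w \<Longrightarrow> w \<le> 1 \<Longrightarrow> taylor2 w k \<le> real k * (real k - 1) / 2"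
proof (induction k)
  case (Suc k)
  then have "(1 - w) * taylor2 w k \<le> 1 * taylor2 w k"
    using taylor2_nonneg[of w k] by (intro mult_right_mono) auto
  then show ?case using Suc by (simp add: field_simps)
qed simp

lemma taylor2_tendsto: "w \<longlonglongrightarrow> 0 \<Longrightarrow> (\<lambda>n. taylor2 (w n) k) \<longlonglongrightarrow> real k * (real k - 1) / 2"
proof (induction k)
  case (Suc k)
  have "(\<lambda>n. (1 - w n) * taylor2 (w n) k + real k) \<longlonglongrightarrow> (1 - 0) * (real k * (real k - 1) / 2) + real k"
    using Suc by (intro tendsto_intros) auto
  then show ?case by (simp add: field_simps)
qed simp

section \<open>Critical offspring laws and the square-root singularity\<close>

locale critical_offspring =
  fixes \<xi> :: "nat pmf"
  assumes square_integrable: "integrable (measure_pmf \<xi>) (\<lambda>k. (real k)\<^sup>2)"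
    and mean: "measure_pmf.expectation \<xi> real = 1"
    and leaf: "0 < pmf \<xi> 0"
begin

abbreviation "p \<equiv> pmf \<xi>"
abbreviation "q \<equiv> total_weight (pmf \<xi>)"

text \<open>As the mean is 1, this second factorial moment is the variance. For the tilted law of a
  simply generated family it equals
  \<open>\<tau>\<^sup>2 * \<Phi>''(\<tau>) / \<Phi>(\<tau>)\<close>, which is how
  \<open>\<Phi>''\<close> enters \<open>\<kappa>\<close>.\<close>

definition var :: real where "var = measure_pmf.expectation \<xi> (\<lambda>k. real k * (real k - 1))"

text \<open>A complement, so the mass of infinite trees would be included. That this mass is 0
  follows from \<open>tail_asymp\<close>.\<close>

definition tail :: "nat \<Rightarrow> real" where "tail n = 1 - (\<Sum>k\<le>n. q k)"

lemma integrable_real: "integrable (measure_pmf \<xi>) real"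
proof (rule Bochner_Integration.integrable_bound[OF square_integrable])
  have "norm (real k) \<le> norm ((real k)\<^sup>2)" for k
    by (cases k) (auto simp: power2_eq_square)
  then show "AE k in measure_pmf \<xi>. norm (real k) \<le> norm ((real k)\<^sup>2)" by simp
qed simp

lemma integrable_falling: "integrable (measure_pmf \<xi>) (\<lambda>k. real k * (real k - 1))"
proof -
  have "(\<lambda>k. real k * (real k - 1)) = (\<lambda>k. (real k)\<^sup>2 - real k)"
    by (auto simp: algebra_simps power2_eq_square)
  then show ?thesis using square_integrable integrable_real by simp
qed

text \<open>Otherwise the mean would be \<open>p 1\<close>, which is below 1 because
  \<open>p 0 > 0\<close>.\<close>

lemma branching: "\<exists>k\<ge>2. 0 < p k"
proof (rule ccontr)
  assume "\<not> ?thesis"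
  then have "k \<in> set_pmf \<xi> \<Longrightarrow> k \<in> {0, 1}" for k
    by (metis insertCI less_2_cases not_le pmf_positive One_nat_def)
  then have sub: "set_pmf \<xi> \<subseteq> {0, 1}" by blast
  have "measure_pmf.expectation \<xi> real = (\<Sum>k\<in>{0, 1}. p k *\<^sub>R real k)"
    by (rule integral_measure_pmf) (use sub in auto)
  moreover have "sum p {0, 1} = 1" using sub by (intro sum_pmf_eq_1) auto
  ultimately show False using mean leaf by simp
qed

lemma taylor2_integrable: "0 \<le> w \<Longrightarrow> w \<le> 1 \<Longrightarrow> integrable (measure_pmf \<xi>) (taylor2 w)"
proof (rule Bochner_Integration.integrable_bound[OF integrable_falling])
  assume w: "0 \<le> w" "w \<le> 1"
  have "norm (taylor2 w k) \<le> norm (real k * (real k - 1))" for k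
    using taylor2_nonneg[OF w, of k] taylor2_le[OF w, of k] by simp
  then show "AE k in measure_pmf \<xi>. norm (taylor2 w k) \<le> norm (real k * (real k - 1))" by simp
qed simp

text \<open>A single atom \<open>k \<ge> 2\<close> gives the bound \<open>p k\<close>. Uniformity in
  \<open>w\<close> serves to show that \<open>1 - tree_gf\<close> tends to 0, before the limit of
  this expectation is known.\<close>

lemma taylor2_expectation_lower:
  obtains c where "0 < c" "\<And>w. 0 \<le> w \<Longrightarrow> w \<le> 1 \<Longrightarrow> c \<le> measure_pmf.expectation \<xi> (taylor2 w)"
proof -
  obtain k where k: "2 \<le> k" "0 < p k" using branching by blast
  show thesis
  proof (rule that[OF k(2)])
    fix w :: real assume w: "0 \<le> w" "w \<le> 1"
    have "p k = measure_pmf.expectation \<xi> (indicator {k})" by (simp add: measure_pmf_single)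
    also have "\<dots> \<le> measure_pmf.expectation \<xi> (taylor2 w)"
      using taylor2_nonneg[OF w] taylor2_ge_1[OF w k(1)]
      by (intro integral_mono taylor2_integrable w integrable_bounded_pmf[where B = 1]) (auto simp: indicator_def)
    finally show "p k \<le> measure_pmf.expectation \<xi> (taylor2 w)" .
  qed
qed

lemma var_pos: "0 < var"
proof -
  obtain c where c: "0 < c" "\<And>w. 0 \<le> w \<Longrightarrow> w \<le> 1 \<Longrightarrow> c \<le> measure_pmf.expectation \<xi> (taylor2 w)"
    using taylor2_expectation_lower by blast
  have "measure_pmf.expectation \<xi> (taylor2 0) \<le> measure_pmf.expectation \<xi> (\<lambda>k. real k * (real k - 1))"
  proof (intro integral_mono taylor2_integrable integrable_falling)
    fix k :: nat
    have "0 \<le> real k * (real k - 1)" by (cases k) auto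
    then show "taylor2 0 k \<le> real k * (real k - 1)" using taylor2_le[of 0 k] by simp
  qed auto
  then show ?thesis using c(1) c(2)[of 0] unfolding var_def by simp
qed

text \<open>In \<open>y = z * E (y ^ \<xi>)\<close> with \<open>y = 1 - w\<close>, mean 1 cancels
  the linear terms of the expansion of \<open>y ^ \<xi>\<close> against those of \<open>y\<close>.
  What is left relates \<open>1 - z\<close> to \<open>w\<^sup>2\<close>, the source of the square
  root.\<close>

lemma gf_complement_eq:
  assumes "0 \<le> z" "z \<le> 1"
  defines "w \<equiv> 1 - tree_gf \<xi> z"
  shows "(1 - z) * (1 - w) = z * (w\<^sup>2 * measure_pmf.expectation \<xi> (taylor2 w))"
proof -
  have w: "0 \<le> w" "w \<le> 1" using tree_gf_bounds[OF assms(1,2), of \<xi>] by (auto simp: w_def)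
  have "w\<^sup>2 * measure_pmf.expectation \<xi> (taylor2 w) = measure_pmf.expectation \<xi> (\<lambda>k. w\<^sup>2 * taylor2 w k)"
    by simp
  also have "\<dots> = measure_pmf.expectation \<xi> (\<lambda>k. (1 - w) ^ k - 1 + real k * w)"
    by (simp add: taylor2_eq)
  also have "\<dots> = measure_pmf.expectation \<xi> (\<lambda>k. (1 - w) ^ k) - 1 + w"
  proof -
    have "integrable (measure_pmf \<xi>) (\<lambda>k. (1 - w) ^ k)"
      by (rule integrable_bounded_pmf[where B = 1]) (use w in \<open>auto simp: power_le_one\<close>)
    then show ?thesis using integrable_real mean by simp
  qed
  finally have "z * (w\<^sup>2 * measure_pmf.expectation \<xi> (taylor2 w))
    = z * (measure_pmf.expectation \<xi> (\<lambda>k. (1 - w) ^ k) - 1 + w)" by (rule arg_cong)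
  moreover have "z * measure_pmf.expectation \<xi> (\<lambda>k. (1 - w) ^ k) = 1 - w"
    using tree_gf_functional_eq[OF assms(1,2), of \<xi>] by (simp add: w_def)
  ultimately show ?thesis by (simp add: algebra_simps)
qed

text \<open>The functional equation reads \<open>w\<^sup>2 / (1 - z) = (1 - w) / (z * h w)\<close>,
  where \<open>h w\<close> is the expectation of \<open>taylor2 w\<close>. The uniform lower bound
  on \<open>h\<close> forces \<open>w\<close> to 0; dominated convergence then gives
  \<open>h w\<close> the limit \<open>var / 2\<close>.\<close>

lemma gf_singularity:
  fixes z :: "nat \<Rightarrow> real"
  assumes z: "\<And>N. 0 < z N" "\<And>N. z N < 1" and lim: "z \<longlonglongrightarrow> 1"
  shows "(\<lambda>N. (1 - tree_gf \<xi> (z N)) / sqrt (1 - z N)) \<longlonglongrightarrow> sqrt (2 / var)"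
proof -
  define w where "w N = 1 - tree_gf \<xi> (z N)" for N
  let ?h = "\<lambda>w. measure_pmf.expectation \<xi> (taylor2 w)"
  have w: "0 \<le> w N" "w N \<le> 1" for N
    using tree_gf_bounds[of "z N" \<xi>] z[of N] by (auto simp: w_def less_imp_le)
  have eq: "(1 - z N) * (1 - w N) = z N * ((w N)\<^sup>2 * ?h (w N))" for N
    using gf_complement_eq[of "z N"] z[of N] by (simp add: w_def less_imp_le)
  obtain c where c: "0 < c" "\<And>w. 0 \<le> w \<Longrightarrow> w \<le> 1 \<Longrightarrow> c \<le> ?h w"
    using taylor2_expectation_lower by blast
  have hpos: "0 < ?h (w N)" for N using c(1) c(2)[OF w] by (rule less_le_trans)
  have w2: "(w N)\<^sup>2 = (1 - z N) * ((1 - w N) / (z N * ?h (w N)))" for N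
    using eq[of N] hpos[of N] z(1)[of N] by (simp add: field_simps)
  have le: "(w N)\<^sup>2 \<le> (1 - z N) / (z N * c)" for N
  proof -
    have "(1 - w N) / (z N * ?h (w N)) \<le> 1 / (z N * c)"
      using w[of N] z(1)[of N] c(1) c(2)[OF w[of N]] by (intro frac_le mult_left_mono) auto
    then have "(1 - z N) * ((1 - w N) / (z N * ?h (w N))) \<le> (1 - z N) * (1 / (z N * c))"
      using z(2)[of N] by (intro mult_left_mono) auto
    then show ?thesis using w2[of N] by simp
  qed
  have "(\<lambda>N. (1 - z N) / (z N * c)) \<longlonglongrightarrow> (1 - 1) / (1 * c)"
    using c(1) by (intro tendsto_intros lim) auto
  then have up: "(\<lambda>N. (1 - z N) / (z N * c)) \<longlonglongrightarrow> 0" by simp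
  have "(\<lambda>N. (w N)\<^sup>2) \<longlonglongrightarrow> 0"
    by (rule tendsto_sandwich[OF _ _ tendsto_const up]; intro always_eventually allI le zero_le_power2)
  then have "(\<lambda>N. sqrt ((w N)\<^sup>2)) \<longlonglongrightarrow> sqrt 0" by (rule tendsto_real_sqrt)
  then have w0: "w \<longlonglongrightarrow> 0" using w by simp
  have "(\<lambda>N. ?h (w N)) \<longlonglongrightarrow> measure_pmf.expectation \<xi> (\<lambda>k. real k * (real k - 1) / 2)"
  proof (rule integral_dominated_convergence)
    show "integrable (measure_pmf \<xi>) (\<lambda>k. real k * (real k - 1))" by (rule integrable_falling)
    show "AE k in measure_pmf \<xi>. (\<lambda>N. taylor2 (w N) k) \<longlonglongrightarrow> real k * (real k - 1) / 2"
      using taylor2_tendsto[OF w0] by simp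
    show "AE k in measure_pmf \<xi>. norm (taylor2 (w N) k) \<le> real k * (real k - 1)" for N
    proof (rule AE_I2)
      fix k show "norm (taylor2 (w N) k) \<le> real k * (real k - 1)"
        using taylor2_nonneg[OF w[of N], of k] taylor2_le[OF w[of N], of k] by simp
    qed
  qed auto
  then have h: "(\<lambda>N. ?h (w N)) \<longlonglongrightarrow> var / 2" by (simp add: var_def)
  have "(\<lambda>N. sqrt ((1 - w N) / (z N * ?h (w N)))) \<longlonglongrightarrow> sqrt ((1 - 0) / (1 * (var / 2)))"
    using var_pos by (intro tendsto_intros h w0 lim) auto
  moreover have "sqrt ((1 - w N) / (z N * ?h (w N))) = w N / sqrt (1 - z N)" for N
  proof -
    have "(1 - w N) / (z N * ?h (w N)) = (w N)\<^sup>2 / (1 - z N)" using w2[of N] z(2)[of N] by simp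
    then show ?thesis using w(1)[of N] by (simp add: real_sqrt_divide)
  qed
  ultimately show ?thesis by (simp add: w_def)
qed

section \<open>From the singularity to the tail of the size\<close>

lemma tail_nonneg: "0 \<le> tail n"
  unfolding tail_def sum_total_weight using sum_weight_le_1[OF finite_trees_size_le] by simp

lemma decseq_tail: "decseq tail"
  by (rule decseq_SucI) (simp add: tail_def total_weight_nonneg)

lemma tail_le_1: "tail n \<le> 1"
  unfolding tail_def by (simp add: sum_nonneg total_weight_nonneg)

text \<open>Summation by parts: multiplication by \<open>1 - z\<close> turns the tails into their
  differences \<open>- q (Suc n)\<close>.\<close>

lemma tail_gf:
  assumes "0 \<le> z" "z < 1"
  shows "(\<Sum>n. tail n * z ^ n) = (1 - tree_gf \<xi> z) / (1 - z)"
proof -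
  have s: "summable (\<lambda>n. tail n * z ^ n)"
    by (rule summable_bounded_power[where B = 1]) (use assms tail_nonneg tail_le_1 in auto)
  have sq: "summable (\<lambda>n. q n * z ^ n)" using assms by (intro tree_gf_summable) auto
  have sq1: "summable (\<lambda>n. q (Suc n) * z ^ Suc n)" using sq by (subst summable_Suc_iff)
  have s1: "summable (\<lambda>n. tail (Suc n) * z ^ Suc n)" using s by (subst summable_Suc_iff)
  have "(\<Sum>n. tail n * z ^ n) - z * (\<Sum>n. tail n * z ^ n)
      = tail 0 + (\<Sum>n. tail (Suc n) * z ^ Suc n) - (\<Sum>n. z * (tail n * z ^ n))"
    using suminf_split_head[OF s] by (simp add: suminf_mult[OF s])
  also have "\<dots> = tail 0 + (\<Sum>n. tail (Suc n) * z ^ Suc n - z * (tail n * z ^ n))"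
    using suminf_diff[OF s1 summable_mult[OF s, of z]] by simp
  also have "(\<lambda>n. tail (Suc n) * z ^ Suc n - z * (tail n * z ^ n)) = (\<lambda>n. - (q (Suc n) * z ^ Suc n))"
    by (auto simp: tail_def algebra_simps)
  also have "tail 0 + (\<Sum>n. - (q (Suc n) * z ^ Suc n)) = 1 - tree_gf \<xi> z"
    using suminf_split_head[OF sq] suminf_minus[OF sq1] unfolding tree_gf_def by (simp add: tail_def)
  finally show ?thesis using assms by (simp add: field_simps)
qed

text \<open>Comparison sequence: the coefficients of \<open>sqrt (2 / var) * (1 - z) powr (- 1 / 2)\<close>.\<close>

definition cmp :: "nat \<Rightarrow> real" where
  "cmp n = sqrt (2 / var) * ((- 1) ^ n * ((- 1 / 2) gchoose n))"

text \<open>The ratio of consecutive terms lies between 0 and 1, so the comparison sequence is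
  nonnegative and decreasing, as the Tauberian theorem demands.\<close>

lemma cmp_Suc: "cmp (Suc n) = cmp n * ((2 * real n + 1) / (2 * real n + 2))"
proof -
  have 1: "((- 1 / 2 :: real) gchoose Suc n) = ((- 1 / 2) gchoose n) * ((- 1 / 2 - real n) / real (Suc n))"
    using gbinomial_mult_1[of "- 1 / 2 :: real" n] by (simp add: field_simps)
  have 2: "(- 1 / 2 - real n) / real (Suc n) = - ((2 * real n + 1) / (2 * real n + 2))"
    by (simp add: field_simps)
  show ?thesis unfolding cmp_def 1 2 by simp
qed

lemma cmp_nonneg: "0 \<le> cmp n"
proof (induction n)
  case 0
  then show ?case using var_pos by (simp add: cmp_def)
next
  case (Suc n)
  then show ?case by (simp add: cmp_Suc)
qed

lemma decseq_cmp: "decseq cmp"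
  by (rule decseq_SucI, unfold cmp_Suc, rule mult_left_le) (simp_all add: cmp_nonneg)

lemma cmp_gf:
  assumes "0 \<le> z" "z < 1"
  shows "(\<Sum>n. cmp n * z ^ n) = sqrt (2 / var) / sqrt (1 - z)"
proof -
  have "(\<lambda>n. ((- 1 / 2) gchoose n) * (- z) ^ n) sums (1 + - z) powr (- 1 / 2)"
    by (rule gen_binomial_real) (use assms in auto)
  then have "(\<lambda>n. sqrt (2 / var) * (((- 1 / 2) gchoose n) * (- z) ^ n)) sums (sqrt (2 / var) * (1 - z) powr (- 1 / 2))"
    by (intro sums_mult) simp
  moreover have "sqrt (2 / var) * (((- 1 / 2) gchoose n) * (- z) ^ n) = cmp n * z ^ n" for n
    unfolding cmp_def power_minus[of z] by simp
  moreover have "(1 - z) powr (- 1 / 2) = 1 / sqrt (1 - z)"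
    using assms powr_minus_divide[of "1 - z" "1 / 2"] by (simp add: powr_half_sqrt)
  ultimately have "(\<lambda>n. cmp n * z ^ n) sums (sqrt (2 / var) / sqrt (1 - z))" by simp
  then show ?thesis by (rule sums_unique[symmetric])
qed

text \<open>The factor \<open>1 / sqrt pi\<close> is \<open>1 / Gamma (1 / 2)\<close>, from the
  asymptotics of the binomial coefficients in \<open>cmp\<close>. In the final theorem this constant
  is \<open>\<kappa>\<close>.\<close>

definition tail_const :: real where "tail_const = sqrt (2 / (pi * var))"

lemma tail_const_pos: "0 < tail_const"
  using var_pos by (simp add: tail_const_def)

lemma cmp_asymp: "(\<lambda>n. cmp n * sqrt (real n)) \<longlonglongrightarrow> tail_const"
proof -
  have "(\<lambda>n. ((- 1 / 2 :: real) gchoose n) / ((- 1) ^ n / exp ((- 1 / 2 + 1) * of_real (ln (real n)))))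
      \<longlonglongrightarrow> inverse (Gamma (- (- 1 / 2)))" by (rule gbinomial_asymptotic)
  then have "(\<lambda>n. sqrt (2 / var) * (((- 1 / 2 :: real) gchoose n) / ((- 1) ^ n / exp (1 / 2 * ln (real n)))))
      \<longlonglongrightarrow> sqrt (2 / var) * inverse (sqrt pi)"
    by (intro tendsto_mult tendsto_const) (simp add: Gamma_one_half_real)
  moreover have "\<forall>\<^sub>F n in sequentially. sqrt (2 / var) * (((- 1 / 2 :: real) gchoose n) / ((- 1) ^ n / exp (1 / 2 * ln (real n))))
      = cmp n * sqrt (real n)"
    using eventually_gt_at_top[of 0]
  proof eventually_elim
    case (elim n)
    have "exp (1 / 2 * ln (real n)) = sqrt (real n)"
      using elim by (simp add: powr_half_sqrt[symmetric] powr_def)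
    moreover have "1 / (- 1 :: real) ^ n = (- 1) ^ n" by (cases "even n") auto
    ultimately show ?case unfolding cmp_def by (simp add: field_simps)
  qed
  ultimately have "(\<lambda>n. cmp n * sqrt (real n)) \<longlonglongrightarrow> sqrt (2 / var) * inverse (sqrt pi)"
    by (rule Lim_transform_eventually)
  then show ?thesis by (simp add: tail_const_def real_sqrt_divide real_sqrt_mult field_simps)
qed

text \<open>By \<open>tail_gf\<close> and \<open>gf_singularity\<close> the power series of
  \<open>tail\<close> behaves at 1 like \<open>sqrt (2 / var) / sqrt (1 - z)\<close>, which is
  exactly the series of \<open>cmp\<close>. At \<open>z = exp (- (k + 1) / N)\<close> the two differ
  by \<open>o (sqrt N)\<close>, so the Tauberian comparison applies.\<close>

theorem tail_asymp: "(\<lambda>n. tail n * sqrt (real n)) \<longlonglongrightarrow> tail_const"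
proof -
  define z where "z k N = exp (- real (Suc k) / real N)" for k N
  define D where "D k N = sqrt (1 - z k N) * sqrt (real N)" for k N
  have z: "0 < z k N" "0 < N \<Longrightarrow> z k N < 1" for k N
    by (auto simp: z_def divide_neg_pos)
  have zlim: "z k \<longlonglongrightarrow> 1" for k unfolding z_def by real_asymp
  have Dlim: "D k \<longlonglongrightarrow> sqrt (real (Suc k))" for k
  proof -
    have "(\<lambda>N. (1 - z k N) * real N) \<longlonglongrightarrow> real (Suc k)" unfolding z_def by real_asymp
    then show ?thesis unfolding D_def real_sqrt_mult[symmetric] by (rule tendsto_real_sqrt)
  qed
  have sing: "(\<lambda>N. (1 - tree_gf \<xi> (z k N)) / sqrt (1 - z k N)) \<longlonglongrightarrow> sqrt (2 / var)" for k
  proof -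
    \<comment> \<open>The index is shifted because \<open>z k 0 = 1\<close> by
      \<open>x / 0 = 0\<close>, whereas \<open>gf_singularity\<close> wants values below 1.\<close>
    have "(\<lambda>N. (1 - tree_gf \<xi> (z k (Suc N))) / sqrt (1 - z k (Suc N))) \<longlonglongrightarrow> sqrt (2 / var)"
      by (rule gf_singularity) (use z LIMSEQ_Suc[OF zlim] in auto)
    then show ?thesis by (rule LIMSEQ_imp_Suc)
  qed
  have summ: "summable (\<lambda>n. tail n * z k N ^ n)" "summable (\<lambda>n. cmp n * z k N ^ n)" if "0 < N" for k N
  proof -
    show "summable (\<lambda>n. tail n * z k N ^ n)"
      by (rule summable_bounded_power[where B = 1]) (use z that tail_nonneg tail_le_1 in \<open>auto simp: less_imp_le\<close>)
    show "summable (\<lambda>n. cmp n * z k N ^ n)"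
      by (rule summable_bounded_power[where B = "cmp 0"])
         (use z that cmp_nonneg decseqD[OF decseq_cmp, of 0] in \<open>auto simp: less_imp_le\<close>)
  qed
  have gf: "(\<Sum>n. tail n * z k N ^ n) / sqrt (real N) = (1 - tree_gf \<xi> (z k N)) / sqrt (1 - z k N) / D k N"
           "(\<Sum>n. cmp n * z k N ^ n) / sqrt (real N) = sqrt (2 / var) / D k N" if N: "0 < N" for k N
  proof -
    have "1 - z k N = sqrt (1 - z k N) * sqrt (1 - z k N)" using z(2)[OF N, of k] by simp
    then show "(\<Sum>n. tail n * z k N ^ n) / sqrt (real N) = (1 - tree_gf \<xi> (z k N)) / sqrt (1 - z k N) / D k N"
      using z(2)[OF N, of k] z(1)[of k N] unfolding D_def
      by (subst tail_gf) (auto simp: divide_simps)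
    show "(\<Sum>n. cmp n * z k N ^ n) / sqrt (real N) = sqrt (2 / var) / D k N"
      using z(2)[OF N, of k] z(1)[of k N] unfolding D_def by (subst cmp_gf) auto
  qed
  have diff: "(\<lambda>N. (\<Sum>n. (tail n - cmp n) * z k N ^ n) / sqrt (real N)) \<longlonglongrightarrow> 0" for k
  proof -
    have "(\<lambda>N. ((1 - tree_gf \<xi> (z k N)) / sqrt (1 - z k N) - sqrt (2 / var)) / D k N)
        \<longlonglongrightarrow> (sqrt (2 / var) - sqrt (2 / var)) / sqrt (real (Suc k))"
      by (intro tendsto_divide tendsto_diff tendsto_const sing Dlim) auto
    moreover have "\<forall>\<^sub>F N in sequentially. ((1 - tree_gf \<xi> (z k N)) / sqrt (1 - z k N) - sqrt (2 / var)) / D k N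
        = (\<Sum>n. (tail n - cmp n) * z k N ^ n) / sqrt (real N)"
      using eventually_gt_at_top[of 0]
    proof eventually_elim
      case (elim N)
      have "(\<Sum>n. (tail n - cmp n) * z k N ^ n) = (\<Sum>n. tail n * z k N ^ n) - (\<Sum>n. cmp n * z k N ^ n)"
        unfolding left_diff_distrib by (rule suminf_diff[symmetric]) (rule summ[OF elim])+
      then show ?case by (simp only: diff_divide_distrib[of "_ / _" "sqrt _"] gf[OF elim, symmetric] diff_divide_distrib[of "suminf _"])
    qed
    ultimately have "(\<lambda>N. (\<Sum>n. (tail n - cmp n) * z k N ^ n) / sqrt (real N))
        \<longlonglongrightarrow> (sqrt (2 / var) - sqrt (2 / var)) / sqrt (real (Suc k))"
      by (rule Lim_transform_eventually)
    then show ?thesis by simp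
  qed
  have "\<exists>C. \<forall>N>0. (\<Sum>n. (tail n + cmp n) * z 0 N ^ n) \<le> C * sqrt (real N)"
  proof -
    have "(\<lambda>N. ((1 - tree_gf \<xi> (z 0 N)) / sqrt (1 - z 0 N) + sqrt (2 / var)) / D 0 N)
        \<longlonglongrightarrow> (sqrt (2 / var) + sqrt (2 / var)) / sqrt (real (Suc 0))"
      by (intro tendsto_divide tendsto_add tendsto_const sing Dlim) auto
    then have "Bseq (\<lambda>N. ((1 - tree_gf \<xi> (z 0 N)) / sqrt (1 - z 0 N) + sqrt (2 / var)) / D 0 N)"
      by (intro convergent_imp_Bseq convergentI)
    then obtain C where C: "\<And>N. \<bar>((1 - tree_gf \<xi> (z 0 N)) / sqrt (1 - z 0 N) + sqrt (2 / var)) / D 0 N\<bar> \<le> C"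
      by (auto simp: Bseq_def)
    have "(\<Sum>n. (tail n + cmp n) * z 0 N ^ n) \<le> C * sqrt (real N)" if N: "N > 0" for N
    proof -
      have "(\<Sum>n. (tail n + cmp n) * z 0 N ^ n) / sqrt (real N)
        = ((1 - tree_gf \<xi> (z 0 N)) / sqrt (1 - z 0 N) + sqrt (2 / var)) / D 0 N"
      proof -
        have "(\<Sum>n. (tail n + cmp n) * z 0 N ^ n) = (\<Sum>n. tail n * z 0 N ^ n) + (\<Sum>n. cmp n * z 0 N ^ n)"
          unfolding distrib_right by (rule suminf_add[symmetric]) (rule summ[OF N])+
        then show ?thesis by (simp only: add_divide_distrib gf[OF N])
      qed
      then have "(\<Sum>n. (tail n + cmp n) * z 0 N ^ n) / sqrt (real N) \<le> C" using C[of N] by linarith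
      then show ?thesis using N by (simp add: pos_divide_le_eq)
    qed
    then show ?thesis by blast
  qed
  then obtain C where C: "\<And>N. N > 0 \<Longrightarrow> (\<Sum>n. (tail n + cmp n) * z 0 N ^ n) \<le> C * sqrt (real N)" by blast
  show ?thesis
  proof (rule tauberian_sqrt[OF decseq_tail tail_nonneg decseq_cmp cmp_nonneg _ _ cmp_asymp])
    show "(\<Sum>n. (tail n + cmp n) * exp (- 1 / real N) ^ n) \<le> C * sqrt (real N)" if "0 < N" for N
      using C[OF that] by (simp add: z_def)
    show "(\<lambda>N. (\<Sum>n. (tail n - cmp n) * exp (- real (Suc k) / real N) ^ n) / sqrt (real N)) \<longlonglongrightarrow> 0" for k
      using diff[of k] by (simp add: z_def)
  qed
qed

end

section \<open>A lower bound for the size distribution\<close>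

text \<open>Substitution for the leaf at the end of the leftmost path. Up to this leaf, sizes add
  and weights multiply; and the path shows where to cut if the size of the grafted tree is
  known.\<close>

fun graft :: "plane_tree \<Rightarrow> plane_tree \<Rightarrow> plane_tree" where
  "graft (Node []) t = t"
| "graft (Node (x # xs)) t = Node (graft x t # xs)"

lemma num_vertices_graft: "Suc (num_vertices (graft s t)) = num_vertices s + num_vertices t"
  by (induction s t rule: graft.induct) auto

lemma weight_graft: "weight f (graft s t) * f 0 = weight f s * weight f t"
proof (induction s t rule: graft.induct)
  case (2 x xs t)
  have "weight f (graft (Node (x # xs)) t) * f 0
      = f (Suc (length xs)) * (weight f (graft x t) * f 0) * prod_list (map (weight f) xs)"
    by (simp add: mult_ac)
  then show ?case unfolding 2 by (simp add: mult_ac)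
qed simp

text \<open>Sizes decrease strictly along the leftmost path, so at most one of its vertices carries
  a subtree of the given size, and \<open>t\<close> is cut off there.\<close>

lemma graft_inject:
  "graft s t = graft s' t' \<Longrightarrow> num_vertices t = num_vertices t' \<Longrightarrow> s = s' \<and> t = t'"
proof (induction s t arbitrary: s' rule: graft.induct)
  case (1 t)
  have "num_vertices s' = 1" using num_vertices_graft[of s' t'] 1 by simp
  then have "s' = Node []" using num_vertices_pos by (cases s') (auto simp: sum_list_eq_0_iff, metis list.set_intros(1) neq_Nil_conv less_numeral_extra(3))
  then show ?case using 1 by simp
next
  case (2 x xs t)
  show ?case
  proof (cases "(s', t')" rule: graft.cases)
    case (1 u)
    then have "graft (Node (x # xs)) t = t'" using 2 by simp
    then have "Suc (num_vertices t') = num_vertices (Node (x # xs)) + num_vertices t"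
      using num_vertices_graft by metis
    then show ?thesis using 2(3) num_vertices_pos[of x] by simp
  next
    case (2 y ys u)
    then show ?thesis using "2.IH" "2.prems" by auto
  qed
qed

text \<open>Different pairs of trees of the given sizes yield different grafted trees, so the
  expanded product on the left is part of the sum on the right. For
  \<open>r m = total_weight f (Suc m) / f 0\<close> this says
  \<open>r a * r b \<le> r (a + b)\<close>.\<close>

lemma total_weight_graft:
  assumes f: "\<And>m. 0 \<le> f m"
  shows "total_weight f (Suc a) * total_weight f (Suc b) \<le> total_weight f (Suc (a + b)) * f 0"
proof -
  let ?X = "\<lambda>k. {t. num_vertices t = k}"
  have inj: "inj_on (\<lambda>(s, t). graft s t) (?X (Suc a) \<times> ?X (Suc b))"
  proof (rule inj_onI, clarify)
    fix s t s' t' assume "num_vertices t = Suc b" "num_vertices t' = Suc b" "graft s t = graft s' t'"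
    then show "s = s' \<and> t = t'" using graft_inject[of s t s' t'] by simp
  qed
  have "total_weight f (Suc a) * total_weight f (Suc b)
      = (\<Sum>(s, t)\<in>?X (Suc a) \<times> ?X (Suc b). weight f s * weight f t)"
    unfolding total_weight_def by (simp add: sum_product sum.cartesian_product)
  also have "\<dots> = (\<Sum>st\<in>?X (Suc a) \<times> ?X (Suc b). weight f ((\<lambda>(s, t). graft s t) st) * f 0)"
    by (intro sum.cong) (auto simp: weight_graft)
  also have "\<dots> = (\<Sum>u\<in>(\<lambda>(s, t). graft s t) ` (?X (Suc a) \<times> ?X (Suc b)). weight f u * f 0)"
    using inj by (simp add: sum.reindex)
  also have "\<dots> \<le> (\<Sum>u\<in>?X (Suc (a + b)). weight f u * f 0)"
  proof (rule sum_mono2[OF finite_plane_trees_of_size])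
    show "(\<lambda>(s, t). graft s t) ` (?X (Suc a) \<times> ?X (Suc b)) \<subseteq> ?X (Suc (a + b))"
    proof safe
      fix s t assume "num_vertices s = Suc a" "num_vertices t = Suc b"
      then show "num_vertices (graft s t) = Suc (a + b)" using num_vertices_graft[of s t] by simp
    qed
  qed (simp add: f weight_nonneg)
  finally show ?thesis unfolding total_weight_def by (simp add: sum_distrib_right)
qed

lemma supermultiplicative_power:
  fixes r :: "nat \<Rightarrow> real"
  assumes "r 0 = 1" "\<And>n. 0 \<le> r n" "\<And>a b. r a * r b \<le> r (a + b)"
  shows "r m ^ j \<le> r (j * m)"
proof (induction j)
  case (Suc j)
  have "r m ^ Suc j \<le> r m * r (j * m)" using Suc assms(2) by (simp add: mult_left_mono)
  also have "\<dots> \<le> r (Suc j * m)" using assms(3)[of m "j * m"] by simp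
  finally show ?case .
qed (simp add: assms)

text \<open>Copes with periodicity, where \<open>r\<close> vanishes on whole residue classes. Each
  class modulo \<open>m\<close> on which \<open>r\<close> is somewhere positive gets one
  representative \<open>s i\<close>; a larger \<open>x\<close> of this class is
  \<open>s i + j * m\<close>, so \<open>r x \<ge> r (s i) * r m ^ j\<close>. As there are finitely
  many classes, \<open>c\<close> and \<open>S\<close> are uniform.\<close>

lemma supermultiplicative_residues:
  fixes r :: "nat \<Rightarrow> real"
  assumes r: "r 0 = 1" "\<And>n. 0 \<le> r n" "\<And>a b. r a * r b \<le> r (a + b)"
    and m: "0 < m" "0 < r m"
  obtains c \<rho> S where "0 < c" "0 < \<rho>" "\<rho> \<le> 1"
    "\<And>n x. 0 < r n \<Longrightarrow> x mod m = n mod m \<Longrightarrow> S \<le> x \<Longrightarrow> c * \<rho> ^ x \<le> r x"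
proof -
  define I where "I = {i. i < m \<and> (\<exists>n. 0 < r n \<and> n mod m = i)}"
  define s where "s i = (SOME n. 0 < r n \<and> n mod m = i)" for i
  have fin: "finite I" by (simp add: I_def)
  have s: "0 < r (s i) \<and> s i mod m = i" if "i \<in> I" for i
    using that unfolding s_def I_def by (intro someI_ex[of "\<lambda>n. 0 < r n \<and> n mod m = i"]) auto
  define c where "c = Min (insert 1 (r ` s ` I))"
  define S where "S = Max (insert 0 (s ` I))"
  define \<rho> where "\<rho> = min 1 (r m)"
  have c: "0 < c" unfolding c_def using fin s by (subst Min_gr_iff) auto
  have \<rho>: "0 < \<rho>" "\<rho> \<le> 1" using m by (auto simp: \<rho>_def)
  show thesis
  proof (rule that[OF c \<rho>])
    fix n x assume n: "0 < r n" "x mod m = n mod m" "S \<le> x"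
    define i where "i = n mod m"
    have i: "i \<in> I" using n m by (auto simp: I_def i_def)
    have ci: "c \<le> r (s i)" unfolding c_def using fin i by (intro Min_le) auto
    have "s i \<le> S" unfolding S_def using fin i by (intro Max_ge) auto
    then have sx: "s i \<le> x" using n by simp
    have "s i mod m = x mod m" using s[OF i] n by (simp add: i_def)
    then have "m dvd x - s i" using sx by (metis mod_eq_dvd_iff_nat)
    then obtain j where j: "x = s i + j * m" using sx by (metis dvd_def le_add_diff_inverse mult.commute)
    have "j \<le> j * m" using m by simp
    then have "j \<le> x" using j by linarith
    then have "\<rho> ^ x \<le> \<rho> ^ j" using \<rho> by (intro power_decreasing) auto
    also have "\<dots> \<le> r m ^ j" using \<rho> by (intro power_mono) (auto simp: \<rho>_def)
    also have "\<dots> \<le> r (j * m)" by (rule supermultiplicative_power[OF r])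
    finally have "c * \<rho> ^ x \<le> r (s i) * r (j * m)" using ci c \<rho> r(2) by (intro mult_mono) auto
    also have "\<dots> \<le> r x" using r(3)[of "s i" "j * m"] j by simp
    finally show "c * \<rho> ^ x \<le> r x" .
  qed
qed

text \<open>At most about \<open>sqrt n\<close> blocks of length of order \<open>sqrt n\<close> cost
  a factor polynomial in \<open>n\<close> each, in total \<open>exp (- O (sqrt n * ln n))\<close>.
  The rest has length \<open>O (sqrt n)\<close> and is paid for by the exponential bound on its
  residue class. The second logarithm in the claim absorbs the constants.\<close>

lemma supermultiplicative_lower_bound:
  fixes r :: "nat \<Rightarrow> real"
  assumes r: "r 0 = 1" "\<And>n. 0 \<le> r n" "\<And>a b. r a * r b \<le> r (a + b)"
    and blocks: "\<forall>\<^sub>F B in sequentially. \<exists>b. B \<le> b \<and> b \<le> 16 * B \<and> 1 / (real B)\<^sup>2 \<le> r b"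
  shows "\<forall>\<^sub>F n in sequentially. 0 < r n \<longrightarrow> exp (- (sqrt (real n) * (ln (real n))\<^sup>2)) \<le> r n"
proof -
  obtain B0 where B0: "\<And>B. B \<ge> B0 \<Longrightarrow> \<exists>b. B \<le> b \<and> b \<le> 16 * B \<and> 1 / (real B)\<^sup>2 \<le> r b"
    using blocks by (auto simp: eventually_sequentially)
  obtain m where m: "0 < m" "0 < r m"
  proof -
    obtain b where "max B0 1 \<le> b" "1 / (real (max B0 1))\<^sup>2 \<le> r b" using B0[of "max B0 1"] by auto
    moreover have "0 < 1 / (real (max B0 1))\<^sup>2" by simp
    ultimately have "0 < b" "0 < r b" by linarith+
    then show thesis by (rule that)
  qed
  obtain c \<rho> S where c: "0 < c" "0 < \<rho>" "\<rho> \<le> 1"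
    and res: "\<And>n x. 0 < r n \<Longrightarrow> x mod m = n mod m \<Longrightarrow> S \<le> x \<Longrightarrow> c * \<rho> ^ x \<le> r x"
    using supermultiplicative_residues[OF r m] by blast
  \<comment> \<open>\<open>A + D * sqrt n\<close> will bound \<open>- ln (c * \<rho> ^ x)\<close>
    for the rest \<open>x \<le> S + m * b\<close>, because
    \<open>b \<le> 16 * B \<le> 32 * sqrt n\<close>.\<close>
  define A where "A = real S * \<bar>ln \<rho>\<bar> + \<bar>ln c\<bar>"
  define D where "D = 32 * real m * \<bar>ln \<rho>\<bar>"
  have ev: "\<forall>\<^sub>F n::nat in sequentially. 2 * sqrt (real n) * ln (2 * sqrt (real n)) + A + D * sqrt (real n) \<le> sqrt (real n) * (ln (real n))\<^sup>2"
    by real_asymp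
  have "\<forall>\<^sub>F n in sequentially. real (max S (max (B0\<^sup>2) 1)) \<le> real n"
    by (rule eventually_mono[OF eventually_ge_at_top[of "max S (max (B0\<^sup>2) 1)"]]) (simp only: of_nat_le_iff)
  with ev show ?thesis
  proof eventually_elim
    case (elim n)
    show ?case
    proof
      assume n: "0 < r n"
      define B where "B = nat \<lceil>sqrt (real n)\<rceil>"
      have n1: "1 \<le> sqrt (real n)" "S \<le> n" using elim by auto
      have B: "sqrt (real n) \<le> real B" "real B \<le> 2 * sqrt (real n)"
        using n1 unfolding B_def by linarith+
      have "real B0 \<le> sqrt (real n)" using elim by (intro real_le_rsqrt) (simp flip: of_nat_power)
      then have "B0 \<le> B" using B by linarith
      then obtain b where b: "B \<le> b" "b \<le> 16 * B" "1 / (real B)\<^sup>2 \<le> r b" using B0 by blast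
      have B1: "1 \<le> real B" using B n1 by linarith
      \<comment> \<open>Blocks of length \<open>b'\<close> are split off; as \<open>m\<close> divides \<open>b'\<close>, the rest \<open>x\<close> stays in the residue class of \<open>n\<close>.\<close>
      define b' where "b' = m * b"
      have bpos: "0 < b" using b B1 by linarith
      define j where "j = (n - S) div b'"
      define x where "x = n - j * b'"
      have jb: "j * b' \<le> n - S" unfolding j_def by simp
      have nx: "n = j * b' + x" using jb by (simp add: x_def)
      have xS: "S \<le> x" using jb n1 by (simp add: x_def)
      have "0 < b'" using bpos m by (simp add: b'_def)
      then have "n - S < j * b' + b'" unfolding j_def
        using div_mult_mod_eq[of "n - S" b'] mod_less_divisor[of b' "n - S"] by linarith
      then have xle: "x \<le> S + b'" using n1 by (simp add: x_def)
      have "n = x + m * (j * b)" using nx by (simp add: b'_def mult_ac)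
      then have "n mod m = x mod m" by (metis mod_mult_self2)
      then have rx: "c * \<rho> ^ x \<le> r x" using res[OF n _ xS] by simp
      have rb': "(1 / (real B)\<^sup>2) ^ (m * j) \<le> r (j * b')"
      proof -
        have "(1 / (real B)\<^sup>2) ^ (m * j) \<le> r b ^ (m * j)" using b by (intro power_mono) auto
        also have "\<dots> \<le> r ((m * j) * b)" by (rule supermultiplicative_power[OF r])
        finally show ?thesis by (simp add: b'_def mult_ac)
      qed
      have jm: "real (m * j) * sqrt (real n) \<le> real n"
      proof -
        have "real (m * j) * sqrt (real n) \<le> real (m * j) * real b" using B b by (intro mult_left_mono) linarith+
        also have "\<dots> = real (j * b')" by (simp add: b'_def)
        also have "\<dots> \<le> real n" using nx by simp
        finally show ?thesis .
      qed
      have jm': "real (m * j) \<le> sqrt (real n)"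
      proof -
        have "real (m * j) * sqrt (real n) \<le> sqrt (real n) * sqrt (real n)" using jm by simp
        then show ?thesis by (rule mult_right_le_imp_le) (use n1 in linarith)
      qed
      have e1: "exp (- (2 * sqrt (real n) * ln (2 * sqrt (real n)))) \<le> (1 / (real B)\<^sup>2) ^ (m * j)"
      proof -
        have "(1 / (real B)\<^sup>2) ^ (m * j) = exp (- (2 * real (m * j) * ln (real B)))"
        proof -
          have "1 / (real B)\<^sup>2 = exp (- (2 * ln (real B)))"
            using B1 by (simp add: exp_minus exp_double divide_inverse power_inverse)
          then show ?thesis by (simp add: exp_of_nat_mult[symmetric] algebra_simps)
        qed
        moreover have "2 * real (m * j) * ln (real B) \<le> 2 * sqrt (real n) * ln (2 * sqrt (real n))"
        proof -
          have "ln (real B) \<le> ln (2 * sqrt (real n))" using B B1 by (intro ln_mono) linarith+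
          moreover have "0 \<le> ln (real B)" using B1 by (rule ln_ge_zero)
          ultimately show ?thesis using jm' n1 by (intro mult_mono) auto
        qed
        ultimately show ?thesis by simp
      qed
      have e2: "exp (- (A + D * sqrt (real n))) \<le> c * \<rho> ^ x"
      proof -
        have "c * \<rho> ^ x = exp (ln c + real x * ln \<rho>)" using c by (simp add: exp_add exp_of_nat_mult)
        moreover have "ln c + real x * ln \<rho> \<ge> - (A + D * sqrt (real n))"
        proof -
          have "x \<le> S + m * (16 * B)" using xle mult_le_mono2[OF b(2), of m] unfolding b'_def by linarith
          then have "real x \<le> real (S + m * (16 * B))" by (simp only: of_nat_le_iff)
          also have "\<dots> = real S + real m * (16 * real B)" by simp
          also have "\<dots> \<le> real S + real m * (32 * sqrt (real n))" using B by (intro add_left_mono mult_left_mono) auto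
          finally have "real x * \<bar>ln \<rho>\<bar> \<le> (real S + real m * (32 * sqrt (real n))) * \<bar>ln \<rho>\<bar>"
            by (intro mult_right_mono) auto
          also have "\<dots> = real S * \<bar>ln \<rho>\<bar> + D * sqrt (real n)" by (simp add: D_def algebra_simps)
          finally have "real x * \<bar>ln \<rho>\<bar> \<le> real S * \<bar>ln \<rho>\<bar> + D * sqrt (real n)" .
          moreover have "real x * ln \<rho> \<ge> - (real x * \<bar>ln \<rho>\<bar>)"
            using c by (simp add: abs_if)
          moreover have "ln c \<ge> - \<bar>ln c\<bar>" by simp
          ultimately show ?thesis unfolding A_def by linarith
        qed
        ultimately show ?thesis by simp
      qed
      have "exp (- (sqrt (real n) * (ln (real n))\<^sup>2))
          \<le> exp (- (2 * sqrt (real n) * ln (2 * sqrt (real n))) + (- (A + D * sqrt (real n))))"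
        using elim(1) by simp
      also have "\<dots> = exp (- (2 * sqrt (real n) * ln (2 * sqrt (real n)))) * exp (- (A + D * sqrt (real n)))"
        by (rule exp_add)
      also have "\<dots> \<le> r (j * b') * r x"
        using order_trans[OF e1 rb'] order_trans[OF e2 rx] r(2) by (intro mult_mono) auto
      also have "\<dots> \<le> r n" using r(3)[of "j * b'" x] nx by simp
      finally show "exp (- (sqrt (real n) * (ln (real n))\<^sup>2)) \<le> r n" .
    qed
  qed
qed

context critical_offspring
begin

lemma size_window_mass:
  assumes "m \<le> n"
  shows "tail m - tail n = (\<Sum>k\<in>{m<..n}. q k)"
proof -
  have "(\<Sum>k\<le>n. q k) = (\<Sum>k\<in>{..m} \<union> {m<..n}. q k)" using assms by (intro sum.cong) auto
  also have "\<dots> = (\<Sum>k\<le>m. q k) + (\<Sum>k\<in>{m<..n}. q k)" by (rule sum.union_disjoint) auto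
  finally show ?thesis by (simp add: tail_def)
qed

text \<open>As \<open>tail n\<close> is about \<open>L / sqrt n\<close> and
  \<open>sqrt 16 = 4\<close>, the sizes above \<open>B\<close> and up to \<open>16 * B\<close> have
  total mass about \<open>(3 / 4) * L / sqrt B\<close>. If each of them had mass at most
  \<open>1 / B\<^sup>2\<close>, the total would be at most \<open>15 / B\<close>.\<close>

lemma total_weight_blocks:
  "\<forall>\<^sub>F B in sequentially. \<exists>b. B \<le> b \<and> b \<le> 16 * B \<and> 1 / (real B)\<^sup>2 \<le> q (Suc b)"
proof -
  define L where "L = tail_const"
  have L: "0 < L" using tail_const_pos by (simp add: L_def)
  have l1: "(\<lambda>n. tail n * sqrt (real n)) \<longlonglongrightarrow> L" unfolding L_def by (rule tail_asymp)
  have "(\<lambda>B. tail (16 * B) * sqrt (real B)) \<longlonglongrightarrow> L / sqrt 16"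
    by (rule tendsto_scaled_index[OF l1 _ filterlim_real_sequentially]) (auto intro!: tendsto_eventually eventually_mono[OF eventually_gt_at_top[of 0]])
  then have l16: "(\<lambda>B. tail (16 * B) * sqrt (real B)) \<longlonglongrightarrow> L / 4" by simp
  have "(\<lambda>B. tail B * sqrt (real B) - tail (16 * B) * sqrt (real B)) \<longlonglongrightarrow> L - L / 4"
    by (intro tendsto_diff l1 l16)
  then have ev1: "\<forall>\<^sub>F B in sequentially. L / 2 < tail B * sqrt (real B) - tail (16 * B) * sqrt (real B)"
    by (rule order_tendstoD) (use L in simp)
  have ev2: "\<forall>\<^sub>F B::nat in sequentially. 15 * real B / (real B)\<^sup>2 < L / 2 / sqrt (real B)"
    using L by real_asymp
  show ?thesis using ev1 ev2 eventually_gt_at_top[of 0]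
  proof eventually_elim
    case (elim B)
    show ?case
    proof (rule ccontr)
      assume not: "\<not> ?thesis"
      have "q k \<le> 1 / (real B)\<^sup>2" if k: "k \<in> {B<..16 * B}" for k
      proof -
        obtain b where "k = Suc b" using k by (cases k) auto
        then show ?thesis using not k by (auto simp: not_le) (metis less_Suc_eq_le less_imp_le not_le Suc_leD)
      qed
      then have "(\<Sum>k\<in>{B<..16 * B}. q k) \<le> real (card {B<..16 * B}) * (1 / (real B)\<^sup>2)"
        by (intro sum_bounded_above)
      then have "tail B - tail (16 * B) \<le> 15 * real B / (real B)\<^sup>2" by (simp add: size_window_mass)
      also note elim(2)
      finally have "(tail B - tail (16 * B)) * sqrt (real B) < L / 2" using elim(3) by (simp add: pos_less_divide_eq)
      then show False using elim(1) by (simp add: left_diff_distrib)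
    qed
  qed
qed

theorem total_weight_lower_bound:
  "\<forall>\<^sub>F n in sequentially. 0 < q n \<longrightarrow> exp (- (sqrt (real n) * (ln (real n))\<^sup>2)) * p 0 \<le> q n"
proof -
  \<comment> \<open>The shift and the division by \<open>p 0\<close> make up for the leaf that is
    lost in grafting, so that \<open>r 0 = 1\<close> and \<open>r\<close> is
    supermultiplicative.\<close>
  define r where "r m = q (Suc m) / p 0" for m
  have "{t. num_vertices t = 1} = {Node []}"
  proof safe
    fix t assume "num_vertices t = 1"
    then show "t = Node []" using num_vertices_pos
      by (cases t) (auto simp: sum_list_eq_0_iff, metis list.set_intros(1) neq_Nil_conv less_numeral_extra(3))
  qed simp
  then have q1: "q 1 = p 0" by (simp add: total_weight_def)
  have r0: "r 0 = 1" using q1 leaf by (simp add: r_def)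
  have rn: "0 \<le> r n" for n using leaf by (simp add: r_def total_weight_nonneg)
  have rs: "r a * r b \<le> r (a + b)" for a b
    using total_weight_graft[of p a b] leaf by (simp add: r_def field_simps)
  have "\<forall>\<^sub>F B in sequentially. \<exists>b. B \<le> b \<and> b \<le> 16 * B \<and> 1 / (real B)\<^sup>2 \<le> r b"
    using total_weight_blocks
  proof (rule eventually_mono)
    fix B assume "\<exists>b. B \<le> b \<and> b \<le> 16 * B \<and> 1 / (real B)\<^sup>2 \<le> q (Suc b)"
    then obtain b where b: "B \<le> b" "b \<le> 16 * B" "1 / (real B)\<^sup>2 \<le> q (Suc b)" by blast
    have "q (Suc b) * p 0 \<le> q (Suc b)" by (intro mult_left_le) (auto simp: pmf_le_1 total_weight_nonneg)
    then have "q (Suc b) \<le> r b" using leaf by (simp add: r_def pos_le_divide_eq)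
    then show "\<exists>b. B \<le> b \<and> b \<le> 16 * B \<and> 1 / (real B)\<^sup>2 \<le> r b" using b by (intro exI[of _ b]) auto
  qed
  from supermultiplicative_lower_bound[OF r0 rn rs this]
  have ev: "\<forall>\<^sub>F n in sequentially. 0 < r n \<longrightarrow> exp (- (sqrt (real n) * (ln (real n))\<^sup>2)) \<le> r n" .
  have "\<forall>\<^sub>F n in sequentially. 0 < q (Suc n) \<longrightarrow> exp (- (sqrt (real (Suc n)) * (ln (real (Suc n)))\<^sup>2)) * p 0 \<le> q (Suc n)"
    using ev eventually_gt_at_top[of 0]
  proof eventually_elim
    case (elim n)
    show ?case
    proof
      assume "0 < q (Suc n)"
      then have "exp (- (sqrt (real n) * (ln (real n))\<^sup>2)) \<le> r n" using elim leaf by (simp add: r_def)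
      moreover have "sqrt (real n) * (ln (real n))\<^sup>2 \<le> sqrt (real (Suc n)) * (ln (real (Suc n)))\<^sup>2"
        using elim by (intro mult_mono power_mono) auto
      ultimately have "exp (- (sqrt (real (Suc n)) * (ln (real (Suc n)))\<^sup>2)) \<le> r n"
        by (meson exp_le_cancel_iff neg_le_iff_le order_trans)
      then show "exp (- (sqrt (real (Suc n)) * (ln (real (Suc n)))\<^sup>2)) * p 0 \<le> q (Suc n)"
        using leaf by (simp add: r_def pos_le_divide_eq)
    qed
  qed
  then show ?thesis by (rule eventually_sequentially_Suc[THEN iffD1])
qed

end

section \<open>Counting fringe subtrees in random words\<close>

text \<open>Bonferroni's inequality for each tree separately: with weight \<open>x\<close> and
  \<open>m\<close> start positions, the tree occurs with probability at least
  \<open>m * x - m\<^sup>2 * x\<^sup>2\<close>. Over \<open>A\<close> the weights add up to at most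
  1, hence their squares to at most \<open>a\<close>. Only the first \<open>n - L\<close> start
  positions are used, where every tree of \<open>A\<close> fits.\<close>

lemma expectation_distinct_occ_ge:
  assumes A: "finite A" "A \<subseteq> {s. num_vertices s \<le> L}" and pA: "\<And>s. s \<in> A \<Longrightarrow> weight (pmf p) s \<le> a" and a: "0 \<le> a"
  shows "real (n - L) * (\<Sum>s\<in>A. weight (pmf p) s) - (real n)\<^sup>2 * a
    \<le> measure_pmf.expectation (replicate_pmf n p) (\<lambda>w. real (distinct_occ A w))"
proof -
  let ?P = "replicate_pmf n p"
  have one: "real (n - L) * weight (pmf p) s - (real n)\<^sup>2 * (weight (pmf p) s)\<^sup>2
      \<le> measure_pmf.prob ?P {w. \<exists>i. occ s i w}" if s: "s \<in> A" for s
  proof -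
    let ?x = "weight (pmf p) s"
    have "real m * ?x - (real m)\<^sup>2 * ?x\<^sup>2 \<le> measure_pmf.prob ?P (\<Union>i<m. {w. occ s i w})" if "m \<le> n - L" for m
      using that
    proof (induction m)
      case (Suc m)
      let ?U = "\<Union>i<m. {w. occ s i w}" and ?E = "{w. occ s m w}"
      have sz: "num_vertices s \<le> L" using s A by auto
      have "measure_pmf.prob ?P (?U \<inter> ?E) = measure_pmf.prob ?P (\<Union>i<m. {w. occ s i w \<and> occ s m w})"
        by (rule arg_cong[where f = "measure_pmf.prob ?P"]) auto
      also have "\<dots> \<le> (\<Sum>i<m. measure_pmf.prob ?P {w. occ s i w \<and> occ s m w})"
        by (intro measure_pmf.finite_measure_subadditive_finite) auto
      also have "\<dots> \<le> (\<Sum>i<m. ?x\<^sup>2)" by (intro sum_mono prob_occ_twice_le) auto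
      finally have int: "measure_pmf.prob ?P (?U \<inter> ?E) \<le> real m * ?x\<^sup>2" by simp
      have E: "measure_pmf.prob ?P ?E = ?x" using Suc.prems sz num_vertices_pos[of s] by (intro prob_occ) linarith
      have "measure_pmf.prob ?P (\<Union>i<Suc m. {w. occ s i w}) = measure_pmf.prob ?P (?U \<union> ?E)"
        by (rule arg_cong[where f = "measure_pmf.prob ?P"]) (auto simp: less_Suc_eq)
      also have "\<dots> = measure_pmf.prob ?P ?U + measure_pmf.prob ?P ?E - measure_pmf.prob ?P (?U \<inter> ?E)"
        by (simp add: measure_pmf.finite_measure_Union' measure_pmf.finite_measure_Diff' Int_commute)
      also have "\<dots> \<ge> real m * ?x - (real m)\<^sup>2 * ?x\<^sup>2 + ?x - real m * ?x\<^sup>2" using Suc int E by simp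
      finally have "real m * ?x - (real m)\<^sup>2 * ?x\<^sup>2 + ?x - real m * ?x\<^sup>2
        \<le> measure_pmf.prob ?P (\<Union>i<Suc m. {w. occ s i w})" .
      moreover have "0 \<le> real m * ?x\<^sup>2 + ?x\<^sup>2" by simp
      moreover have "real (Suc m) * ?x - (real (Suc m))\<^sup>2 * ?x\<^sup>2
          = real m * ?x - (real m)\<^sup>2 * ?x\<^sup>2 + ?x - real m * ?x\<^sup>2 - (real m * ?x\<^sup>2 + ?x\<^sup>2)"
        by (simp add: power2_eq_square algebra_simps)
      ultimately show ?case by linarith
    qed simp
    from this[of "n - L"] have "real (n - L) * ?x - (real (n - L))\<^sup>2 * ?x\<^sup>2
        \<le> measure_pmf.prob ?P (\<Union>i<n - L. {w. occ s i w})" by simp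
    also have "\<dots> \<le> measure_pmf.prob ?P {w. \<exists>i. occ s i w}"
      by (rule measure_pmf.finite_measure_mono) auto
    finally show ?thesis
      using mult_right_mono[of "(real (n - L))\<^sup>2" "(real n)\<^sup>2" "?x\<^sup>2"] by (simp add: power_mono)
  qed
  have "(real n)\<^sup>2 * (\<Sum>s\<in>A. (weight (pmf p) s)\<^sup>2) \<le> (real n)\<^sup>2 * (a * 1)"
  proof -
    have "(\<Sum>s\<in>A. (weight (pmf p) s)\<^sup>2) \<le> (\<Sum>s\<in>A. a * weight (pmf p) s)"
      unfolding power2_eq_square using pA by (intro sum_mono mult_right_mono) auto
    also have "\<dots> \<le> a * 1"
      unfolding sum_distrib_left[symmetric] using sum_weight_le_1[OF A(1)] a by (intro mult_left_mono)
    finally show ?thesis by (intro mult_left_mono) auto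
  qed
  then have "real (n - L) * (\<Sum>s\<in>A. weight (pmf p) s) - (real n)\<^sup>2 * a
    \<le> (\<Sum>s\<in>A. real (n - L) * weight (pmf p) s - (real n)\<^sup>2 * (weight (pmf p) s)\<^sup>2)"
    by (simp add: sum_subtractf sum_distrib_left)
  also have "\<dots> \<le> (\<Sum>s\<in>A. measure_pmf.prob ?P {w. \<exists>i. occ s i w})" by (intro sum_mono one)
  also have "\<dots> = (\<Sum>s\<in>A. measure_pmf.expectation ?P (indicator {w. \<exists>i. occ s i w}))" by simp
  also have "\<dots> = measure_pmf.expectation ?P (\<lambda>w. \<Sum>s\<in>A. indicator {w. \<exists>i. occ s i w} w)"
    by (subst Bochner_Integration.integral_sum) (auto intro!: integrable_bounded_pmf[where B = 1])
  also have "(\<lambda>w. \<Sum>s\<in>A. indicator {w. \<exists>i. occ s i w} w) = (\<lambda>w. real (distinct_occ A w))"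
    using A(1) by (auto simp: distinct_occ_def indicator_def sum.If_cases Int_def)
  finally show ?thesis .
qed

lemma prob_no_small_occ:
  assumes "i + K \<le> n"
  shows "measure_pmf.prob (replicate_pmf n p) {w. \<not> (\<exists>s. num_vertices s \<le> K \<and> occ s i w)}
    = 1 - (\<Sum>k\<le>K. total_weight (pmf p) k)"
proof -
  have "measure_pmf.prob (replicate_pmf n p) {w. \<exists>s\<in>{s. num_vertices s \<le> K}. occ s i w}
      = (\<Sum>s | num_vertices s \<le> K. weight (pmf p) s)"
    by (rule sum_weight_eq_prob[OF finite_trees_size_le]) (use assms in auto)
  moreover have "{w. \<not> (\<exists>s. num_vertices s \<le> K \<and> occ s i w)} = UNIV - {w. \<exists>s\<in>{s. num_vertices s \<le> K}. occ s i w}"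
    by auto
  moreover have "measure_pmf.prob (replicate_pmf n p) (UNIV - {w. \<exists>s\<in>{s. num_vertices s \<le> K}. occ s i w})
      = 1 - measure_pmf.prob (replicate_pmf n p) {w. \<exists>s\<in>{s. num_vertices s \<le> K}. occ s i w}"
    using measure_pmf.prob_compl[of "{w. \<exists>s\<in>{s. num_vertices s \<le> K}. occ s i w}" "replicate_pmf n p"] by simp
  ultimately show ?thesis by (simp add: sum_total_weight)
qed

text \<open>Linearity over the positions. Those near the end, where a tree of size \<open>K\<close>
  would not fit, are counted with probability 1 and give the summand \<open>real K\<close>.\<close>

lemma expectation_no_small_occ_le:
  "measure_pmf.expectation (replicate_pmf n p) (\<lambda>w. real (no_small_occ K w))
    \<le> real n * (1 - (\<Sum>k\<le>K. total_weight (pmf p) k)) + real K"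
proof -
  let ?P = "replicate_pmf n p" and ?t = "1 - (\<Sum>k\<le>K. total_weight (pmf p) k)"
  let ?B = "\<lambda>i. {w. \<not> (\<exists>s. num_vertices s \<le> K \<and> occ s i w)}"
  have t: "0 \<le> ?t" using sum_weight_le_1[OF finite_trees_size_le, of p K] by (simp add: sum_total_weight)
  have "measure_pmf.expectation ?P (\<lambda>w. real (no_small_occ K w))
      = measure_pmf.expectation ?P (\<lambda>w. \<Sum>i<n. indicator (?B i) w)"
  proof (intro integral_cong_AE)
    show "AE w in ?P. real (no_small_occ K w) = (\<Sum>i<n. indicator (?B i) w)"
    proof (rule AE_pmfI)
      fix w assume "w \<in> set_pmf ?P"
      then have "length w = n" by (rule length_replicate_pmf)
      then show "real (no_small_occ K w) = (\<Sum>i<n. indicator (?B i) w)"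
        by (simp add: no_small_occ_def indicator_def sum.If_cases Int_def)
    qed
  qed auto
  also have "\<dots> = (\<Sum>i<n. measure_pmf.prob ?P (?B i))"
    by (subst Bochner_Integration.integral_sum) (auto intro!: integrable_bounded_pmf[where B = 1])
  also have "\<dots> \<le> (\<Sum>i<n. ?t + indicator {n - K..} i)"
  proof (rule sum_mono)
    fix i assume "i \<in> {..<n}"
    show "measure_pmf.prob ?P (?B i) \<le> ?t + indicator {n - K..} i"
    proof (cases "i + K \<le> n")
      case True
      then show ?thesis using prob_no_small_occ[OF True, of p] by simp
    next
      case False
      then have "?t + indicator {n - K..} i \<ge> 1" using t \<open>i \<in> {..<n}\<close> by simp
      then show ?thesis using measure_pmf.prob_le_1[of ?P "?B i"] by linarith
    qed
  qed
  also have "\<dots> = real n * ?t + real (card ({..<n} \<inter> {n - K..}))"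
    by (simp add: sum.distrib indicator_def sum.If_cases Int_def)
  also have "card ({..<n} \<inter> {n - K..}) \<le> card {n - K..<n}" by (intro card_mono) auto
  then have "real n * ?t + real (card ({..<n} \<inter> {n - K..})) \<le> real n * ?t + real K" by simp
  finally show ?thesis .
qed

section \<open>From sums over trees to random words, and the rarity of heavy trees\<close>

lemma expectation_replicate_prod:
  fixes f :: "'a \<Rightarrow> real"
  assumes f: "\<And>x. 0 \<le> f x" "\<And>x. f x \<le> 1"
  shows "measure_pmf.expectation (replicate_pmf n p) (\<lambda>w. prod_list (map f w)) = measure_pmf.expectation p f ^ n"
proof (induction n)
  case (Suc n)
  have bd: "\<bar>prod_list (map f w)\<bar> \<le> 1" for w
    using f by (induction w) (auto simp: abs_mult intro!: mult_le_one)
  have "measure_pmf.expectation (replicate_pmf (Suc n) p) (\<lambda>w. prod_list (map f w))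
      = measure_pmf.expectation p (\<lambda>x. f x * measure_pmf.expectation (replicate_pmf n p) (\<lambda>w. prod_list (map f w)))"
    unfolding replicate_pmf_Suc' using bd by (subst expectation_bind_pmf[where B = 1]) auto
  then show ?case using Suc by simp
qed simp

text \<open>The passage from conditioned trees to free words: \<open>code\<close> is injective and
  \<open>weight\<close> is the probability of the code as a word. Divided by
  \<open>total_weight (pmf p) n\<close>, the left side is a probability for the tree conditioned on
  its size.\<close>

lemma sum_trees_le_prob:
  "(\<Sum>s | num_vertices s = n \<and> code s \<in> B. weight (pmf p) s) \<le> measure_pmf.prob (replicate_pmf n p) B"
proof -
  let ?S = "{s. num_vertices s = n \<and> code s \<in> B}"
  have fin: "finite ?S" by (rule finite_subset[OF _ finite_plane_trees_of_size[of n]]) auto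
  have "(\<Sum>s\<in>?S. weight (pmf p) s) = (\<Sum>s\<in>?S. pmf (replicate_pmf n p) (code s))"
    by (intro sum.cong) (auto simp: pmf_replicate_pmf weight_code)
  also have "\<dots> = (\<Sum>w\<in>code ` ?S. pmf (replicate_pmf n p) w)"
    by (subst sum.reindex) (auto simp: inj_on_def code_inject)
  also have "\<dots> = measure_pmf.prob (replicate_pmf n p) (code ` ?S)"
    using fin by (simp add: measure_measure_pmf_finite)
  also have "\<dots> \<le> measure_pmf.prob (replicate_pmf n p) B" by (intro measure_pmf.finite_measure_mono) auto
  finally show ?thesis .
qed

text \<open>\<open>weight (pmf p) s powr \<theta>\<close> is a product over the letters of the code,
  so its analogue for words has a power as its mean; restricting words to codes drops nonnegative
  terms.\<close>

lemma sum_weight_powr_le: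
  assumes "0 < \<theta>"
  shows "(\<Sum>s | num_vertices s = k. weight (pmf p) s * weight (pmf p) s powr \<theta>)
    \<le> measure_pmf.expectation p (\<lambda>d. pmf p d powr \<theta>) ^ k"
proof -
  let ?P = "replicate_pmf k p" and ?S = "{s. num_vertices s = k}"
  define F where "F w = prod_list (map (\<lambda>d. pmf p d powr \<theta>) w)" for w
  have F01: "0 \<le> pmf p d powr \<theta>" "pmf p d powr \<theta> \<le> 1" for d
    using assms powr_mono2[of \<theta> "pmf p d" 1] by (auto simp: pmf_le_1)
  have F: "0 \<le> F w" "F w \<le> 1" for w
  proof -
    show "0 \<le> F w" unfolding F_def by (rule prod_list_nonneg) auto
    show "F w \<le> 1" unfolding F_def using F01 by (induction w) (auto intro!: mult_le_one prod_list_nonneg)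
  qed
  have wF: "weight (pmf p) s powr \<theta> = F (code s)" for s
  proof -
    have "prod_list (map (pmf p) w) powr \<theta> = F w" for w
      unfolding F_def by (induction w) (auto simp: powr_mult prod_list_nonneg)
    then show ?thesis by (simp add: weight_code)
  qed
  have "(\<Sum>s\<in>?S. weight (pmf p) s * weight (pmf p) s powr \<theta>) = (\<Sum>s\<in>?S. pmf ?P (code s) * F (code s))"
    unfolding wF by (intro sum.cong) (auto simp: pmf_replicate_pmf weight_code)
  also have "\<dots> = (\<Sum>w\<in>code ` ?S. pmf ?P w * F w)"
    by (subst sum.reindex) (auto simp: inj_on_def code_inject)
  also have "\<dots> = measure_pmf.expectation ?P (\<lambda>w. indicator (code ` ?S) w * F w)"
    by (subst integral_measure_pmf[where A = "code ` ?S"]) (auto simp: finite_plane_trees_of_size indicator_def split: if_splits intro!: sum.cong)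
  also have "\<dots> \<le> measure_pmf.expectation ?P F"
    using F by (intro integral_mono integrable_bounded_pmf[where B = 1]) (auto simp: indicator_def)
  also have "\<dots> = measure_pmf.expectation p (\<lambda>d. pmf p d powr \<theta>) ^ k"
    unfolding F_def using F01 by (rule expectation_replicate_prod)
  finally show ?thesis .
qed

text \<open>Chernoff's method, applied to the information content \<open>- ln (p d)\<close> of the out-degrees.\<close>

lemma heavy_trees_exponentially_rare:
  assumes int: "integrable (measure_pmf p) (\<lambda>d. ln (pmf p d))"
    and h: "h < - measure_pmf.expectation p (\<lambda>d. ln (pmf p d))"
  obtains \<rho> where "0 < \<rho>" "\<rho> < 1"
    "\<And>k. (\<Sum>s | num_vertices s = k \<and> exp (- h * real k) < weight (pmf p) s. weight (pmf p) s) \<le> \<rho> ^ k"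
proof -
  define X where "X d = - ln (pmf p d)" for d
  have X: "0 \<le> X d" if "d \<in> set_pmf p" for d using that by (simp add: X_def pmf_positive pmf_le_1)
  have intX: "integrable (measure_pmf p) X" unfolding X_def using int by simp
  define e where "e \<theta> = measure_pmf.expectation p (\<lambda>d. pmf p d powr \<theta>)" for \<theta>
  have pe: "pmf p d powr \<theta> = exp (- \<theta> * X d)" if "d \<in> set_pmf p" for d \<theta>
    using pmf_positive[OF that] by (simp add: powr_def X_def)
  have ib: "integrable (measure_pmf p) (\<lambda>d. pmf p d powr \<theta>)" if "0 < \<theta>" for \<theta>
    by (rule integrable_bounded_pmf[where B = 1]) (use that powr_mono2[of \<theta> _ 1] in \<open>auto simp: pmf_le_1\<close>)
  \<comment> \<open>With \<open>\<theta> = 1 / (N + 1)\<close>, the quotient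
    \<open>(1 - e \<theta>) / \<theta>\<close> tends to the entropy; the convergence is dominated by
    the information content \<open>X\<close>. Hence some \<open>\<theta>\<close> satisfies
    \<open>e \<theta> < 1 - \<theta> * h \<le> exp (- (\<theta> * h))\<close>.\<close>
  have lim: "(\<lambda>N. measure_pmf.expectation p (\<lambda>d. (1 - pmf p d powr (1 / real (Suc N))) * real (Suc N)))
      \<longlonglongrightarrow> measure_pmf.expectation p X"
  proof (rule integral_dominated_convergence)
    show "AE d in measure_pmf p. (\<lambda>N. (1 - pmf p d powr (1 / real (Suc N))) * real (Suc N)) \<longlonglongrightarrow> X d"
    proof (rule AE_pmfI)
      fix d assume d: "d \<in> set_pmf p"
      have "(\<lambda>N::nat. (1 - exp (- (1 / real (Suc N)) * X d)) * real (Suc N)) \<longlonglongrightarrow> X d"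
      proof (cases "X d = 0")
        case False
        then have "0 < X d" using X[OF d] by simp
        then show ?thesis by real_asymp
      qed simp
      then show "(\<lambda>N. (1 - pmf p d powr (1 / real (Suc N))) * real (Suc N)) \<longlonglongrightarrow> X d" by (simp add: pe[OF d])
    qed
    show "AE d in measure_pmf p. norm ((1 - pmf p d powr (1 / real (Suc N))) * real (Suc N)) \<le> X d" for N
    proof (rule AE_pmfI)
      fix d assume d: "d \<in> set_pmf p"
      let ?t = "1 / real (Suc N)"
      have "1 - exp (- ?t * X d) \<le> ?t * X d" using exp_ge_add_one_self[of "- ?t * X d"] by simp
      then have "(1 - exp (- ?t * X d)) * real (Suc N) \<le> ?t * X d * real (Suc N)" by (rule mult_right_mono) simp
      moreover have "0 \<le> 1 - exp (- ?t * X d)" using X[OF d] by simp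
      ultimately show "norm ((1 - pmf p d powr ?t) * real (Suc N)) \<le> X d" by (simp add: pe[OF d] abs_mult)
    qed
  qed (use intX in auto)
  have "h < measure_pmf.expectation p X" using h unfolding X_def by simp
  from order_tendstoD(1)[OF lim this] obtain N where
    N: "h < measure_pmf.expectation p (\<lambda>d. (1 - pmf p d powr (1 / real (Suc N))) * real (Suc N))"
    by (auto dest: eventually_happens)
  define \<theta> where "\<theta> = 1 / real (Suc N)"
  have \<theta>: "0 < \<theta>" by (simp add: \<theta>_def)
  have "h < (1 - e \<theta>) * real (Suc N)" using N ib[OF \<theta>] by (simp add: e_def \<theta>_def)
  then have "\<theta> * h < 1 - e \<theta>" by (simp add: \<theta>_def field_simps)
  then have e_lt: "e \<theta> < exp (- (\<theta> * h))" using exp_ge_add_one_self[of "- (\<theta> * h)"] by linarith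
  have e_nonneg: "0 \<le> e \<theta>" unfolding e_def by (intro integral_nonneg_AE) simp
  \<comment> \<open>The maximum with \<open>1 / 2\<close> secures \<open>0 < \<rho>\<close>.\<close>
  define \<rho> where "\<rho> = max (1 / 2) (e \<theta> * exp (\<theta> * h))"
  have "e \<theta> * exp (\<theta> * h) < exp (- (\<theta> * h)) * exp (\<theta> * h)" using e_lt by simp
  then have lt1: "e \<theta> * exp (\<theta> * h) < 1" by (simp add: exp_minus)
  show thesis
  proof (rule that[of \<rho>])
    show "0 < \<rho>" "\<rho> < 1" using lt1 by (auto simp: \<rho>_def)
    fix k
    let ?H = "{s. num_vertices s = k \<and> exp (- h * real k) < weight (pmf p) s}"
    have fin: "finite ?H" by (rule finite_subset[OF _ finite_plane_trees_of_size[of k]]) auto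
    \<comment> \<open>For a heavy tree the inserted factor
      \<open>exp (\<theta> * h) ^ k * weight (pmf p) s powr \<theta>\<close> is at least 1.\<close>
    have "(\<Sum>s\<in>?H. weight (pmf p) s) \<le> (\<Sum>s\<in>?H. exp (\<theta> * h) ^ k * (weight (pmf p) s * weight (pmf p) s powr \<theta>))"
    proof (rule sum_mono)
      fix s assume "s \<in> ?H"
      then have "exp (- h * real k) powr \<theta> \<le> weight (pmf p) s powr \<theta>" using \<theta> by (intro powr_mono2) auto
      then have "exp (\<theta> * h) ^ k * exp (- h * real k) powr \<theta> \<le> exp (\<theta> * h) ^ k * weight (pmf p) s powr \<theta>"
        by (intro mult_left_mono) auto
      moreover have "exp (\<theta> * h) ^ k * exp (- h * real k) powr \<theta> = 1"
        by (simp add: powr_def exp_of_nat_mult[symmetric] exp_add[symmetric] algebra_simps)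
      ultimately have "1 \<le> exp (\<theta> * h) ^ k * weight (pmf p) s powr \<theta>" by linarith
      then have "1 * weight (pmf p) s \<le> (exp (\<theta> * h) ^ k * weight (pmf p) s powr \<theta>) * weight (pmf p) s"
        by (intro mult_right_mono) auto
      then show "weight (pmf p) s \<le> exp (\<theta> * h) ^ k * (weight (pmf p) s * weight (pmf p) s powr \<theta>)"
        by (simp add: mult_ac)
    qed
    also have "\<dots> \<le> (\<Sum>s | num_vertices s = k. exp (\<theta> * h) ^ k * (weight (pmf p) s * weight (pmf p) s powr \<theta>))"
      by (rule sum_mono2[OF finite_plane_trees_of_size]) auto
    also have "\<dots> \<le> exp (\<theta> * h) ^ k * e \<theta> ^ k"
      unfolding sum_distrib_left[symmetric] e_def using sum_weight_powr_le[OF \<theta>] by (intro mult_left_mono) auto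
    also have "\<dots> \<le> \<rho> ^ k" unfolding power_mult_distrib[symmetric] using e_nonneg
      by (intro power_mono) (auto simp: \<rho>_def mult.commute)
    finally show "(\<Sum>s\<in>?H. weight (pmf p) s) \<le> \<rho> ^ k" .
  qed
qed

lemma weight_fringe_pos:
  assumes "\<And>m. 0 \<le> f m" "0 < weight f t" "s \<in> fringe_subtrees t"
  shows "0 < weight f s"
  using assms(2,3)
proof (induction t)
  case (Node ts)
  show ?case
  proof (cases "s = Node ts")
    case False
    then obtain t where t: "t \<in> set ts" "s \<in> fringe_subtrees t" using Node.prems by auto
    have "prod_list (map (weight f) ts) \<noteq> 0" using Node.prems(1) by auto
    then have "weight f t \<noteq> 0" using t(1) by (auto simp: prod_list_zero_iff)
    then have "0 < weight f t" using weight_nonneg[of f t] assms(1) by simp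
    then show ?thesis using Node.IH t by blast
  qed (use Node in simp)
qed

text \<open>Lets trees of weight 0 be ignored: the bound on the number of small fringe subtrees
  holds for trees of positive weight.\<close>

lemma sum_mono_nonzero:
  fixes f :: "'a \<Rightarrow> real"
  assumes "finite S" "finite S'" "\<And>s. s \<in> S \<Longrightarrow> f s \<noteq> 0 \<Longrightarrow> s \<in> S'" "\<And>s. 0 \<le> f s"
  shows "sum f S \<le> sum f S'"
proof -
  have "sum f S = sum f {s \<in> S. f s \<noteq> 0}" using assms(1) by (intro sum.mono_neutral_right) auto
  also have "\<dots> \<le> sum f S'" using assms by (intro sum_mono2) auto
  finally show ?thesis .
qed

text \<open>The exponent is \<open>- 2 * \<gamma>\<^sup>2 * n / (ln n * L\<^sup>2)\<close>, and
  \<open>ln n * L\<^sup>2 \<le> 4 * (ln n) ^ 5\<close>; the power is rounded up to 6.\<close>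

lemma exp_mcdiarmid_bound:
  assumes n: "1 \<le> ln (real n)" and L: "0 < L" "real L \<le> 2 * (ln (real n))\<^sup>2"
  shows "exp (- 2 * (\<gamma> * (real n / sqrt (ln (real n))))\<^sup>2 / (real n * (real L)\<^sup>2))
    \<le> exp (- (\<gamma>\<^sup>2 / 2) * real n / (ln (real n)) ^ 6)"
proof -
  let ?x = "ln (real n)"
  have x: "0 < ?x" using n by linarith
  have n0: "0 < real n" using x by (cases "n = 0") auto
  have "(real L)\<^sup>2 \<le> (2 * ?x\<^sup>2)\<^sup>2" using L by (intro power_mono) auto
  also have "\<dots> = 4 * ?x ^ 4" by (simp add: power_mult_distrib flip: power_mult)
  finally have L2: "(real L)\<^sup>2 \<le> 4 * ?x ^ 4" .
  have "?x * (real L)\<^sup>2 \<le> ?x * (4 * ?x ^ 4)" using L2 x by (intro mult_left_mono) auto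
  also have "\<dots> = 4 * ?x ^ 5" by (simp add: eval_nat_numeral)
  also have "\<dots> \<le> 4 * ?x ^ 6" using n by (intro mult_left_mono power_increasing) auto
  finally have "2 * \<gamma>\<^sup>2 * real n / (4 * ?x ^ 6) \<le> 2 * \<gamma>\<^sup>2 * real n / (?x * (real L)\<^sup>2)"
    using x L(1) by (intro divide_left_mono) auto
  also have "2 * \<gamma>\<^sup>2 * real n / (?x * (real L)\<^sup>2) = 2 * (\<gamma> * (real n / sqrt ?x))\<^sup>2 / (real n * (real L)\<^sup>2)"
    using x n0 L(1) by (simp add: power_mult_distrib power_divide power2_eq_square)
  also have "2 * \<gamma>\<^sup>2 * real n / (4 * ?x ^ 6) = (\<gamma>\<^sup>2 / 2) * real n / ?x ^ 6" by simp
  finally show ?thesis by simp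
qed

section \<open>Rarity of too many and of too few fringe subtrees\<close>

context critical_offspring
begin

text \<open>\<open>n / (ln n) ^ 6\<close> outgrows \<open>sqrt n * (ln n)\<^sup>2\<close>, so
  McDiarmid's bound stays small after division by \<open>q n\<close>. The remaining
  \<open>1 / n\<close> suffices to control means, because a tree of size \<open>n\<close> has at
  most \<open>n\<close> fringe subtrees.\<close>

lemma stretched_exponential_negligible:
  assumes "0 < a"
  shows "\<forall>\<^sub>F n in sequentially. 0 < q n \<longrightarrow> exp (- a * real n / (ln (real n)) ^ 6) \<le> q n / real n"
proof -
  have "\<forall>\<^sub>F n::nat in sequentially. exp (- a * real n / (ln (real n)) ^ 6) * real n \<le> exp (- (sqrt (real n) * (ln (real n))\<^sup>2)) * p 0"
    using assms leaf by real_asymp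
  then show ?thesis using total_weight_lower_bound eventually_gt_at_top[of 0]
  proof eventually_elim
    case (elim n)
    show ?case
    proof
      assume "0 < q n"
      then have "exp (- a * real n / (ln (real n)) ^ 6) * real n \<le> q n" using elim by linarith
      then show "exp (- a * real n / (ln (real n)) ^ 6) \<le> q n / real n" using elim by (simp add: pos_le_divide_eq)
    qed
  qed
qed

text \<open>At the cutoff \<open>K\<close> near \<open>c * ln n\<close>, the number of small trees
  is bounded deterministically, by about \<open>n powr (C * c)\<close>. Only the number of positions
  without a small tree is random, with mean about \<open>l * n / sqrt (ln n)\<close>, and
  McDiarmid's inequality is applied to it.\<close>

lemma many_fringe_subtrees_rare:
  assumes C: "0 < C" and \<delta>: "0 < \<delta>"
    and count: "\<And>K. real (card {s. num_vertices s \<le> K \<and> 0 < weight p s}) \<le> A * (real K + 1) * exp (C * real K)"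
  shows "\<forall>\<^sub>F n in sequentially. 0 < q n \<longrightarrow>
    (\<Sum>s | num_vertices s = n \<and> tail_const * sqrt C * (real n / sqrt (ln (real n))) * (1 + \<delta>) < real (card (fringe_subtrees s)). weight p s)
      \<le> q n / real n" (is "eventually (\<lambda>n. _ \<longrightarrow> ?G n) _")
proof -
  \<comment> \<open>\<open>C * c = 1 / (1 + \<delta>) < 1\<close> keeps the number of small trees
    below a power of \<open>n\<close> with exponent less than 1, while
    \<open>1 / sqrt c = sqrt C * sqrt (1 + \<delta>)\<close> stays below
    \<open>sqrt C * (1 + \<delta>)\<close>.\<close>
  define c where "c = 1 / (C * (1 + \<delta>))"
  have c: "0 < c" using C \<delta> by (simp add: c_def)
  have e: "C * c < 1" using C \<delta> by (simp add: c_def)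
  define l where "l = tail_const / sqrt c"
  define T where "T = tail_const * sqrt C * (1 + \<delta>)"
  \<comment> \<open>Three shares of the gap: the error in the tail, the lower-order terms, and the
    deviation from the mean.\<close>
  define \<gamma> where "\<gamma> = (T - l) / 3"
  have "sqrt (1 + \<delta>) < 1 + \<delta>"
  proof (rule real_less_lsqrt)
    show "1 + \<delta> < (1 + \<delta>)\<^sup>2" using \<delta> by (simp add: power2_eq_square)
  qed (use \<delta> in auto)
  then have "tail_const * sqrt C * sqrt (1 + \<delta>) < T"
    unfolding T_def using tail_const_pos C by (intro mult_strict_left_mono) auto
  moreover have "l = tail_const * sqrt C * sqrt (1 + \<delta>)"
    unfolding l_def c_def by (simp add: real_sqrt_divide real_sqrt_mult)
  ultimately have \<gamma>: "0 < \<gamma>" by (simp add: \<gamma>_def)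
  define K where "K n = nat \<lfloor>c * ln (real n)\<rfloor>" for n
  define g where "g n = real n / sqrt (ln (real n))" for n
  have ln_top: "filterlim (\<lambda>n. ln (real n)) at_top sequentially" by real_asymp
  have "(\<lambda>n. tail (K n) * sqrt (ln (real n))) \<longlonglongrightarrow> l"
    unfolding l_def K_def by (rule tendsto_scaled_index[OF tail_asymp c ln_top tendsto_round_divide(1)[OF c ln_top]])
  then have ev_tail: "\<forall>\<^sub>F n in sequentially. tail (K n) * sqrt (ln (real n)) < l + \<gamma>"
    by (rule order_tendstoD) (use \<gamma> in simp)
  define A' where "A' = \<bar>A\<bar> + 1"
  have A': "A \<le> A'" "0 < A'" by (auto simp: A'_def)
  have ev_small: "\<forall>\<^sub>F n in sequentially. c * ln (real n) + A' * (c * ln (real n) + 1) * exp (C * c * ln (real n)) \<le> \<gamma> * g n"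
    unfolding g_def using c e \<gamma> A' C by real_asymp
  have ev_c: "\<forall>\<^sub>F n in sequentially. c * ln (real n) + 1 \<le> 2 * (ln (real n))\<^sup>2" using c by real_asymp
  have ev_ln: "\<forall>\<^sub>F n in sequentially. max 1 (1 / c) < ln (real n)"
    by (rule filterlim_at_top_dense[THEN iffD1, OF ln_top, rule_format])
  have "0 < \<gamma>\<^sup>2 / 2" using \<gamma> by simp
  note ev_neg = stretched_exponential_negligible[OF this]
  show ?thesis using ev_tail ev_small ev_c ev_ln ev_neg
  proof eventually_elim
    case (elim n)
    show ?case
    proof
      assume q: "0 < q n"
      let ?P = "replicate_pmf n \<xi>"
      let ?N = "\<lambda>w. real (no_small_occ (K n) w)"
      have ln1: "1 \<le> ln (real n)" "1 / c < ln (real n)" using elim(4) by auto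
      have n0: "0 < n" using ln1 by (cases "n = 0") auto
      have "0 < ln (real n)" using ln1 by linarith
      then have g: "real n = g n * sqrt (ln (real n))" "0 < g n" using n0 by (simp_all add: g_def)
      have Kn: "real (K n) \<le> c * ln (real n)" "0 < K n"
      proof -
        have "1 < c * ln (real n)" using ln1(2) c by (simp add: field_simps)
        then show "real (K n) \<le> c * ln (real n)" "0 < K n" unfolding K_def by linarith+
      qed
      have E: "measure_pmf.expectation ?P ?N + \<gamma> * g n + real (card {s. num_vertices s \<le> K n \<and> 0 < weight p s}) \<le> T * g n"
      proof -
        have "measure_pmf.expectation ?P ?N \<le> real n * tail (K n) + real (K n)"
          using expectation_no_small_occ_le[of n \<xi> "K n"] by (simp add: tail_def)
        also have "real n * tail (K n) = g n * (tail (K n) * sqrt (ln (real n)))" by (subst g(1)) (simp add: mult_ac)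
        also have "\<dots> \<le> g n * (l + \<gamma>)" using elim(1) g(2) by (intro mult_left_mono) auto
        finally have 1: "measure_pmf.expectation ?P ?N \<le> g n * (l + \<gamma>) + real (K n)" by simp
        have "real (card {s. num_vertices s \<le> K n \<and> 0 < weight p s}) \<le> A * (real (K n) + 1) * exp (C * real (K n))"
          by (rule count)
        also have "\<dots> \<le> A' * (c * ln (real n) + 1) * exp (C * (c * ln (real n)))"
        proof -
          have "A * (real (K n) + 1) \<le> A' * (real (K n) + 1)" using A' by (intro mult_right_mono) auto
          then have "A * (real (K n) + 1) * exp (C * real (K n)) \<le> A' * (real (K n) + 1) * exp (C * real (K n))"
            by (intro mult_right_mono) auto
          also have "\<dots> \<le> A' * (c * ln (real n) + 1) * exp (C * (c * ln (real n)))"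
            using Kn A' C c ln1 by (intro mult_mono) auto
          finally show ?thesis .
        qed
        finally have 2: "real (card {s. num_vertices s \<le> K n \<and> 0 < weight p s}) + c * ln (real n) \<le> \<gamma> * g n"
          using elim(2) by (simp add: mult.assoc)
        have "T * g n = g n * (l + \<gamma>) + \<gamma> * g n + \<gamma> * g n" by (simp add: \<gamma>_def field_simps)
        then show ?thesis using 1 2 Kn(1) by linarith
      qed
      have "(\<Sum>s | num_vertices s = n \<and> T * g n < real (card (fringe_subtrees s)). weight p s)
          \<le> (\<Sum>s | num_vertices s = n \<and> code s \<in> {w. measure_pmf.expectation ?P ?N + \<gamma> * g n \<le> ?N w}. weight p s)"
        (is "sum _ ?S \<le> sum _ ?S'")
      proof -
        have "s \<in> ?S'" if s: "s \<in> ?S" "weight p s \<noteq> 0" for s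
        proof -
          have pos: "0 < weight p s" using s(2) weight_pmf_nonneg[of \<xi> s] by linarith
          have "card (fringe_subtrees s) \<le> card {s. num_vertices s \<le> K n \<and> 0 < weight p s} + no_small_occ (K n) (code s)"
            by (rule card_fringe_le, rule weight_fringe_pos[OF pmf_nonneg pos])
          then have "real (card (fringe_subtrees s)) \<le> real (card {s. num_vertices s \<le> K n \<and> 0 < weight p s}) + ?N (code s)"
            by linarith
          then show ?thesis using s(1) E by auto
        qed
        moreover have "finite ?S" "finite ?S'"
          by (rule finite_subset[OF _ finite_plane_trees_of_size[of n]]; auto)+
        ultimately show ?thesis by (intro sum_mono_nonzero) auto
      qed
      also have "\<dots> \<le> measure_pmf.prob ?P {w. measure_pmf.expectation ?P ?N + \<gamma> * g n \<le> ?N w}"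
        by (rule sum_trees_le_prob)
      also have "\<dots> \<le> exp (- 2 * (\<gamma> * g n)\<^sup>2 / (real n * (real (K n))\<^sup>2))"
      proof (rule mcdiarmid_ge[where B = "real n"])
        show "0 \<le> \<gamma> * g n" using \<gamma> g by simp
        show "\<bar>?N w - ?N (w[i := x])\<bar> \<le> real (K n)" for w i x
          by (rule abs_diff_update_le) (rule no_small_occ_update_le)
        show "\<bar>?N w\<bar> \<le> real n" if "length w = n" for w
        proof -
          have "no_small_occ (K n) w \<le> card {..<length w}" unfolding no_small_occ_def by (intro card_mono) auto
          then show ?thesis using that by simp
        qed
      qed simp
      also have "\<dots> \<le> exp (- (\<gamma>\<^sup>2 / 2) * real n / (ln (real n)) ^ 6)"
        unfolding g_def by (rule exp_mcdiarmid_bound) (use ln1 Kn elim(3) in auto)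
      also have "\<dots> \<le> q n / real n" using elim(5) q by blast
      finally show "?G n" by (simp add: T_def g_def mult_ac)
    qed
  qed
qed

text \<open>Only fringe subtrees with sizes above \<open>K\<close> and up to \<open>L\<close> and
  with weight at most \<open>exp (- h * size)\<close> are counted. The lower cutoff makes each
  weight at most \<open>n powr (- h * c)\<close>, so repetitions are rare; the upper cutoff keeps
  the Lipschitz constant polylogarithmic.\<close>

lemma few_fringe_subtrees_rare:
  assumes int: "integrable (measure_pmf \<xi>) (\<lambda>d. ln (p d))"
  defines "H \<equiv> - measure_pmf.expectation \<xi> (\<lambda>d. ln (p d))"
  assumes H: "0 < H" and \<delta>: "0 < \<delta>" "\<delta> < 1"
  shows "\<forall>\<^sub>F n in sequentially. 0 < q n \<longrightarrow>
    (\<Sum>s | num_vertices s = n \<and> real (card (fringe_subtrees s)) < tail_const * sqrt H * (real n / sqrt (ln (real n))) * (1 - \<delta>). weight p s)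
      \<le> q n / real n" (is "eventually (\<lambda>n. _ \<longrightarrow> ?G n) _")
proof -
  \<comment> \<open>With \<open>c = 1 / (H * u\<^sup>2)\<close> and \<open>h = H * u\<close>, the
    exponent \<open>h * c = 1 / u\<close> exceeds 1, so that repetitions cost only
    \<open>n powr (2 - 1 / u)\<close>; and \<open>1 / sqrt c = sqrt H * u\<close> still exceeds
    \<open>sqrt H * (1 - \<delta>)\<close>.\<close>
  define u where "u = 1 - \<delta> / 2"
  have u: "0 < u" "u < 1" using \<delta> by (auto simp: u_def)
  define c where "c = 1 / (H * u\<^sup>2)"
  define h where "h = H * u"
  have c: "0 < c" using H u by (simp add: c_def)
  have h: "0 < h" "h < H" using H u by (auto simp: h_def)
  have hc: "h * c = 1 / u" using H u by (simp add: h_def c_def power2_eq_square)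
  have hc1: "1 < h * c" unfolding hc using u by simp
  define l where "l = tail_const / sqrt c"
  define T where "T = tail_const * sqrt H * (1 - \<delta>)"
  have l: "l = tail_const * sqrt H * u"
    using u H by (simp add: l_def c_def real_sqrt_divide real_sqrt_mult)
  \<comment> \<open>Four shares of the gap: the tails at \<open>K\<close> and at \<open>L\<close>,
    the lower-order terms, and the deviation from the mean.\<close>
  define \<gamma> where "\<gamma> = (l - T) / 4"
  have "T < l" unfolding T_def l using tail_const_pos H \<delta> by (intro mult_strict_left_mono) (auto simp: u_def)
  then have \<gamma>: "0 < \<gamma>" by (simp add: \<gamma>_def)
  obtain \<rho> where \<rho>: "0 < \<rho>" "\<rho> < 1"
    and heavy: "\<And>k. (\<Sum>s | num_vertices s = k \<and> exp (- h * real k) < weight p s. weight p s) \<le> \<rho> ^ k"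
    using heavy_trees_exponentially_rare[OF int, of h] h(2) unfolding H_def by blast
  \<comment> \<open>Chosen so that \<open>\<rho> powr (c * ln n) = n powr (- b)\<close>; up to the
    factor \<open>1 / (1 - \<rho>)\<close> this bounds the mass of the heavy trees above the lower
    cutoff.\<close>
  define b where "b = - (c * ln \<rho>)"
  have b: "0 < b" using c \<rho> by (simp add: b_def mult_pos_neg)
  define K where "K n = nat \<lceil>c * ln (real n)\<rceil>" for n
  \<comment> \<open>The tail at \<open>(ln n)\<^sup>2\<close> is of order \<open>1 / ln n\<close>,
    hence negligible against \<open>1 / sqrt (ln n)\<close>, and McDiarmid's inequality tolerates a
    Lipschitz constant of this size.\<close>
  define L where "L n = nat \<lceil>(ln (real n))\<^sup>2\<rceil>" for n
  define g where "g n = real n / sqrt (ln (real n))" for n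
  have ln_top: "filterlim (\<lambda>n. ln (real n)) at_top sequentially" by real_asymp
  have ln2_top: "filterlim (\<lambda>n. (ln (real n))\<^sup>2) at_top sequentially" by real_asymp
  have "(\<lambda>n. tail (K n) * sqrt (ln (real n))) \<longlonglongrightarrow> l"
    unfolding l_def K_def by (rule tendsto_scaled_index[OF tail_asymp c ln_top tendsto_round_divide(2)[OF c ln_top]])
  then have ev_K: "\<forall>\<^sub>F n in sequentially. l - \<gamma> < tail (K n) * sqrt (ln (real n))"
    by (rule order_tendstoD) (use \<gamma> in simp)
  have "(\<lambda>n. tail (L n) * sqrt ((ln (real n))\<^sup>2)) \<longlonglongrightarrow> tail_const / sqrt 1"
    using tendsto_round_divide(2)[of 1, OF _ ln2_top] unfolding L_def by (intro tendsto_scaled_index[OF tail_asymp _ ln2_top]) simp_all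
  then have "(\<lambda>n. tail (L n) * sqrt ((ln (real n))\<^sup>2) * (1 / sqrt (ln (real n)))) \<longlonglongrightarrow> tail_const / sqrt 1 * 0"
    by (rule tendsto_mult) real_asymp
  then have ev_L: "\<forall>\<^sub>F n in sequentially. tail (L n) * sqrt ((ln (real n))\<^sup>2) * (1 / sqrt (ln (real n))) < \<gamma>"
    by (rule order_tendstoD) (use \<gamma> in simp)
  have ev_small: "\<forall>\<^sub>F n in sequentially. real n * (exp (- b * ln (real n)) / (1 - \<rho>)) + 2 * (ln (real n))\<^sup>2
      + (real n)\<^sup>2 * exp (- (h * c) * ln (real n)) \<le> \<gamma> * g n"
  proof -
    have "\<forall>\<^sub>F n in sequentially. real n * (exp (- b * ln (real n)) * r) \<le> \<gamma> / 3 * g n" if "0 < r" for r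
      unfolding g_def using b \<gamma> that by real_asymp
    from this[of "1 / (1 - \<rho>)"]
    have 1: "\<forall>\<^sub>F n in sequentially. real n * (exp (- b * ln (real n)) / (1 - \<rho>)) \<le> \<gamma> / 3 * g n"
      using \<rho> by simp
    have 2: "\<forall>\<^sub>F n in sequentially. 2 * (ln (real n))\<^sup>2 \<le> \<gamma> / 3 * g n"
      unfolding g_def using \<gamma> by real_asymp
    have "\<forall>\<^sub>F n in sequentially. (real n)\<^sup>2 * exp (- e * ln (real n)) \<le> \<gamma> / 3 * g n" if "1 < e" for e
      unfolding g_def using \<gamma> that by real_asymp
    from this[OF hc1] have 3: "\<forall>\<^sub>F n in sequentially. (real n)\<^sup>2 * exp (- (h * c) * ln (real n)) \<le> \<gamma> / 3 * g n" .
    from 1 2 3 show ?thesis by eventually_elim linarith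
  qed
  have ev_c: "\<forall>\<^sub>F n in sequentially. c * ln (real n) + 1 \<le> (ln (real n))\<^sup>2" using c by real_asymp
  have ev_ln: "\<forall>\<^sub>F n in sequentially. 1 < ln (real n)"
    by (rule filterlim_at_top_dense[THEN iffD1, OF ln_top, rule_format])
  have "0 < \<gamma>\<^sup>2 / 2" using \<gamma> by simp
  note ev_neg = stretched_exponential_negligible[OF this]
  show ?thesis using ev_K ev_L ev_small ev_c ev_ln ev_neg
  proof eventually_elim
    case (elim n)
    show ?case
    proof
      assume q: "0 < q n"
      let ?P = "replicate_pmf n \<xi>"
      define A where "A = {s. K n < num_vertices s \<and> num_vertices s \<le> L n \<and> weight p s \<le> exp (- h * real (num_vertices s))}"
      let ?D = "\<lambda>w. real (distinct_occ A w)"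
      have ln1: "1 < ln (real n)" using elim(5) .
      have n0: "0 < n" using ln1 by (cases "n = 0") auto
      have "0 < ln (real n)" using ln1 by linarith
      then have g: "real n = g n * sqrt (ln (real n))" "0 < g n" using n0 by (simp_all add: g_def)
      have Kn: "c * ln (real n) \<le> real (K n)" unfolding K_def by (rule of_nat_ceiling)
      have ln2: "1 < (ln (real n))\<^sup>2" using ln1 by (simp add: one_less_power)
      have Ln: "real (L n) \<le> 2 * (ln (real n))\<^sup>2" "0 < L n" "K n \<le> L n"
      proof -
        show "real (L n) \<le> 2 * (ln (real n))\<^sup>2" "0 < L n" unfolding L_def using ln2 by linarith+
        have "c * ln (real n) \<le> (ln (real n))\<^sup>2" using elim(4) by linarith
        then show "K n \<le> L n" unfolding K_def L_def by (intro nat_mono ceiling_mono)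
      qed
      have Afin: "finite A" "A \<subseteq> {s. num_vertices s \<le> L n}"
      proof -
        show sub: "A \<subseteq> {s. num_vertices s \<le> L n}" by (auto simp: A_def)
        show "finite A" by (rule finite_subset[OF sub finite_trees_size_le])
      qed
      have Asmall: "weight p s \<le> exp (- (h * c) * ln (real n))" if "s \<in> A" for s
      proof -
        have "c * ln (real n) \<le> real (num_vertices s)" using that Kn by (auto simp: A_def)
        then have "h * (c * ln (real n)) \<le> h * real (num_vertices s)" using h by (intro mult_left_mono) auto
        then have "exp (- h * real (num_vertices s)) \<le> exp (- (h * c) * ln (real n))" by (simp add: mult.assoc)
        moreover have "weight p s \<le> exp (- h * real (num_vertices s))" using that by (simp add: A_def)
        ultimately show ?thesis by (rule order_trans[rotated])
      qed
      have mass: "tail (K n) - tail (L n) - exp (- b * ln (real n)) / (1 - \<rho>) \<le> (\<Sum>s\<in>A. weight p s)"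
      proof -
        have fin: "finite {s. num_vertices s = k \<and> P s}" for k P
          by (rule finite_subset[OF _ finite_plane_trees_of_size[of k]]) auto
        let ?H = "\<lambda>k. {s. num_vertices s = k \<and> exp (- h * real k) < weight p s}"
        let ?G = "\<lambda>k. {s. num_vertices s = k \<and> weight p s \<le> exp (- h * real k)}"
        have split: "q k \<le> (\<Sum>s\<in>?G k. weight p s) + \<rho> ^ k" for k
        proof -
          have "q k = (\<Sum>s\<in>?G k \<union> ?H k. weight p s)" unfolding total_weight_def by (intro sum.cong) auto
          also have "\<dots> = (\<Sum>s\<in>?G k. weight p s) + (\<Sum>s\<in>?H k. weight p s)"
            by (intro sum.union_disjoint fin) auto
          finally show ?thesis using heavy[of k] by linarith
        qed
        have "tail (K n) - tail (L n) = (\<Sum>k\<in>{K n<..L n}. q k)" by (rule size_window_mass) (rule Ln)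
        also have "\<dots> \<le> (\<Sum>k\<in>{K n<..L n}. (\<Sum>s\<in>?G k. weight p s)) + (\<Sum>k\<in>{K n<..L n}. \<rho> ^ k)"
          unfolding sum.distrib[symmetric] by (intro sum_mono split)
        also have "(\<Sum>k\<in>{K n<..L n}. (\<Sum>s\<in>?G k. weight p s)) = (\<Sum>s\<in>(\<Union>k\<in>{K n<..L n}. ?G k). weight p s)"
          by (rule sum.UNION_disjoint[symmetric]) (auto simp: fin)
        also have "(\<Union>k\<in>{K n<..L n}. ?G k) = A" by (auto simp: A_def)
        also have "(\<Sum>k\<in>{K n<..L n}. \<rho> ^ k) \<le> exp (- b * ln (real n)) / (1 - \<rho>)"
        proof -
          have "(\<Sum>k\<in>{K n<..L n}. \<rho> ^ k) \<le> (\<Sum>k=K n..L n. \<rho> ^ k)" using \<rho> by (intro sum_mono2) auto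
          also have "\<dots> \<le> \<rho> ^ K n / (1 - \<rho>)"
            unfolding sum_gp using \<rho> by (auto intro!: divide_right_mono)
          also have "\<rho> ^ K n = exp (real (K n) * ln \<rho>)" using \<rho> by (simp add: exp_of_nat_mult)
          also have "\<dots> \<le> exp (c * ln (real n) * ln \<rho>)" using Kn \<rho> by (simp add: mult_right_mono_neg)
          also have "c * ln (real n) * ln \<rho> = - b * ln (real n)" by (simp add: b_def)
          finally show ?thesis using \<rho> by (simp add: divide_right_mono)
        qed
        finally show ?thesis by simp
      qed
      have E: "T * g n \<le> measure_pmf.expectation ?P ?D - \<gamma> * g n"
      proof -
        let ?m = "\<Sum>s\<in>A. weight p s"
        have m1: "?m \<le> 1" by (rule sum_weight_le_1[OF Afin(1)])
        have "(real n - real (L n)) * ?m \<le> real (n - L n) * ?m" by (intro mult_right_mono sum_nonneg) auto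
        then have f1: "real n * ?m - real (L n) * ?m \<le> real (n - L n) * ?m" by (simp only: left_diff_distrib)
        have f2: "real (L n) * ?m \<le> real (L n)" using mult_left_mono[OF m1, of "real (L n)"] by simp
        have "real n * (tail (K n) - tail (L n) - exp (- b * ln (real n)) / (1 - \<rho>)) \<le> real n * ?m"
          using mass by (intro mult_left_mono) auto
        then have f3: "real n * tail (K n) - real n * tail (L n) - real n * (exp (- b * ln (real n)) / (1 - \<rho>)) \<le> real n * ?m"
          by (simp only: right_diff_distrib)
        have f4: "real n * tail (K n) = g n * (tail (K n) * sqrt (ln (real n)))" by (subst g(1)) (simp add: mult_ac)
        have "g n * (l - \<gamma>) \<le> g n * (tail (K n) * sqrt (ln (real n)))"
          using elim(1) g(2) by (intro mult_left_mono) auto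
        then have f5: "g n * l - g n * \<gamma> \<le> g n * (tail (K n) * sqrt (ln (real n)))" by (simp only: right_diff_distrib)
        have f6: "real n * tail (L n) \<le> g n * \<gamma>"
        proof -
          have "sqrt ((ln (real n))\<^sup>2) * (1 / sqrt (ln (real n))) = sqrt (ln (real n))"
            using ln1 real_div_sqrt[of "ln (real n)"] by simp
          then have "tail (L n) * sqrt ((ln (real n))\<^sup>2) * (1 / sqrt (ln (real n))) = tail (L n) * sqrt (ln (real n))"
            by (simp only: mult.assoc)
          then have "tail (L n) * sqrt (ln (real n)) \<le> \<gamma>" using elim(2) by simp
          then have "g n * (tail (L n) * sqrt (ln (real n))) \<le> g n * \<gamma>" using g(2) by (intro mult_left_mono) auto
          moreover have "real n * tail (L n) = g n * (tail (L n) * sqrt (ln (real n)))"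
            by (subst g(1)) (simp add: mult_ac)
          ultimately show ?thesis by linarith
        qed
        have f7: "real (n - L n) * ?m - (real n)\<^sup>2 * exp (- (h * c) * ln (real n)) \<le> measure_pmf.expectation ?P ?D"
          by (rule expectation_distinct_occ_ge[OF Afin Asmall]) auto
        have f8: "T * g n = g n * l - 4 * (g n * \<gamma>)" by (simp add: \<gamma>_def field_simps)
        have f9: "\<gamma> * g n = g n * \<gamma>" by simp
        show ?thesis using f1 f2 f3 f4 f5 f6 f7 elim(3) Ln(1) unfolding f8 f9 by linarith
      qed
      have "(\<Sum>s | num_vertices s = n \<and> real (card (fringe_subtrees s)) < T * g n. weight p s)
          \<le> (\<Sum>s | num_vertices s = n \<and> code s \<in> {w. ?D w \<le> measure_pmf.expectation ?P ?D - \<gamma> * g n}. weight p s)"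
      proof (rule sum_mono2)
        show "finite {s. num_vertices s = n \<and> code s \<in> {w. ?D w \<le> measure_pmf.expectation ?P ?D - \<gamma> * g n}}"
          by (rule finite_subset[OF _ finite_plane_trees_of_size[of n]]) auto
        show "{s. num_vertices s = n \<and> real (card (fringe_subtrees s)) < T * g n}
          \<subseteq> {s. num_vertices s = n \<and> code s \<in> {w. ?D w \<le> measure_pmf.expectation ?P ?D - \<gamma> * g n}}"
        proof safe
          fix s assume "real (card (fringe_subtrees s)) < T * g (num_vertices s)" "n = num_vertices s"
          then show "?D (code s) \<le> measure_pmf.expectation (replicate_pmf (num_vertices s) \<xi>) ?D - \<gamma> * g (num_vertices s)"
            using E distinct_occ_le_card_fringe[of A s] by simp
        qed
      qed simp
      also have "\<dots> \<le> measure_pmf.prob ?P {w. ?D w \<le> measure_pmf.expectation ?P ?D - \<gamma> * g n}"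
        by (rule sum_trees_le_prob)
      also have "\<dots> \<le> exp (- 2 * (\<gamma> * g n)\<^sup>2 / (real n * (real (L n))\<^sup>2))"
      proof (rule mcdiarmid_le[where B = "real (card A)"])
        show "0 \<le> \<gamma> * g n" using \<gamma> g by simp
        show "\<bar>?D w - ?D (w[i := x])\<bar> \<le> real (L n)" for w i x
          by (rule abs_diff_update_le) (rule distinct_occ_update_le[OF Afin(2)])
        show "\<bar>?D w\<bar> \<le> real (card A)" for w
          unfolding distinct_occ_def using Afin(1) by (simp add: card_mono)
      qed simp
      also have "\<dots> \<le> exp (- (\<gamma>\<^sup>2 / 2) * real n / (ln (real n)) ^ 6)"
        unfolding g_def by (rule exp_mcdiarmid_bound) (use ln1 Ln in auto)
      also have "\<dots> \<le> q n / real n" using elim(6) q by blast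
      finally show "?G n" by (simp add: T_def g_def mult_ac)
    qed
  qed
qed

end

section \<open>Simply generated families\<close>

text \<open>Passes between power series at \<open>\<tau>\<close> and moments of
  \<open>\<xi>\<close>. As \<open>f\<close> is nonnegative, both sides amount to the value of one
  integral in \<open>ennreal\<close>.\<close>

lemma nat_pmf_expectation_sums:
  fixes f :: "nat \<Rightarrow> real"
  assumes f: "\<And>m. 0 \<le> f m"
  shows "(\<lambda>m. pmf p m * f m) sums S \<longleftrightarrow> integrable (measure_pmf p) f \<and> measure_pmf.expectation p f = S"
proof -
  have N: "(\<integral>\<^sup>+m. ennreal (f m) \<partial>p) = (\<Sum>m. ennreal (pmf p m * f m))"
    by (simp add: nn_integral_measure_pmf nn_integral_count_space_nat ennreal_mult')
  have pos: "0 \<le> pmf p m * f m" for m using f by simp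
  show ?thesis
  proof
    assume S: "(\<lambda>m. pmf p m * f m) sums S"
    then have "(\<integral>\<^sup>+m. ennreal (f m) \<partial>p) = ennreal S"
      unfolding N using pos by (simp add: suminf_ennreal2 sums_iff)
    moreover from this have int: "integrable (measure_pmf p) f"
      using f by (intro integrableI_nn_integral_finite[where x = S]) auto
    ultimately have "ennreal (measure_pmf.expectation p f) = ennreal S"
      using nn_integral_eq_integral[OF int] f by simp
    moreover have "0 \<le> S" using sums_unique[OF S] suminf_nonneg[OF sums_summable[OF S] pos] by simp
    moreover have "0 \<le> measure_pmf.expectation p f" using f by (intro integral_nonneg_AE) auto
    ultimately show "integrable (measure_pmf p) f \<and> measure_pmf.expectation p f = S"
      using int by (simp add: ennreal_inj)
  next
    assume a: "integrable (measure_pmf p) f \<and> measure_pmf.expectation p f = S"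
    then have eq: "(\<Sum>m. ennreal (pmf p m * f m)) = ennreal S"
      using nn_integral_eq_integral[of "measure_pmf p" f] f unfolding N[symmetric] by simp
    then have s: "summable (\<lambda>m. pmf p m * f m)" using pos by (intro summable_suminf_not_top) auto
    have "0 \<le> measure_pmf.expectation p f" using f by (intro integral_nonneg_AE) auto
    then have "0 \<le> S" using a by simp
    moreover have "ennreal (\<Sum>m. pmf p m * f m) = ennreal S" using eq s pos by (simp add: suminf_ennreal2)
    ultimately have "(\<Sum>m. pmf p m * f m) = S" using suminf_nonneg[OF s] pos by (simp add: ennreal_inj)
    then show "(\<lambda>m. pmf p m * f m) sums S" using s by (simp add: sums_iff)
  qed
qed

text \<open>The value 0 in the second case is the convention of \<open>infsum\<close> for families
  that are not summable.\<close>

lemma nat_pmf_infsum: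
  fixes f :: "nat \<Rightarrow> real"
  assumes f: "\<And>m. 0 \<le> f m" and M: "\<And>m. m \<notin> M \<Longrightarrow> pmf p m = 0"
  shows "(\<Sum>\<^sub>\<infinity>m\<in>M. pmf p m * f m) = (if integrable (measure_pmf p) f then measure_pmf.expectation p f else 0)"
proof (cases "integrable (measure_pmf p) f")
  case True
  then have "(\<lambda>m. pmf p m * f m) sums measure_pmf.expectation p f"
    using nat_pmf_expectation_sums[of f p] f by blast
  then have "((\<lambda>m. pmf p m * f m) has_sum measure_pmf.expectation p f) UNIV"
    by (rule sums_nonneg_imp_has_sum) (simp add: f)
  then have "((\<lambda>m. pmf p m * f m) has_sum measure_pmf.expectation p f) M"
    by (rule has_sum_cong_neutral[THEN iffD1, rotated -1]) (auto simp: M)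
  then show ?thesis using True by (simp add: infsumI)
next
  case False
  have "\<not> (\<lambda>m. pmf p m * f m) summable_on M"
  proof
    assume "(\<lambda>m. pmf p m * f m) summable_on M"
    then have "(\<lambda>m. pmf p m * f m) summable_on UNIV"
      by (rule summable_on_cong_neutral[THEN iffD1, rotated -1]) (auto simp: M)
    then have "summable (\<lambda>m. pmf p m * f m)" by (rule summable_on_imp_summable)
    then show False using False nat_pmf_expectation_sums[of f p] f by (metis summable_sums)
  qed
  then show ?thesis using False by (simp add: infsum_not_exists)
qed

section \<open>Tilted weights and the number of trees with given out-degrees\<close>

lemma sum_list_code: "Suc (sum_list (code t)) = num_vertices t"
proof (induction t)
  case (Node ts)
  have "length ts + sum_list (concat (map code ts)) = sum_list (map num_vertices ts)"
    using Node
  proof (induction ts)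
    case (Cons t ts)
    have "Suc (sum_list (code t)) = num_vertices t" using Cons.prems by simp
    moreover have "length ts + sum_list (concat (map code ts)) = sum_list (map num_vertices ts)"
      using Cons by simp
    ultimately show ?case by simp
  qed simp
  then show ?case by simp
qed

lemma weight_tilt:
  fixes \<tau> F :: real
  assumes "0 < \<tau>" "0 < F"
  shows "weight (\<lambda>m. a m * \<tau> ^ m / F) s = weight a s * (\<tau> ^ (num_vertices s - 1) / F ^ num_vertices s)"
proof -
  have "prod_list (map (\<lambda>m. a m * \<tau> ^ m / F) w) = prod_list (map a w) * (\<tau> ^ sum_list w / F ^ length w)" for w
    using assms by (induction w) (auto simp: field_simps power_add)
  \<comment> \<open>The out-degrees add up to the number of edges, which gives the exponent of
    \<open>\<tau>\<close>.\<close>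
  moreover have "sum_list (code s) = num_vertices s - 1" using sum_list_code[of s] by simp
  ultimately show ?thesis by (simp add: weight_code)
qed

lemma weight_no_leaf: "f 0 = 0 \<Longrightarrow> weight f t = 0"
proof (induction t)
  case (Node ts)
  show ?case
  proof (cases ts)
    case (Cons x xs)
    then have "weight f x = 0" using Node by simp
    then show ?thesis using Cons by simp
  qed (use Node in simp)
qed

text \<open>Counting by a probability law: each degree \<open>k\<close> in \<open>M\<close> gets
  probability \<open>\<upsilon> ^ k / Z\<close>. All trees of size \<open>k\<close> with degrees in
  \<open>M\<close> then have the same weight \<open>\<upsilon> ^ (k - 1) / Z ^ k\<close>, and the
  weights add up to at most 1. By \<open>\<upsilon> \<le> Z\<close> the bound for the largest size
  serves for all sizes up to \<open>K\<close>.\<close>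

lemma card_trees_with_degrees_le:
  fixes M :: "nat set" and \<upsilon> Z :: real
  assumes \<upsilon>: "0 < \<upsilon>" and Z: "(\<lambda>k. (if k \<in> M then 1 else 0) * \<upsilon> ^ k) sums Z" "0 < Z" and Z\<upsilon>: "\<upsilon> \<le> Z"
  shows "real (card {s. num_vertices s \<le> K \<and> set (code s) \<subseteq> M}) \<le> \<upsilon> * (real K + 1) * (Z / \<upsilon>) ^ K"
proof -
  define f where "f k = (if k \<in> M then 1 else 0) * \<upsilon> ^ k / Z" for k
  have f: "0 \<le> f k" for k using \<upsilon> Z by (simp add: f_def)
  have "f sums (Z / Z)" unfolding f_def by (intro sums_divide Z)
  then have f1: "(\<integral>\<^sup>+k. ennreal (f k) \<partial>count_space UNIV) = 1"
    using f Z(2) by (simp add: nn_integral_count_space_nat suminf_ennreal2 sums_iff)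
  define \<eta> where "\<eta> = embed_pmf f"
  have \<eta>: "pmf \<eta> = f" unfolding \<eta>_def using pmf_embed_pmf[OF f f1] by auto
  let ?S = "\<lambda>k. {s. num_vertices s = k \<and> set (code s) \<subseteq> M}"
  have fin: "finite (?S k)" for k
    by (rule finite_subset[OF _ finite_plane_trees_of_size[of k]]) auto
  have each: "real (card (?S k)) \<le> \<upsilon> * (Z / \<upsilon>) ^ k" for k
  proof (cases k)
    case 0
    have "num_vertices s \<noteq> 0" for s using num_vertices_pos[of s] by simp
    then have empty: "?S k = {}" using 0 by simp
    show ?thesis unfolding empty using \<upsilon> Z by simp
  next
    case (Suc j)
    have w: "weight (pmf \<eta>) s = \<upsilon> ^ j / Z ^ k" if s: "s \<in> ?S k" for s
    proof -
      have "prod_list (map (\<lambda>k. if k \<in> M then 1 else (0::real)) w) = 1" if "set w \<subseteq> M" for w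
        using that by (induction w) auto
      then have "weight (\<lambda>k. if k \<in> M then 1 else 0) s = 1" using s by (simp add: weight_code)
      then show ?thesis unfolding \<eta> f_def using s Suc by (subst weight_tilt[OF \<upsilon> Z(2)]) simp
    qed
    have "real (card (?S k)) * (\<upsilon> ^ j / Z ^ k) = (\<Sum>s\<in>?S k. weight (pmf \<eta>) s)" using w by simp
    also have "\<dots> \<le> 1" by (rule sum_weight_le_1[OF fin])
    finally show ?thesis using \<upsilon> Z(2) Suc by (simp add: field_simps power_divide)
  qed
  have "real (card {s. num_vertices s \<le> K \<and> set (code s) \<subseteq> M}) = real (card (\<Union>k\<le>K. ?S k))"
    by (rule arg_cong[where f = "\<lambda>X. real (card X)"]) auto
  also have "\<dots> \<le> (\<Sum>k\<le>K. real (card (?S k)))"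
    using card_UN_le[of "{..K}" ?S] by (simp flip: of_nat_sum)
  also have "\<dots> \<le> (\<Sum>k\<le>K. \<upsilon> * (Z / \<upsilon>) ^ K)"
  proof (rule sum_mono)
    fix k assume "k \<in> {..K}"
    then have "(Z / \<upsilon>) ^ k \<le> (Z / \<upsilon>) ^ K" using \<upsilon> Z\<upsilon> by (intro power_increasing) auto
    then show "real (card (?S k)) \<le> \<upsilon> * (Z / \<upsilon>) ^ K" using each[of k] \<upsilon> by (meson mult_left_mono less_imp_le order_trans)
  qed
  also have "\<dots> = \<upsilon> * (real K + 1) * (Z / \<upsilon>) ^ K" by simp
  finally show ?thesis .
qed

text \<open>As \<open>J \<le> n\<close>, an event of probability at most \<open>1 / n\<close> adds
  at most 1 to the mean, which is negligible because \<open>b2\<close> tends to infinity. The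
  hypotheses concern each fixed \<open>\<delta>\<close>, while the conclusion wants null sequences;
  for the means these are read off from the quotients of the mean by \<open>b1\<close> and by
  \<open>b2\<close>.\<close>

lemma asymptotic_bounds_from_tails:
  fixes T :: "nat \<Rightarrow> 'a pmf" and J :: "'a \<Rightarrow> real" and b1 b2 :: "nat \<Rightarrow> real" and F :: "nat filter"
  assumes F: "F \<le> sequentially"
    and J: "\<forall>\<^sub>F n in F. \<forall>t\<in>set_pmf (T n). 0 \<le> J t \<and> J t \<le> real n"
    and b1: "\<And>n. 0 \<le> b1 n" and b2: "filterlim b2 at_top sequentially"
    and lo: "\<And>\<delta>. 0 < \<delta> \<Longrightarrow> \<delta> < 1 \<Longrightarrow> \<forall>\<^sub>F n in F. measure_pmf.prob (T n) {t. J t < b1 n * (1 - \<delta>)} \<le> 1 / real n"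
    and hi: "\<And>\<delta>. 0 < \<delta> \<Longrightarrow> \<forall>\<^sub>F n in F. measure_pmf.prob (T n) {t. b2 n * (1 + \<delta>) < J t} \<le> 1 / real n"
  shows "(\<exists>\<epsilon>\<^sub>1 \<epsilon>\<^sub>2. (\<epsilon>\<^sub>1 \<longlongrightarrow> 0) F \<and> (\<epsilon>\<^sub>2 \<longlongrightarrow> 0) F \<and>
      (\<forall>\<^sub>F n in F. b1 n * (1 + \<epsilon>\<^sub>1 n) \<le> measure_pmf.expectation (T n) J \<and>
        measure_pmf.expectation (T n) J \<le> b2 n * (1 + \<epsilon>\<^sub>2 n))) \<and>
    (\<exists>\<epsilon>\<^sub>1 \<epsilon>\<^sub>2. (\<epsilon>\<^sub>1 \<longlongrightarrow> 0) F \<and> (\<epsilon>\<^sub>2 \<longlongrightarrow> 0) F \<and>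
      ((\<lambda>n. measure_pmf.prob (T n) {t. b1 n * (1 + \<epsilon>\<^sub>1 n) \<le> J t \<and> J t \<le> b2 n * (1 + \<epsilon>\<^sub>2 n)}) \<longlongrightarrow> 1) F)"
proof -
  let ?E = "\<lambda>n. measure_pmf.expectation (T n) J"
  have n_large: "\<forall>\<^sub>F n in F. x < real n" for x
    using F filterlim_at_top_dense[THEN iffD1, OF filterlim_real_sequentially, rule_format, of x]
    by (rule filter_leD)
  have b2_large: "\<forall>\<^sub>F n in F. x < b2 n" for x
    using F filterlim_at_top_dense[THEN iffD1, OF b2, rule_format, of x] by (rule filter_leD)
  have int: "integrable (measure_pmf (T n)) J" if "\<forall>t\<in>set_pmf (T n). 0 \<le> J t \<and> J t \<le> real n" for n
    by (rule integrable_bounded_pmf[where B = "real n"]) (use that in auto)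
  have E_lo: "\<forall>\<^sub>F n in F. b1 n * (1 - \<delta>) \<le> ?E n" if \<delta>: "0 < \<delta>" "\<delta> < 1" for \<delta>
  proof -
    have half: "0 < \<delta> / 2" "\<delta> / 2 < 1" using \<delta> by auto
    show ?thesis using lo[OF half] J n_large[of "2 / \<delta>"]
    proof eventually_elim
      case (elim n)
      let ?A = "{t. b1 n * (1 - \<delta> / 2) \<le> J t}"
      have "0 < 2 / \<delta>" using \<delta> by simp
      then have n0: "0 < real n" using elim(3) by linarith
      have n: "1 / real n \<le> \<delta> / 2"
        using elim(3) \<delta> n0 by (simp add: pos_divide_le_eq pos_divide_less_eq mult.commute)
      have "measure_pmf.prob (T n) ?A = 1 - measure_pmf.prob (T n) {t. J t < b1 n * (1 - \<delta> / 2)}"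
        using measure_pmf.prob_compl[of "{t. J t < b1 n * (1 - \<delta> / 2)}" "T n"]
        by (simp add: set_diff_eq not_less)
      then have A: "1 - \<delta> / 2 \<le> measure_pmf.prob (T n) ?A" using elim(1) n by linarith
      have "b1 n * (1 - \<delta>) \<le> b1 n * ((1 - \<delta> / 2) * (1 - \<delta> / 2))"
        using b1 \<delta> by (intro mult_left_mono) (auto simp: field_simps)
      also have "\<dots> = b1 n * (1 - \<delta> / 2) * (1 - \<delta> / 2)" by simp
      also have "\<dots> \<le> b1 n * (1 - \<delta> / 2) * measure_pmf.prob (T n) ?A"
        using A b1 half by (intro mult_left_mono) auto
      also have "\<dots> = measure_pmf.expectation (T n) (\<lambda>t. b1 n * (1 - \<delta> / 2) * indicator ?A t)" by simp
      also have "\<dots> \<le> ?E n"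
        using elim(2) b1[of n] half
        by (intro integral_mono_AE int integrable_bounded_pmf[where B = "b1 n * (1 - \<delta> / 2)"])
           (auto simp: AE_measure_pmf_iff indicator_def)
      finally show ?case .
    qed
  qed
  have E_hi: "\<forall>\<^sub>F n in F. ?E n \<le> b2 n * (1 + \<delta>)" if \<delta>: "0 < \<delta>" for \<delta>
  proof -
    have half: "0 < \<delta> / 2" using \<delta> by simp
    show ?thesis using hi[OF half] J n_large[of 0] b2_large[of "2 / \<delta>"]
    proof eventually_elim
      case (elim n)
      let ?B = "{t. b2 n * (1 + \<delta> / 2) < J t}"
      have "0 < 2 / \<delta>" using \<delta> by simp
      then have b2n: "0 < b2 n" using elim(4) by linarith
      have "0 \<le> b2 n * (1 + \<delta> / 2)" using b2n half by simp
      then have le: "J t \<le> b2 n * (1 + \<delta> / 2) + real n" if "t \<in> set_pmf (T n)" for t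
        using elim(2) that by (meson add_increasing)
      have "?E n \<le> measure_pmf.expectation (T n) (\<lambda>t. b2 n * (1 + \<delta> / 2) + real n * indicator ?B t)"
        using elim(2) b2n half le
        by (intro integral_mono_AE int integrable_bounded_pmf[where B = "b2 n * (1 + \<delta> / 2) + real n"])
           (auto simp: AE_measure_pmf_iff indicator_def)
      also have "\<dots> = b2 n * (1 + \<delta> / 2) + real n * measure_pmf.prob (T n) ?B"
      proof -
        have "integrable (measure_pmf (T n)) (\<lambda>t. real n * indicator ?B t)"
          by (rule integrable_bounded_pmf[where B = "real n"]) (simp add: indicator_def)
        then show ?thesis by (subst Bochner_Integration.integral_add) auto
      qed
      also have "\<dots> \<le> b2 n * (1 + \<delta> / 2) + real n * (1 / real n)"
        using elim(1) by (intro add_left_mono mult_left_mono) auto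
      also have "\<dots> \<le> b2 n * (1 + \<delta>)" using elim(3,4) \<delta> by (simp add: field_simps)
      finally show ?case .
    qed
  qed
  \<comment> \<open>Both sequences are clipped at 0, since only the defect matters. Where
    \<open>b1 n = 0\<close>, the lower bound is just nonnegativity of the mean.\<close>
  define \<epsilon>1 where "\<epsilon>1 n = (if 0 < b1 n then min 0 (?E n / b1 n - 1) else 0)" for n
  define \<epsilon>2 where "\<epsilon>2 n = max 0 (?E n / b2 n - 1)" for n
  have lim1: "(\<epsilon>1 \<longlongrightarrow> 0) F"
  proof (rule tendstoI)
    fix e :: real assume "0 < e"
    define d where "d = min (e / 2) (1 / 2)"
    have d: "0 < d" "d < 1" "d < e" using \<open>0 < e\<close> by (auto simp: d_def)
    show "\<forall>\<^sub>F n in F. dist (\<epsilon>1 n) 0 < e" using E_lo[OF d(1,2)]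
    proof eventually_elim
      case (elim n)
      have "- d \<le> \<epsilon>1 n"
      proof (cases "0 < b1 n")
        case True
        then have "1 - d \<le> ?E n / b1 n" using elim by (simp add: pos_le_divide_eq mult.commute)
        then show ?thesis using True d by (simp add: \<epsilon>1_def)
      qed (use d in \<open>simp add: \<epsilon>1_def\<close>)
      moreover have "\<epsilon>1 n \<le> 0" by (simp add: \<epsilon>1_def)
      ultimately show ?case using d by simp
    qed
  qed
  have lim2: "(\<epsilon>2 \<longlongrightarrow> 0) F"
  proof (rule tendstoI)
    fix e :: real assume "0 < e"
    then have d: "0 < e / 2" by simp
    show "\<forall>\<^sub>F n in F. dist (\<epsilon>2 n) 0 < e" using E_hi[OF d] b2_large[of 0]
    proof eventually_elim
      case (elim n)
      have "?E n / b2 n \<le> 1 + e / 2" using elim by (simp add: pos_divide_le_eq mult.commute)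
      then have "\<epsilon>2 n \<le> e / 2" unfolding \<epsilon>2_def using d by (intro max.boundedI) linarith+
      moreover have "0 \<le> \<epsilon>2 n" by (simp add: \<epsilon>2_def)
      ultimately show ?case using d by simp
    qed
  qed
  have bounds: "\<forall>\<^sub>F n in F. b1 n * (1 + \<epsilon>1 n) \<le> ?E n \<and> ?E n \<le> b2 n * (1 + \<epsilon>2 n)"
    using J b2_large[of 0]
  proof eventually_elim
    case (elim n)
    have "b1 n * (1 + \<epsilon>1 n) \<le> ?E n"
    proof (cases "0 < b1 n")
      case True
      have "b1 n * (1 + \<epsilon>1 n) \<le> b1 n * (?E n / b1 n)" using True by (intro mult_left_mono) (auto simp: \<epsilon>1_def)
      then show ?thesis using True by simp
    next
      case False
      then have "b1 n = 0" using b1[of n] by simp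
      moreover have "0 \<le> ?E n" using elim(1) by (intro integral_nonneg_AE) (auto simp: AE_measure_pmf_iff)
      ultimately show ?thesis by simp
    qed
    moreover have "?E n \<le> b2 n * (1 + \<epsilon>2 n)"
    proof -
      have "b2 n * (?E n / b2 n) \<le> b2 n * (1 + \<epsilon>2 n)" using elim by (intro mult_left_mono) (auto simp: \<epsilon>2_def)
      then show ?thesis using elim by simp
    qed
    ultimately show ?case by blast
  qed
  define good where "good n d = measure_pmf.prob (T n) {t. b1 n * (1 - d) \<le> J t \<and> J t \<le> b2 n * (1 + d)}" for n d
  define D where "D n = {d. 0 < d \<and> 1 - d \<le> good n d}" for n
  \<comment> \<open>Just above the infimum of the tolerances that work for \<open>n\<close>, so that one sequence serves all fixed tolerances.\<close>
  define \<epsilon> where "\<epsilon> n = Inf (D n) + 1 / real n" for n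
  \<comment> \<open>At tolerance 1 the required probability is 0, so \<open>D n\<close> is never
    empty and its infimum is meaningful.\<close>
  have one: "1 \<in> D n" for n by (simp add: D_def good_def)
  have bdd: "bdd_below (D n)" for n by (rule bdd_belowI[where m = 0]) (auto simp: D_def)
  have \<epsilon>_good: "\<forall>\<^sub>F n in F. 0 \<le> \<epsilon> n \<and> 1 - \<epsilon> n \<le> good n (\<epsilon> n)"
    using n_large[of 0] b2_large[of 0]
  proof eventually_elim
    case (elim n)
    have "Inf (D n) < \<epsilon> n" using elim by (simp add: \<epsilon>_def)
    then obtain d where d: "d \<in> D n" "d < \<epsilon> n" using cInf_less_iff[OF _ bdd] one by (metis empty_iff)
    have "good n d \<le> good n (\<epsilon> n)" unfolding good_def
    proof (rule measure_pmf.finite_measure_mono)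
      have "b1 n * (1 - \<epsilon> n) \<le> b1 n * (1 - d)" using d b1 by (intro mult_left_mono) auto
      moreover have "b2 n * (1 + d) \<le> b2 n * (1 + \<epsilon> n)" using d elim by (intro mult_left_mono) auto
      ultimately show "{t. b1 n * (1 - d) \<le> J t \<and> J t \<le> b2 n * (1 + d)}
        \<subseteq> {t. b1 n * (1 - \<epsilon> n) \<le> J t \<and> J t \<le> b2 n * (1 + \<epsilon> n)}" by auto
    qed simp
    then show ?case using d by (auto simp: D_def)
  qed
  have lim: "(\<epsilon> \<longlongrightarrow> 0) F"
  proof (rule tendstoI)
    fix e :: real assume "0 < e"
    define d where "d = min (e / 2) (1 / 2)"
    have d: "0 < d" "d < 1" "d \<le> e / 2" using \<open>0 < e\<close> by (auto simp: d_def)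
    show "\<forall>\<^sub>F n in F. dist (\<epsilon> n) 0 < e" using lo[OF d(1,2)] hi[OF d(1)] n_large[of "max (2 / d) (2 / e)"] \<epsilon>_good
    proof eventually_elim
      case (elim n)
      have "0 < 2 / d" "2 / d < real n" "2 / e < real n" using elim(3) d by auto
      moreover from this have n0: "0 < real n" by linarith
      ultimately have n: "2 / real n < d" "1 / real n < e / 2"
        using d(1) \<open>0 < e\<close> by (simp_all add: pos_divide_less_eq mult.commute)
      let ?X = "{t. J t < b1 n * (1 - d)}" and ?Y = "{t. b2 n * (1 + d) < J t}"
      have "1 - good n d = measure_pmf.prob (T n) (UNIV - {t. b1 n * (1 - d) \<le> J t \<and> J t \<le> b2 n * (1 + d)})"
        using measure_pmf.prob_compl[of "{t. b1 n * (1 - d) \<le> J t \<and> J t \<le> b2 n * (1 + d)}" "T n"] by (simp add: good_def)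
      also have "UNIV - {t. b1 n * (1 - d) \<le> J t \<and> J t \<le> b2 n * (1 + d)} = ?X \<union> ?Y" by auto
      also have "measure_pmf.prob (T n) (?X \<union> ?Y) \<le> measure_pmf.prob (T n) ?X + measure_pmf.prob (T n) ?Y"
        by (rule measure_Un_le) auto
      finally have "1 - good n d \<le> 2 / real n" using elim by simp
      then have "d \<in> D n" using n d by (simp add: D_def)
      then have "Inf (D n) \<le> d" by (rule cInf_lower[OF _ bdd])
      then show ?case using n d elim(4) by (simp add: \<epsilon>_def)
    qed
  qed
  have "((\<lambda>n. good n (\<epsilon> n)) \<longlongrightarrow> 1) F"
  proof (rule tendsto_sandwich)
    show "\<forall>\<^sub>F n in F. 1 - \<epsilon> n \<le> good n (\<epsilon> n)" using \<epsilon>_good by (rule eventually_mono) simp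
    show "\<forall>\<^sub>F n in F. good n (\<epsilon> n) \<le> 1" by (simp add: good_def)
    have "((\<lambda>n. 1 - \<epsilon> n) \<longlongrightarrow> 1 - 0) F" by (intro tendsto_intros lim)
    then show "((\<lambda>n. 1 - \<epsilon> n) \<longlongrightarrow> 1) F" by simp
  qed simp
  then have "((\<lambda>n. measure_pmf.prob (T n) {t. b1 n * (1 + - \<epsilon> n) \<le> J t \<and> J t \<le> b2 n * (1 + \<epsilon> n)}) \<longlongrightarrow> 1) F"
    by (simp add: good_def)
  moreover have "((\<lambda>n. - \<epsilon> n) \<longlongrightarrow> 0) F" using tendsto_minus[OF lim] by simp
  ultimately show ?thesis using lim lim1 lim2 bounds by blast
qed

section \<open>Fringe subtrees in simply generated families\<close>

lemma card_fringe_le_size: "card (fringe_subtrees t) \<le> num_vertices t"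
proof -
  have "num_vertices s \<noteq> 0" for s using num_vertices_pos[of s] by simp
  then have empty: "{s. num_vertices s \<le> 0 \<and> True} = {}" by simp
  \<comment> \<open>For \<open>K = 0\<close> there are no small trees, and every fringe subtree is
    charged to a position.\<close>
  have "card (fringe_subtrees t) \<le> card {s. num_vertices s \<le> 0 \<and> True} + no_small_occ 0 (code t)"
    by (rule card_fringe_le) simp
  also have "\<dots> = no_small_occ 0 (code t)" unfolding empty by simp
  also have "\<dots> \<le> card {..<length (code t)}" unfolding no_small_occ_def by (intro card_mono) auto
  finally show ?thesis by simp
qed

lemma admissible_sizes_no_leaf: "\<phi> 0 = 0 \<Longrightarrow> admissible_sizes \<phi> = bot"
  by (simp add: admissible_sizes_def total_weight_def weight_no_leaf)

text \<open>On the support of \<open>T n\<close> the count depends on the plane representation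
  alone, and the family prescribes the law of the latter.\<close>

lemma simply_generated_prob:
  assumes family: "simply_generated_family \<phi> plane_rep fringe T"
    and n: "0 < total_weight \<phi> n"
  shows "measure_pmf.prob (T n) {t. Q (num_distinct_fringe plane_rep fringe t)}
    = (\<Sum>s | num_vertices s = n \<and> Q (card (fringe_subtrees s)). weight \<phi> s) / total_weight \<phi> n"
proof -
  let ?P = "map_pmf plane_rep (T n)"
  have pmf: "pmf ?P s = (if num_vertices s = n then weight \<phi> s / total_weight \<phi> n else 0)" for s
    using family n unfolding simply_generated_family_def by blast
  have rep: "num_distinct_fringe plane_rep fringe t = card (fringe_subtrees (plane_rep t))" if "t \<in> set_pmf (T n)" for t
    using family n that unfolding simply_generated_family_def num_distinct_fringe_def by auto
  let ?S = "{s. num_vertices s = n \<and> Q (card (fringe_subtrees s))}"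
  have fin: "finite ?S" by (rule finite_subset[OF _ finite_plane_trees_of_size[of n]]) auto
  have sub: "s \<in> set_pmf ?P \<Longrightarrow> num_vertices s = n" for s using pmf by (metis pmf_eq_0_set_pmf)
  have "measure_pmf.prob (T n) {t. Q (num_distinct_fringe plane_rep fringe t)}
      = measure_pmf.prob (T n) {t. plane_rep t \<in> ?S}"
    using rep sub by (intro measure_pmf.finite_measure_eq_AE) (auto simp: AE_measure_pmf_iff)
  also have "\<dots> = measure_pmf.prob ?P ?S" by (simp add: vimage_def)
  also have "\<dots> = (\<Sum>s\<in>?S. weight \<phi> s / total_weight \<phi> n)"
    unfolding measure_measure_pmf_finite[OF fin] by (intro sum.cong) (auto simp: pmf)
  finally show ?thesis by (simp add: sum_divide_distrib)
qed

lemma simply_generated_size: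
  assumes family: "simply_generated_family \<phi> plane_rep fringe T"
    and n: "0 < total_weight \<phi> n" and t: "t \<in> set_pmf (T n)"
  shows "num_distinct_fringe plane_rep fringe t \<le> n"
proof -
  have "pmf (map_pmf plane_rep (T n)) (plane_rep t) \<noteq> 0" using t by (simp add: set_pmf_iff[symmetric])
  then have "num_vertices (plane_rep t) = n"
    using family n unfolding simply_generated_family_def by metis
  moreover have "num_distinct_fringe plane_rep fringe t = card (fringe_subtrees (plane_rep t))"
    using family n t unfolding simply_generated_family_def num_distinct_fringe_def by auto
  ultimately show ?thesis using card_fringe_le_size by metis
qed

lemma eventually_admissible:
  assumes "\<forall>\<^sub>F n in sequentially. 0 < total_weight \<phi> n \<longrightarrow> P n"
  shows "\<forall>\<^sub>F n in admissible_sizes \<phi>. P n"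
  using assms unfolding admissible_sizes_def by (simp add: eventually_inf_principal)

theorem theorem9:
  fixes \<phi> :: "nat \<Rightarrow> real"
    and plane_rep :: "'a \<Rightarrow> plane_tree"
    and fringe :: "'a \<Rightarrow> 'a set"
    and T :: "nat \<Rightarrow> 'a pmf"
    and \<Phi> \<Psi> :: "real fps"
    and \<xi> :: "nat pmf"
    and M :: "nat set"
    and J :: "'a \<Rightarrow> real"
    and \<tau> \<upsilon> \<kappa> \<mu> C1 C2 :: real
  assumes family: "simply_generated_family \<phi> plane_rep fringe T"
    and \<Phi>: "\<Phi> = Abs_fps \<phi>"
    and \<tau>_range: "0 < \<tau>" "ereal \<tau> \<le> fps_conv_radius \<Phi>"
    and \<tau>_conv: "summable (\<lambda>m. fps_nth \<Phi> m * \<tau> ^ m)"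
                "summable (\<lambda>m. fps_nth (fps_deriv \<Phi>) m * \<tau> ^ m)"
    and \<tau>_eq: "\<tau> * eval_fps (fps_deriv \<Phi>) \<tau> = eval_fps \<Phi> \<tau>"
    and \<xi>: "\<And>m. pmf \<xi> m = \<phi> m * \<tau> ^ m / eval_fps \<Phi> \<tau>"
    and finite_variance:
      "integrable (measure_pmf \<xi>) (\<lambda>m. (real m - measure_pmf.expectation \<xi> real)\<^sup>2)"
    and J: "\<And>t. J t = real (num_distinct_fringe plane_rep fringe t)"
    and \<kappa>: "\<kappa> = 2 * inverse \<tau> * eval_fps \<Phi> \<tau> powr (1 / 2)
                * (2 * pi * eval_fps (fps_deriv (fps_deriv \<Phi>)) \<tau>) powr (- 1 / 2)"
    and M: "M = {k. \<phi> k > 0}"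
    and \<Psi>: "\<Psi> = Abs_fps (\<lambda>k. if k \<in> M then 1 else 0)"
    and \<upsilon>: "0 < \<upsilon>" "ereal \<upsilon> < fps_conv_radius \<Psi>"
          "\<upsilon> * eval_fps (fps_deriv \<Psi>) \<upsilon> = eval_fps \<Psi> \<upsilon>"
    and C1: "C1 = ln (eval_fps (fps_deriv \<Psi>) \<upsilon>)"
    and \<mu>: "\<mu> = (\<Sum>\<^sub>\<infinity>m\<in>M. pmf \<xi> m * ln (pmf \<xi> m))"
    and C2: "C2 = - \<mu>"
  shows "(\<exists>\<epsilon>\<^sub>1 \<epsilon>\<^sub>2 :: nat \<Rightarrow> real.
      (\<epsilon>\<^sub>1 \<longlongrightarrow> 0) (admissible_sizes \<phi>) \<and> (\<epsilon>\<^sub>2 \<longlongrightarrow> 0) (admissible_sizes \<phi>) \<and>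
      (\<forall>\<^sub>F n in admissible_sizes \<phi>.
         \<kappa> * sqrt C2 * (real n / sqrt (ln (real n))) * (1 + \<epsilon>\<^sub>1 n) \<le> measure_pmf.expectation (T n) J \<and>
         measure_pmf.expectation (T n) J \<le> \<kappa> * sqrt C1 * (real n / sqrt (ln (real n))) * (1 + \<epsilon>\<^sub>2 n))) \<and>
    (\<exists>\<epsilon>\<^sub>1 \<epsilon>\<^sub>2 :: nat \<Rightarrow> real.
      (\<epsilon>\<^sub>1 \<longlongrightarrow> 0) (admissible_sizes \<phi>) \<and> (\<epsilon>\<^sub>2 \<longlongrightarrow> 0) (admissible_sizes \<phi>) \<and>
      ((\<lambda>n. measure_pmf.prob (T n)
         {t. \<kappa> * sqrt C2 * (real n / sqrt (ln (real n))) * (1 + \<epsilon>\<^sub>1 n) \<le> J t \<and>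
             J t \<le> \<kappa> * sqrt C1 * (real n / sqrt (ln (real n))) * (1 + \<epsilon>\<^sub>2 n)}) \<longlongrightarrow> 1)
        (admissible_sizes \<phi>))"
proof (cases "\<phi> 0 = 0")
  \<comment> \<open>No tree has positive weight, and the limits are along the trivial filter.\<close>
  case True
  show ?thesis unfolding admissible_sizes_no_leaf[of \<phi>, OF True] by simp
next
  case False
  have \<phi>: "0 \<le> \<phi> m" for m using family by (simp add: simply_generated_family_def)
  have \<phi>0: "0 < \<phi> 0" using False \<phi>[of 0] by simp
  define F where "F = eval_fps \<Phi> \<tau>"
  have F_sums: "(\<lambda>m. \<phi> m * \<tau> ^ m) sums F"
    using \<tau>_conv(1) unfolding F_def eval_fps_def \<Phi> by (simp add: summable_sums)
  have F: "0 < F"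
  proof -
    have "(\<Sum>m\<in>{0}. \<phi> m * \<tau> ^ m) \<le> (\<Sum>m. \<phi> m * \<tau> ^ m)"
      using F_sums \<phi> \<tau>_range(1) by (intro sum_le_suminf) (auto simp: sums_iff)
    then show ?thesis using \<phi>0 F_sums by (simp add: sums_iff)
  qed
  have p: "pmf \<xi> = (\<lambda>m. \<phi> m * \<tau> ^ m / F)" using \<xi> by (auto simp: F_def)
  have p_pos: "0 < pmf \<xi> m \<longleftrightarrow> m \<in> M" for m
    using F \<tau>_range(1) by (simp add: p M zero_less_divide_iff zero_less_mult_iff)
  \<comment> \<open>Criticality: \<open>\<tau> * \<Phi>'(\<tau>) / \<Phi>(\<tau>)\<close> is the
    mean of \<open>\<xi>\<close>. The coefficients of the derivative are shifted by one, and the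
    term \<open>m = 0\<close> of the mean vanishes.\<close>
  have "(\<lambda>m. pmf \<xi> m * real m) sums 1"
  proof -
    have "(\<lambda>m. fps_nth (fps_deriv \<Phi>) m * \<tau> ^ m) sums eval_fps (fps_deriv \<Phi>) \<tau>"
      using \<tau>_conv(2) unfolding eval_fps_def by (rule summable_sums)
    then have "(\<lambda>m. \<tau> / F * (fps_nth (fps_deriv \<Phi>) m * \<tau> ^ m)) sums (\<tau> / F * eval_fps (fps_deriv \<Phi>) \<tau>)"
      by (rule sums_mult)
    moreover have "\<tau> / F * eval_fps (fps_deriv \<Phi>) \<tau> = 1" using \<tau>_eq F by (simp add: F_def)
    moreover have "\<tau> / F * (fps_nth (fps_deriv \<Phi>) m * \<tau> ^ m) = pmf \<xi> (Suc m) * real (Suc m)" for m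
      using F by (simp add: p \<Phi> field_simps)
    ultimately have "(\<lambda>m. pmf \<xi> (Suc m) * real (Suc m)) sums 1" by (simp only:)
    then show ?thesis using sums_Suc_iff[of "\<lambda>m. pmf \<xi> m * real m" 1] by simp
  qed
  then have mean: "integrable (measure_pmf \<xi>) real" "measure_pmf.expectation \<xi> real = 1"
    using nat_pmf_expectation_sums[of real \<xi> 1] by auto
  have "integrable (measure_pmf \<xi>) (\<lambda>m. (real m)\<^sup>2)"
  proof -
    have "(\<lambda>m. (real m)\<^sup>2) = (\<lambda>m. (real m - 1)\<^sup>2 + (2 * real m - 1))"
      by (auto simp: power2_eq_square algebra_simps)
    then show ?thesis using finite_variance mean by simp
  qed
  then interpret critical_offspring \<xi>
    using mean(2) p_pos[of 0] \<phi>0 by unfold_locales (auto simp: M)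
  \<comment> \<open>After two such shifts \<open>\<Phi>''(\<tau>)\<close> becomes the second
    factorial moment; inserted into \<open>\<kappa>\<close>, it leaves
    \<open>sqrt (2 / (pi * var))\<close>.\<close>
  have "eval_fps (fps_deriv (fps_deriv \<Phi>)) \<tau> = F / \<tau>\<^sup>2 * var"
  proof -
    let ?f = "\<lambda>m. pmf \<xi> m * (real m * (real m - 1))"
    have nn: "0 \<le> real m * (real m - 1)" for m by (cases m) auto
    have "?f sums var"
      using nat_pmf_expectation_sums[of "\<lambda>m. real m * (real m - 1)" \<xi> var] nn integrable_falling
      by (simp add: var_def)
    then have "(\<lambda>m. ?f (Suc m)) sums var" using sums_Suc_iff[of ?f var] by simp
    then have "(\<lambda>m. ?f (Suc (Suc m))) sums var" using sums_Suc_iff[of "\<lambda>m. ?f (Suc m)" var] by simp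
    then have "(\<lambda>m. F / \<tau>\<^sup>2 * ?f (Suc (Suc m))) sums (F / \<tau>\<^sup>2 * var)" by (rule sums_mult)
    moreover have "F / \<tau>\<^sup>2 * ?f (Suc (Suc m)) = fps_nth (fps_deriv (fps_deriv \<Phi>)) m * \<tau> ^ m" for m
      using F \<tau>_range(1) by (simp add: p \<Phi> power2_eq_square field_simps)
    ultimately have "(\<lambda>m. fps_nth (fps_deriv (fps_deriv \<Phi>)) m * \<tau> ^ m) sums (F / \<tau>\<^sup>2 * var)"
      by (simp only:)
    then show ?thesis unfolding eval_fps_def by (rule sums_unique[symmetric])
  qed
  then have \<kappa>_eq: "\<kappa> = tail_const"
  proof -
    assume d2: "eval_fps (fps_deriv (fps_deriv \<Phi>)) \<tau> = F / \<tau>\<^sup>2 * var"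
    have "(2 * pi * (F / \<tau>\<^sup>2 * var)) powr (- 1 / 2) = 1 / sqrt (2 * pi * (F / \<tau>\<^sup>2 * var))"
      using powr_minus_divide[of "2 * pi * (F / \<tau>\<^sup>2 * var)" "1 / 2"] F var_pos by (simp add: powr_half_sqrt)
    then have "\<kappa> = 2 * inverse \<tau> * sqrt F * (1 / sqrt (2 * pi * (F / \<tau>\<^sup>2 * var)))"
      unfolding \<kappa> d2 using F by (simp add: powr_half_sqrt flip: F_def)
    also have "sqrt (2 * pi * (F / \<tau>\<^sup>2 * var)) = sqrt F / \<tau> * sqrt (2 * pi * var)"
    proof -
      have "2 * pi * (F / \<tau>\<^sup>2 * var) = F / \<tau>\<^sup>2 * (2 * pi * var)" by simp
      then show ?thesis using \<tau>_range(1) by (simp only: real_sqrt_mult real_sqrt_divide real_sqrt_abs abs_of_pos)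
    qed
    also have "2 * inverse \<tau> * sqrt F * (1 / (sqrt F / \<tau> * sqrt (2 * pi * var))) = 2 / sqrt (2 * pi * var)"
      using F \<tau>_range(1) by simp
    also have "\<dots> = tail_const"
    proof -
      have "2 / sqrt (2 * pi * var) = sqrt (2\<^sup>2) / sqrt (2 * pi * var)" by simp
      also have "\<dots> = sqrt (2\<^sup>2 / (2 * pi * var))" by (rule real_sqrt_divide[symmetric])
      also have "2\<^sup>2 / (2 * pi * var) = 2 / (pi * var)" by (simp add: power2_eq_square)
      finally show ?thesis by (simp add: tail_const_def)
    qed
    finally show ?thesis .
  qed
  define tilt where "tilt n = \<tau> ^ (n - 1) / F ^ n" for n
  have tilt: "0 < tilt n" for n using F \<tau>_range(1) by (simp add: tilt_def)
  have w: "weight (pmf \<xi>) s = weight \<phi> s * tilt (num_vertices s)" for s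
    unfolding p tilt_def by (rule weight_tilt[OF \<tau>_range(1) F])
  have q_tilt: "q n = total_weight \<phi> n * tilt n" for n
    unfolding total_weight_def by (simp add: w sum_distrib_right)
  have q_pos: "0 < q n \<longleftrightarrow> 0 < total_weight \<phi> n" for n
    using tilt[of n] by (simp add: q_tilt zero_less_mult_iff)
  have prob_J: "measure_pmf.prob (T n) {t. Q (J t)}
      = (\<Sum>s | num_vertices s = n \<and> Q (real (card (fringe_subtrees s))). weight (pmf \<xi>) s) / q n"
    if n: "0 < total_weight \<phi> n" for n Q
  proof -
    have "(\<Sum>s | num_vertices s = n \<and> Q (real (card (fringe_subtrees s))). weight (pmf \<xi>) s)
      = (\<Sum>s | num_vertices s = n \<and> Q (real (card (fringe_subtrees s))). weight \<phi> s) * tilt n"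
      unfolding sum_distrib_right by (intro sum.cong) (auto simp: w)
    then show ?thesis
      using simply_generated_prob[OF family n, of "\<lambda>x. Q (real x)"] tilt[of n] by (simp add: J q_tilt)
  qed
  have rare: "\<forall>\<^sub>F n in admissible_sizes \<phi>. measure_pmf.prob (T n) {t. Q n (J t)} \<le> 1 / real n"
    if "\<forall>\<^sub>F n in sequentially. 0 < q n \<longrightarrow>
      (\<Sum>s | num_vertices s = n \<and> Q n (real (card (fringe_subtrees s))). weight (pmf \<xi>) s) \<le> q n / real n" for Q
  proof (rule eventually_admissible, use that in eventually_elim)
    case (elim n)
    show ?case
    proof
      assume n: "0 < total_weight \<phi> n"
      then have "0 < q n" by (simp add: q_pos)
      then show "measure_pmf.prob (T n) {t. Q n (J t)} \<le> 1 / real n"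
        using elim unfolding prob_J[OF n] by (simp add: pos_divide_le_eq)
    qed
  qed

  \<comment> \<open>Outside \<open>M\<close> the value is 0, by the convention
    \<open>ln 0 = 0\<close>.\<close>
  have X: "0 \<le> - ln (pmf \<xi> m)" for m
    using pmf_le_1[of \<xi> m] pmf_nonneg[of \<xi> m] by (cases "pmf \<xi> m = 0") (auto simp: ln_le_zero_iff)
  \<comment> \<open>If the sum that defines \<open>\<mu>\<close> diverges, it is 0 by convention, and the lower bounds are trivial.\<close>
  have C2_eq: "C2 = (if integrable (measure_pmf \<xi>) (\<lambda>m. ln (pmf \<xi> m)) then - measure_pmf.expectation \<xi> (\<lambda>m. ln (pmf \<xi> m)) else 0)"
  proof -
    have "C2 = (\<Sum>\<^sub>\<infinity>m\<in>M. pmf \<xi> m * - ln (pmf \<xi> m))" unfolding C2 \<mu> infsum_uminus[symmetric] by simp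
    also have "\<dots> = (if integrable (measure_pmf \<xi>) (\<lambda>m. - ln (pmf \<xi> m)) then measure_pmf.expectation \<xi> (\<lambda>m. - ln (pmf \<xi> m)) else 0)"
      using p_pos by (intro nat_pmf_infsum[of "\<lambda>m. - ln (pmf \<xi> m)"] X) (metis pmf_nonneg order_le_less)
    finally show ?thesis by simp
  qed
  have C2_nonneg: "0 \<le> C2"
    using X unfolding C2_eq by (auto simp flip: integral_minus intro!: integral_nonneg_AE)
  have lower: "\<forall>\<^sub>F n in admissible_sizes \<phi>.
      measure_pmf.prob (T n) {t. J t < \<kappa> * sqrt C2 * (real n / sqrt (ln (real n))) * (1 - \<delta>)} \<le> 1 / real n"
    if \<delta>: "0 < \<delta>" "\<delta> < 1" for \<delta>
  proof (cases "0 < C2")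
    case True
    then have int: "integrable (measure_pmf \<xi>) (\<lambda>m. ln (pmf \<xi> m))"
      and H: "C2 = - measure_pmf.expectation \<xi> (\<lambda>m. ln (pmf \<xi> m))" by (auto simp: C2_eq split: if_splits)
    show ?thesis
      by (rule rare) (use few_fringe_subtrees_rare[OF int _ \<delta>] True in \<open>simp add: \<kappa>_eq H\<close>)
  next
    case False
    then have "C2 = 0" using C2_nonneg by simp
    moreover have "{t. J t < 0} = {}" by (auto simp: J not_less)
    ultimately show ?thesis by simp
  qed

  have \<Psi>_sums: "(\<lambda>k. (if k \<in> M then 1 else 0) * \<upsilon> ^ k) sums eval_fps \<Psi> \<upsilon>"
    using summable_fps[of \<upsilon> \<Psi>] \<upsilon>(1,2) unfolding eval_fps_def by (simp add: \<Psi> summable_sums)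
  obtain k where k: "2 \<le> k" "k \<in> M" using branching p_pos by blast
  \<comment> \<open>\<open>M\<close> contains 0 and some \<open>k \<ge> 2\<close>, so
    \<open>\<Psi>(\<upsilon>) \<ge> 1 + \<upsilon> ^ k > \<upsilon>\<close>. This makes
    \<open>C1\<close> positive and provides the hypothesis \<open>\<upsilon> \<le> Z\<close> of the
    counting lemma.\<close>
  have \<Psi>_ge: "1 + \<upsilon> ^ k \<le> eval_fps \<Psi> \<upsilon>"
  proof -
    have "(\<Sum>j\<in>{0, k}. (if j \<in> M then 1 else 0) * \<upsilon> ^ j) \<le> (\<Sum>j. (if j \<in> M then 1 else 0) * \<upsilon> ^ j)"
      using \<Psi>_sums \<upsilon>(1) by (intro sum_le_suminf) (auto simp: sums_iff)
    moreover have "0 \<in> M" using \<phi>0 by (simp add: M)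
    ultimately show ?thesis using k \<Psi>_sums by (auto simp: sums_iff)
  qed
  have \<Psi>_gt: "\<upsilon> < eval_fps \<Psi> \<upsilon>"
  proof (cases "\<upsilon> \<le> 1")
    case True
    have "0 < \<upsilon> ^ k" using \<upsilon>(1) by simp
    then show ?thesis using True \<Psi>_ge by linarith
  next
    case False
    then have "\<upsilon> ^ 1 \<le> \<upsilon> ^ k" using k by (intro power_increasing) auto
    then show ?thesis using \<Psi>_ge by simp
  qed
  \<comment> \<open>The equation for \<open>\<upsilon>\<close> identifies the growth base
    \<open>Z / \<upsilon>\<close> of the counting lemma with
    \<open>\<Psi>'(\<upsilon>) = exp C1\<close>.\<close>
  have \<Psi>': "eval_fps (fps_deriv \<Psi>) \<upsilon> = eval_fps \<Psi> \<upsilon> / \<upsilon>" using \<upsilon>(1,3) by (simp add: field_simps)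
  have "1 < eval_fps \<Psi> \<upsilon> / \<upsilon>" using \<Psi>_gt \<upsilon>(1) by simp
  then have C1_pos: "0 < C1" and exp_C1: "exp C1 = eval_fps \<Psi> \<upsilon> / \<upsilon>" unfolding C1 \<Psi>' by auto
  have count: "real (card {s. num_vertices s \<le> K \<and> 0 < weight (pmf \<xi>) s}) \<le> \<upsilon> * (real K + 1) * exp (C1 * real K)" for K
  proof -
    have pos: "set (code s) \<subseteq> M" if "0 < weight (pmf \<xi>) s" for s
    proof
      fix m assume m: "m \<in> set (code s)"
      have "prod_list (map (pmf \<xi>) (code s)) \<noteq> 0" using that by (simp add: weight_code)
      then have "0 \<notin> pmf \<xi> ` set (code s)" by (simp only: prod_list_zero_iff set_map) simp
      then have "pmf \<xi> m \<noteq> 0" using m by (metis imageI)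
      then show "m \<in> M" using p_pos[of m] pmf_nonneg[of \<xi> m] by linarith
    qed
    have "card {s. num_vertices s \<le> K \<and> 0 < weight (pmf \<xi>) s} \<le> card {s. num_vertices s \<le> K \<and> set (code s) \<subseteq> M}"
      using pos by (intro card_mono finite_subset[OF _ finite_trees_size_le[of K]]) auto
    also have "real \<dots> \<le> \<upsilon> * (real K + 1) * (eval_fps \<Psi> \<upsilon> / \<upsilon>) ^ K"
      using \<upsilon>(1) \<Psi>_gt by (intro card_trees_with_degrees_le[OF _ \<Psi>_sums]) auto
    also have "(eval_fps \<Psi> \<upsilon> / \<upsilon>) ^ K = exp (C1 * real K)"
      unfolding exp_C1[symmetric] exp_of_nat_mult[symmetric] by (simp add: mult.commute)
    finally show ?thesis by simp
  qed
  have upper: "\<forall>\<^sub>F n in admissible_sizes \<phi>.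
      measure_pmf.prob (T n) {t. \<kappa> * sqrt C1 * (real n / sqrt (ln (real n))) * (1 + \<delta>) < J t} \<le> 1 / real n"
    if \<delta>: "0 < \<delta>" for \<delta>
    unfolding \<kappa>_eq by (rule rare) (rule many_fringe_subtrees_rare[OF C1_pos \<delta> count])

  show ?thesis
  proof (rule asymptotic_bounds_from_tails)
    show "admissible_sizes \<phi> \<le> sequentially" by (simp add: admissible_sizes_def)
    show "\<forall>\<^sub>F n in admissible_sizes \<phi>. \<forall>t\<in>set_pmf (T n). 0 \<le> J t \<and> J t \<le> real n"
      using simply_generated_size[OF family] by (intro eventually_admissible always_eventually) (auto simp: J)
    show "0 \<le> \<kappa> * sqrt C2 * (real n / sqrt (ln (real n)))" for n
    proof (cases "n = 0")
      case False
      then show ?thesis using tail_const_pos C2_nonneg by (simp add: \<kappa>_eq)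
    qed simp
    have "filterlim (\<lambda>n. c * (real n / sqrt (ln (real n)))) at_top sequentially" if "0 < c" for c :: real
      using that by real_asymp
    then show "filterlim (\<lambda>n. \<kappa> * sqrt C1 * (real n / sqrt (ln (real n)))) at_top sequentially"
      using tail_const_pos C1_pos by (simp add: \<kappa>_eq)
  qed (fact lower upper)+
qed

end
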